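(* Let $\sigma_0>0$ and $\lambda>0$. Let $F(\mu)=F_\circ(\mu)+\int_{\mathbb{R}^n}f\,d\mu$ for $\mu\in\mathcal{P}_2(\mathbb{R}^n)$, where $F_\circ:\mathcal{P}_2(\mathbb{R}^n)\to[0,\infty)$ is of class $\mathcal{C}^\infty$ and $f:\mathbb{R}^n\to[0,\infty)$ is $C^\infty$ with $f(x)\ge\lambda|x|^2$ for all $x\in\mathbb{R}^n$. Assume that for each $k\ge2$ the derivative $D_m^kF$ is bounded, and that there is a constant $C$ with $$|D_mF(\mu_1,x_1)-D_mF(\mu_2,x_2)|\le C\big(\mathcal{W}_1(\mu_1,\mu_2)+|x_1-x_2|\big)\quad\text{for all }\mu_1,\mu_2\in\mathcal{P}_2(\mathbb{R}^n),\ x_1,x_2\in\mathbb{R}^n.$$ Let $m_0$ be a probability measure on $\mathbb{R}^n\times\mathbb{R}^n$ with $\int(|x|^p+|v|^p)\,m_0(dx,dv)<\infty$ for all $p\ge1$, with $H(m_0)<\infty$ and $\mathfrak{F}(m_0)<\infty$. For each $\gamma>0$ let $(X^\gamma,V^\gamma)$ be the solution, with $\mathcal{L}(X^\gamma_0,V^\gamma_0)=m_0$, of $$dX^\gamma_t=V^\gamma_t\,dt,\qquad dV^\gamma_t=-\big(D_mF(\mathcal{L}(X^\gamma_t),X^\gamma_t)+\gamma V^\gamma_t\big)dt+\sigma_0\sqrt{\gamma}\,dW_t,$$ where $W$ is an $n$-dimensional standard Brownian motion. Then, for all $t\ge0$, $X^\gamma_{\gamma t}\to Y_t$ in distribution as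 $\gamma\to\infty$, where $Y$ is the overdamped mean-field Langevin dynamics defined by $$dY_t=-D_mF(\mathcal{L}(Y_t),Y_t)\,dt+\sigma_0\,dW_t\ \ (t>0),\qquad \mathcal{L}(Y_0)=m_0^X.$$
   Context: $\mathcal{L}(\cdot)$ denotes the law. $\mathcal{P}_2(\mathbb{R}^d)$ is the set of probability measures on $\mathbb{R}^d$ with finite second moment, with continuity understood in the $2$-Wasserstein distance; $\mathcal{W}_p$ is the $p$-Wasserstein distance. For $m\in\mathcal{P}_2(\mathbb{R}^n\times\mathbb{R}^n)$, $m^X$ is the pushforward of $m$ under $(x,v)\mapsto x$. $F:\mathcal{P}_2(\mathbb{R}^n)\to\mathbb{R}$ is of class $\mathcal{C}^1$ if there is a continuous $\frac{\delta F}{\delta m}:\mathcal{P}_2(\mathbb{R}^n)\times\mathbb{R}^n\to\mathbb{R}$ with $|\frac{\delta F}{\delta m}(m,x)|\le C(1+|x|^2)$ for some $C>0$ and $F(m')-F(m)=\int_0^1\int_{\mathbb{R}^n}\frac{\delta F}{\delta m}((1-u)m+um',x)\,(m'-m)(dx)\,du$ for all $m,m'\in\mathcal{P}_2(\mathbb{R}^n)$. When $\frac{\delta F}{\delta m}$ is continuously differentiable in $x$, the intrinsic derivative is $D_mF(m,x):=\nabla_x\frac{\delta F}{\delta m}(m,x)$. $D^k_mF(m,x_1,\dots,x_k)$ denotes the iterated intrinsic derivative. $F\in\mathcal{C}^\infty$ means that for all $k$ and $i_1,\dots,i_k\in\mathbb{N}$ the derivatives $\partial_{x_1}^{i_1}\cdots\partial_{x_k}^{i_k}D_m^kF(m,x_1,\dots,x_k)$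 exist and are continuous. For $F=F_\circ+\int f\,d\mu$ one sets $\frac{\delta F}{\delta m}(\mu,x):=\frac{\delta F_\circ}{\delta m}(\mu,x)+f(x)$ and $D_mF(\mu,x):=D_mF_\circ(\mu,x)+\nabla f(x)$. $H(m):=\int\log(m(x,v))\,m(x,v)\,dx\,dv$ if $m\in\mathcal{P}_2(\mathbb{R}^n\times\mathbb{R}^n)$ has a density $m(x,v)$, and $H(m):=\infty$ otherwise. With $\sigma=\sigma_0\sqrt{\gamma}$, the free energy is $\mathfrak{F}(m):=F(m^X)+\int\frac{|v|^2}{2}m(dx,dv)+\frac{\sigma^2}{2\gamma}H(m)=F(m^X)+\int\frac{|v|^2}{2}m(dx,dv)+\frac{\sigma_0^2}{2}H(m)$, which does not depend on $\gamma$. *)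

theory Defs
  imports "HOL-Probability.Probability"
begin

section \<open>Measures with finite second moment and Wasserstein distances\<close>

definition P2 :: "'a::euclidean_space measure set" where
  "P2 = {\<mu>. prob_space \<mu> \<and> sets \<mu> = sets borel \<and>
             (\<integral>\<^sup>+x. ennreal ((norm x)\<^sup>2) \<partial>\<mu>) < \<infinity>}"

definition couplings ::
  "'a::euclidean_space measure \<Rightarrow> 'a measure \<Rightarrow> ('a \<times> 'a) measure set" where
  "couplings \<mu> \<nu> =
     {\<pi>. sets \<pi> = sets borel \<and> distr \<pi> borel fst = \<mu> \<and> distr \<pi> borel snd = \<nu>}"

text \<open>Real-valued; the infimum is finite for measures with finite \<open>p\<close>-th moment, in particular
  on \<open>P2\<close> when \<open>1 \<le> p \<le> 2\<close>.\<close>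

definition wasserstein :: "real \<Rightarrow> 'a::euclidean_space measure \<Rightarrow> 'a measure \<Rightarrow> real" where
  "wasserstein p \<mu> \<nu> =
     enn2real (INF \<pi> \<in> couplings \<mu> \<nu>. \<integral>\<^sup>+z. ennreal (dist (fst z) (snd z) powr p) \<partial>\<pi>) powr (1 / p)"

text \<open>The convex combination \<open>(1 - u) m + u m'\<close>, for \<open>0 \<le> u \<le> 1\<close>.\<close>

definition mix :: "real \<Rightarrow> 'a measure \<Rightarrow> 'a measure \<Rightarrow> 'a measure" where
  "mix u m m' = measure_of (space m) (sets m)
     (\<lambda>A. ennreal (1 - u) * emeasure m A + ennreal u * emeasure m' A)"

text \<open>Points of \<open>(\<real>\<^sup>n)\<^sup>k\<close> are lists of length \<open>k\<close>; continuity on \<open>P2 \<times> (\<real>\<^sup>n)\<^sup>k\<close>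
  refers to the 2-Wasserstein distance in the first argument.\<close>

definition continuous_P2 ::
  "nat \<Rightarrow> ('a::euclidean_space measure \<Rightarrow> 'a list \<Rightarrow> real) \<Rightarrow> bool" where
  "continuous_P2 k g \<longleftrightarrow>
     (\<forall>m\<in>P2. \<forall>xs. length xs = k \<longrightarrow> (\<forall>e>0. \<exists>d>0. \<forall>m'\<in>P2. \<forall>ys. length ys = k \<longrightarrow>
        wasserstein 2 m m' < d \<longrightarrow> (\<forall>j<k. dist (xs ! j) (ys ! j) < d) \<longrightarrow>
        \<bar>g m' ys - g m xs\<bar> < e))"


section \<open>Smooth functions on Euclidean space\<close>

definition grad :: "('a::real_inner \<Rightarrow> real) \<Rightarrow> 'a \<Rightarrow> 'a" where
  "grad f x = (THE D. GDERIV f x :> D)"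

primrec Ck :: "nat \<Rightarrow> (real^'n \<Rightarrow> real) \<Rightarrow> bool" where
  "Ck 0 f \<longleftrightarrow> continuous_on UNIV f"
| "Ck (Suc k) f \<longleftrightarrow> (\<forall>x. f differentiable (at x)) \<and> (\<forall>i. Ck k (\<lambda>x. grad f x $ i))"

definition smooth_fun :: "(real^'n \<Rightarrow> real) \<Rightarrow> bool" where
  "smooth_fun f \<longleftrightarrow> (\<forall>k. Ck k f)"


section \<open>Linear functional and intrinsic derivatives\<close>

text \<open>Functionals are total functions on measures, but only their values on \<open>P2\<close> matter.\<close>

definition is_linear_derivative ::
  "((real^'n) measure \<Rightarrow> real) \<Rightarrow> ((real^'n) measure \<Rightarrow> real^'n \<Rightarrow> real) \<Rightarrow> bool" where
  "is_linear_derivative F G \<longleftrightarrow>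
     continuous_P2 1 (\<lambda>m xs. G m (xs ! 0)) \<and>
     (\<exists>C>0. \<forall>m\<in>P2. \<forall>x. \<bar>G m x\<bar> \<le> C * (1 + (norm x)\<^sup>2)) \<and>
     (\<forall>m\<in>P2. \<forall>m'\<in>P2.
        F m' - F m = (LBINT u:{0..1}. (\<integral>x. G (mix u m m') x \<partial>m') - (\<integral>x. G (mix u m m') x \<partial>m)))"

definition class_C1 :: "((real^'n) measure \<Rightarrow> real) \<Rightarrow> bool" where
  "class_C1 F \<longleftrightarrow> (\<exists>G. is_linear_derivative F G)"

text \<open>A linear functional derivative is determined on \<open>P2\<close> up to an additive term \<open>c m\<close> that does
  not depend on \<open>x\<close>. Hence neither the differentiability in \<open>x\<close> nor the intrinsic derivative
  depends on the version that is chosen here.\<close>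

definition linear_derivative ::
  "((real^'n) measure \<Rightarrow> real) \<Rightarrow> (real^'n) measure \<Rightarrow> real^'n \<Rightarrow> real" where
  "linear_derivative F = (SOME G. is_linear_derivative F G)"

definition intrinsically_differentiable :: "((real^'n) measure \<Rightarrow> real) \<Rightarrow> bool" where
  "intrinsically_differentiable F \<longleftrightarrow>
     class_C1 F \<and> (\<forall>m\<in>P2. Ck 1 (linear_derivative F m))"

definition intrinsic_derivative ::
  "((real^'n) measure \<Rightarrow> real) \<Rightarrow> (real^'n) measure \<Rightarrow> real^'n \<Rightarrow> real^'n" where
  "intrinsic_derivative F m x = grad (linear_derivative F m) x"

text \<open>\<open>iterated_derivative F [i\<^sub>1,\<dots>,i\<^sub>k] m [x\<^sub>1,\<dots>,x\<^sub>k]\<close> is the component \<open>(i\<^sub>1,\<dots>,i\<^sub>k)\<close> of the tensor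
  \<open>D\<^sub>m\<^sup>k F(m, x\<^sub>1,\<dots>,x\<^sub>k)\<close>: the variable \<open>x\<^sub>1\<close> belongs to the derivative that is taken first and is
  frozen when the next derivative in \<open>m\<close> is taken.\<close>

fun iterated_derivative ::
  "((real^'n) measure \<Rightarrow> real) \<Rightarrow> 'n list \<Rightarrow> (real^'n) measure \<Rightarrow> (real^'n) list \<Rightarrow> real" where
  "iterated_derivative F (i # js) m (x # xs) =
     iterated_derivative (\<lambda>\<mu>. intrinsic_derivative F \<mu> x $ i) js m xs"
| "iterated_derivative F _ m _ = F m"

text \<open>The \<open>i\<close>-th partial derivative in the \<open>j\<close>-th (counted from 0) of the variables in \<open>xs\<close>.\<close>

definition slot_derivative ::
  "nat \<Rightarrow> 'n \<Rightarrow> ((real^'n) list \<Rightarrow> real) \<Rightarrow> (real^'n) list \<Rightarrow> real" where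
  "slot_derivative j i g xs = grad (\<lambda>y. g (xs[j := y])) (xs ! j) $ i"

primrec spatial_derivative ::
  "(nat \<times> 'n) list \<Rightarrow> ((real^'n) list \<Rightarrow> real) \<Rightarrow> (real^'n) list \<Rightarrow> real" where
  "spatial_derivative [] g = g"
| "spatial_derivative (d # ds) g = slot_derivative (fst d) (snd d) (spatial_derivative ds g)"

text \<open>A list \<open>ds\<close> that is sorted by slots and has \<open>n\<^sub>j\<close> entries in slot \<open>j\<close> stands for a component
  of the mixed derivative of order \<open>n\<^sub>j\<close> in the \<open>j\<close>-th point, where the derivatives in the last
  point are taken first. The second conjunct says that these derivatives of \<open>D\<^sub>m\<^sup>k F\<close> are
  continuous, the third one that the next derivative exists.\<close>

definition class_Cinf :: "((real^'n) measure \<Rightarrow> real) \<Rightarrow> bool" where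
  "class_Cinf F \<longleftrightarrow>
     (\<forall>js xs. length xs = length js \<longrightarrow>
        intrinsically_differentiable (\<lambda>\<mu>. iterated_derivative F js \<mu> xs)) \<and>
     (\<forall>js ds. sorted (map fst ds) \<longrightarrow> (\<forall>d\<in>set ds. fst d < length js) \<longrightarrow>
        continuous_P2 (length js) (\<lambda>m. spatial_derivative ds (iterated_derivative F js m))) \<and>
     (\<forall>js ds j. sorted (j # map fst ds) \<longrightarrow> j < length js \<longrightarrow>
        (\<forall>d\<in>set ds. fst d < length js) \<longrightarrow>
        (\<forall>m\<in>P2. \<forall>xs. length xs = length js \<longrightarrow>
           (\<lambda>y. spatial_derivative ds (iterated_derivative F js m) (xs[j := y]))
             differentiable (at (xs ! j))))"

text \<open>The derivatives of \<open>F(\<mu>) = F\<^sub>0(\<mu>) + \<integral>f d\<mu>\<close>, with the convention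
  \<open>D\<^sub>m F(\<mu>, x) = D\<^sub>m F\<^sub>0(\<mu>, x) + \<nabla>f(x)\<close>; the higher derivatives are the iterated intrinsic
  derivatives of the components of \<open>D\<^sub>m F(\<cdot>, x\<^sub>1)\<close>.\<close>

definition Dm ::
  "((real^'n) measure \<Rightarrow> real) \<Rightarrow> (real^'n \<Rightarrow> real) \<Rightarrow> (real^'n) measure \<Rightarrow> real^'n \<Rightarrow> real^'n" where
  "Dm F\<^sub>0 f \<mu> x = intrinsic_derivative F\<^sub>0 \<mu> x + grad f x"

definition bounded_higher_Dm ::
  "((real^'n) measure \<Rightarrow> real) \<Rightarrow> (real^'n \<Rightarrow> real) \<Rightarrow> nat \<Rightarrow> bool" where
  "bounded_higher_Dm F\<^sub>0 f k \<longleftrightarrow>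
     (\<exists>B. \<forall>i js x xs m. Suc (length js) = k \<longrightarrow> length xs = length js \<longrightarrow> m \<in> P2 \<longrightarrow>
        \<bar>iterated_derivative (\<lambda>\<mu>. Dm F\<^sub>0 f \<mu> x $ i) js m xs\<bar> \<le> B)"


section \<open>Entropy and free energy\<close>

text \<open>On \<open>P2\<close> the negative part of \<open>\<rho> log \<rho>\<close> is integrable, so that the difference below is never
  of the form \<open>\<infinity> - \<infinity>\<close>.\<close>

definition entropy_H :: "'a::euclidean_space measure \<Rightarrow> ereal" where
  "entropy_H m =
     (if \<exists>\<rho>\<in>borel_measurable borel. m = density lborel \<rho>
      then let h = (\<lambda>z. let r = enn2real (RN_deriv lborel m z) in r * ln r) in
        enn2ereal (\<integral>\<^sup>+z. ennreal (h z) \<partial>lborel) - enn2ereal (\<integral>\<^sup>+z. ennreal (- h z) \<partial>lborel)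
      else \<infinity>)"

definition potential_energy ::
  "((real^'n) measure \<Rightarrow> real) \<Rightarrow> (real^'n \<Rightarrow> real) \<Rightarrow> (real^'n) measure \<Rightarrow> ereal" where
  "potential_energy F\<^sub>0 f \<mu> = ereal (F\<^sub>0 \<mu>) + enn2ereal (\<integral>\<^sup>+x. ennreal (f x) \<partial>\<mu>)"

definition free_energy ::
  "((real^'n) measure \<Rightarrow> real) \<Rightarrow> (real^'n \<Rightarrow> real) \<Rightarrow> real \<Rightarrow>
   ((real^'n) \<times> (real^'n)) measure \<Rightarrow> ereal" where
  "free_energy F\<^sub>0 f \<sigma>\<^sub>0 m =
     potential_energy F\<^sub>0 f (distr m borel fst)
     + enn2ereal (\<integral>\<^sup>+z. ennreal ((norm (snd z))\<^sup>2 / 2) \<partial>m)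
     + ereal (\<sigma>\<^sub>0\<^sup>2 / 2) * entropy_H m"


section \<open>Brownian motion and mean-field Langevin dynamics\<close>

definition brownian_motion ::
  "'w measure \<Rightarrow> (real \<Rightarrow> 'w measure) \<Rightarrow> (real \<Rightarrow> 'w \<Rightarrow> real^'n) \<Rightarrow> bool" where
  "brownian_motion M \<F> W \<longleftrightarrow>
     prob_space M \<and> filtration (space M) \<F> \<and> (\<forall>t. subalgebra M (\<F> t)) \<and>
     (\<forall>t\<ge>0. W t \<in> borel_measurable (\<F> t)) \<and>
     (AE \<omega> in M. W 0 \<omega> = 0 \<and> continuous_on {0..} (\<lambda>t. W t \<omega>)) \<and>
     (\<forall>s t. 0 \<le> s \<longrightarrow> s < t \<longrightarrow>
        prob_space.indep_set M (sets (\<F> s))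
          (sets (vimage_algebra (space M) (\<lambda>\<omega>. W t \<omega> - W s \<omega>) borel)) \<and>
        distributed M lborel (\<lambda>\<omega>. W t \<omega> - W s \<omega>)
          (\<lambda>x. ennreal (\<Prod>i\<in>UNIV. normal_density 0 (sqrt (t - s)) (x $ i))))"

text \<open>As the noise is additive, the equations are stated in pathwise integral form. The laws
  of \<open>X t\<close> and \<open>Y t\<close> are required to be in \<open>P2\<close>, the domain of the drift
  \<open>b : P2 \<times> \<real>\<^sup>n \<rightarrow> \<real>\<^sup>n\<close>.\<close>

definition underdamped_solution ::
  "((real^'n) measure \<Rightarrow> real^'n \<Rightarrow> real^'n) \<Rightarrow> real \<Rightarrow> real \<Rightarrow>
   ((real^'n) \<times> (real^'n)) measure \<Rightarrow>
   'w measure \<Rightarrow> (real \<Rightarrow> 'w measure) \<Rightarrow> (real \<Rightarrow> 'w \<Rightarrow> real^'n) \<Rightarrow>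
   (real \<Rightarrow> 'w \<Rightarrow> real^'n) \<Rightarrow> (real \<Rightarrow> 'w \<Rightarrow> real^'n) \<Rightarrow> bool" where
  "underdamped_solution b \<gamma> \<sigma> m\<^sub>0 M \<F> W X V \<longleftrightarrow>
     brownian_motion M \<F> W \<and>
     (\<forall>t\<ge>0. X t \<in> borel_measurable (\<F> t) \<and> V t \<in> borel_measurable (\<F> t)) \<and>
     (\<forall>t\<ge>0. distr M borel (X t) \<in> P2) \<and>
     distr M borel (\<lambda>\<omega>. (X 0 \<omega>, V 0 \<omega>)) = m\<^sub>0 \<and>
     (AE \<omega> in M. continuous_on {0..} (\<lambda>t. X t \<omega>) \<and> continuous_on {0..} (\<lambda>t. V t \<omega>) \<and>
        (\<forall>t\<ge>0.
           set_integrable lborel {0..t} (\<lambda>s. b (distr M borel (X s)) (X s \<omega>) + \<gamma> *\<^sub>R V s \<omega>) \<and>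
           X t \<omega> = X 0 \<omega> + (LBINT s:{0..t}. V s \<omega>) \<and>
           V t \<omega> = V 0 \<omega> - (LBINT s:{0..t}. b (distr M borel (X s)) (X s \<omega>) + \<gamma> *\<^sub>R V s \<omega>)
                   + \<sigma> *\<^sub>R W t \<omega>))"

definition overdamped_solution ::
  "((real^'n) measure \<Rightarrow> real^'n \<Rightarrow> real^'n) \<Rightarrow> real \<Rightarrow> (real^'n) measure \<Rightarrow>
   'w measure \<Rightarrow> (real \<Rightarrow> 'w measure) \<Rightarrow> (real \<Rightarrow> 'w \<Rightarrow> real^'n) \<Rightarrow>
   (real \<Rightarrow> 'w \<Rightarrow> real^'n) \<Rightarrow> bool" where
  "overdamped_solution b \<sigma> \<mu>\<^sub>0 M \<F> W Y \<longleftrightarrow>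
     brownian_motion M \<F> W \<and>
     (\<forall>t\<ge>0. Y t \<in> borel_measurable (\<F> t)) \<and>
     (\<forall>t\<ge>0. distr M borel (Y t) \<in> P2) \<and>
     distr M borel (Y 0) = \<mu>\<^sub>0 \<and>
     (AE \<omega> in M. continuous_on {0..} (\<lambda>t. Y t \<omega>) \<and>
        (\<forall>t\<ge>0.
           set_integrable lborel {0..t} (\<lambda>s. b (distr M borel (Y s)) (Y s \<omega>)) \<and>
           Y t \<omega> = Y 0 \<omega> - (LBINT s:{0..t}. b (distr M borel (Y s)) (Y s \<omega>)) + \<sigma> *\<^sub>R W t \<omega>))"

definition weakly_converges ::
  "('i \<Rightarrow> 'a::topological_space measure) \<Rightarrow> 'a measure \<Rightarrow> 'i filter \<Rightarrow> bool" where
  "weakly_converges \<mu> \<nu> A \<longleftrightarrow>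
     (\<forall>g :: 'a \<Rightarrow> real. continuous_on UNIV g \<longrightarrow> bounded (range g) \<longrightarrow>
        ((\<lambda>i. \<integral>x. g x \<partial>\<mu> i) \<longlongrightarrow> (\<integral>x. g x \<partial>\<nu>)) A)"

end

theory Submission
  imports Defs
begin

text \<open>
  In the time scale of the limit, \<open>Z s = X (\<gamma> s)\<close> and \<open>W' s = W (\<gamma> s) / sqrt \<gamma>\<close>, the second
  equation of the underdamped system can be integrated once. With \<open>b = D\<^sub>m F\<close> and
  \<open>P s = X 0 + V 0 / \<gamma> - (\<integral>r\<le>s. b (law of Z r) (Z r)) + \<sigma>\<^sub>0 W' s\<close> it becomes
  \<open>Z' = \<gamma>\<^sup>2 (P - Z)\<close>. Since \<open>W'\<close> is again a Brownian motion, \<open>Z\<close> is an exponential moving average,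
  with memory \<open>1 / \<gamma>\<^sup>2\<close>, of a process that would solve the overdamped equation if it were equal to
  \<open>Z\<close> and if the vanishing term \<open>V 0 / \<gamma>\<close> were absent.

  The processes live on different probability spaces, so they have to be compared through their
  laws. The link is the Euler scheme of the overdamped equation with step \<open>h\<close>. Its law is computed
  by a deterministic recursion (\<open>euler_law\<close>) from the initial law and Gaussian measures, because
  each increment of the noise is independent of the past; so the scheme has the same law on every
  space (\<open>euler_adapted_and_law\<close>). On the space of \<open>Y\<close> the scheme is driven by the noise of \<open>Y\<close>, on
  the space of \<open>X\<close> by \<open>W'\<close>, and in both cases it is close in \<open>L\<^sup>1\<close> to the solution
  (\<open>overdamped_close_to_euler\<close>, \<open>relaxation_close_to_euler\<close>): the drift is Lipschitz in the state and,
  for the Wasserstein distance of order 1, in the law, and this distance is at most the expected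
  distance of the coupled processes, so that Gronwall's inequality closes
  (\<open>mean_field_stability\<close>). The errors that remain are the discretisation error, of order
  \<open>sqrt h\<close>, and the mean oscillation of the forcing of the scheme within the memory \<open>1 / \<gamma>\<^sup>2\<close>, of
  order \<open>1 / \<gamma>\<close>. Both are expressed by the Euler scheme alone, whose moments depend neither on \<open>\<gamma>\<close>
  nor on the space (\<open>euler_moments_bounded\<close>); hence no estimate on \<open>X\<close> uniform in \<open>\<gamma>\<close> enters.

  Consequently the expectations of a Lipschitz function at \<open>Z t\<close> and at \<open>Y t\<close> differ by at most a
  constant times \<open>sqrt h + 1 / \<gamma>\<close> for small \<open>h\<close> and large \<open>\<gamma>\<close>, and bounded Lipschitz functions
  determine weak convergence (\<open>weakly_converges_if_lipschitz\<close>).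
\<close>

section \<open>Integral inequalities on the half-line\<close>

text \<open>Gronwall's inequality in integrated form, for functions that are merely measurable. Integrating
  the hypothesis against the weight \<open>exp (- 2 c t)\<close> and exchanging the integrals reproduces at most
  half of the weighted integral of \<open>u\<close>. It can be absorbed on the left because it is finite.\<close>

lemma gronwall_nn_integral:
  fixes u a :: "real \<Rightarrow> ennreal" and c T :: real
  assumes [measurable]: "u \<in> borel_measurable borel" "a \<in> borel_measurable borel"
    and "c > 0"
    and le: "\<And>t. t \<in> {0..T} \<Longrightarrow> u t \<le> a t + ennreal c * (\<integral>\<^sup>+s\<in>{0..t}. u s \<partial>lborel)"
    and fin: "(\<integral>\<^sup>+t\<in>{0..T}. u t \<partial>lborel) < \<infinity>"
  shows "(\<integral>\<^sup>+t\<in>{0..T}. u t \<partial>lborel) \<le> ennreal (2 * exp (2 * c * T)) * (\<integral>\<^sup>+t\<in>{0..T}. a t \<partial>lborel)"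
proof (cases "T \<ge> 0")
  case True
  define w where "w t = ennreal (exp (- (2 * c * t)))" for t :: real
  have [measurable]: "w \<in> borel_measurable borel"
    unfolding w_def by measurable
  define I where "I = (\<integral>\<^sup>+t\<in>{0..T}. w t * u t \<partial>lborel)"
  have tail: "(\<integral>\<^sup>+t\<in>{s..T}. w t \<partial>lborel) \<le> ennreal (1 / (2 * c)) * w s" for s
  proof (cases "s \<le> T")
    case True
    have "(\<integral>\<^sup>+t\<in>{s..T}. w t \<partial>lborel)
        = ennreal (- exp (- (2 * c * T)) / (2 * c) - - exp (- (2 * c * s)) / (2 * c))"
      unfolding w_def using \<open>c > 0\<close>
      by (intro nn_integral_FTC_Icc[OF _ _ _ True])
         (auto intro!: derivative_eq_intros)
    also have "\<dots> \<le> ennreal (1 / (2 * c) * exp (- (2 * c * s)))"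
      using \<open>c > 0\<close> by (intro ennreal_leI) (simp add: field_simps)
    finally show ?thesis
      using \<open>c > 0\<close> by (simp add: w_def flip: ennreal_mult'')
  qed simp
  have swap: "(\<integral>\<^sup>+t\<in>{0..T}. w t * (\<integral>\<^sup>+s\<in>{0..t}. u s \<partial>lborel) \<partial>lborel)
      = (\<integral>\<^sup>+s\<in>{0..T}. u s * (\<integral>\<^sup>+t\<in>{s..T}. w t \<partial>lborel) \<partial>lborel)"
  proof -
    define k where "k t s = (if 0 \<le> s \<and> s \<le> t \<and> t \<le> T then w t * u s else 0)" for t s
    have [measurable]: "case_prod k \<in> borel_measurable (borel \<Otimes>\<^sub>M borel)"
      unfolding k_def by measurable
    have "(\<integral>\<^sup>+t\<in>{0..T}. w t * (\<integral>\<^sup>+s\<in>{0..t}. u s \<partial>lborel) \<partial>lborel)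
        = (\<integral>\<^sup>+t. \<integral>\<^sup>+s. k t s \<partial>lborel \<partial>lborel)"
    proof (intro nn_integral_cong)
      fix t :: real
      show "w t * (\<integral>\<^sup>+s\<in>{0..t}. u s \<partial>lborel) * indicator {0..T} t = (\<integral>\<^sup>+s. k t s \<partial>lborel)"
      proof (cases "t \<in> {0..T}")
        case True
        then show ?thesis
          by (auto intro!: nn_integral_cong simp: k_def nn_integral_cmult[symmetric] split: split_indicator)
      next
        case False
        then have "k t s = 0" for s by (auto simp: k_def)
        with False show ?thesis by simp
      qed
    qed
    also have "\<dots> = (\<integral>\<^sup>+s. \<integral>\<^sup>+t. k t s \<partial>lborel \<partial>lborel)"
      by (intro lborel_pair.Fubini') measurable
    also have "\<dots> = (\<integral>\<^sup>+s\<in>{0..T}. u s * (\<integral>\<^sup>+t\<in>{s..T}. w t \<partial>lborel) \<partial>lborel)"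
    proof (intro nn_integral_cong)
      fix s :: real
      show "(\<integral>\<^sup>+t. k t s \<partial>lborel) = u s * (\<integral>\<^sup>+t\<in>{s..T}. w t \<partial>lborel) * indicator {0..T} s"
      proof (cases "s \<in> {0..T}")
        case True
        then show ?thesis
          by (auto intro!: nn_integral_cong
              simp: k_def nn_integral_cmult[symmetric] mult.commute split: split_indicator)
      next
        case False
        then have "k t s = 0" for t by (auto simp: k_def)
        with False show ?thesis by simp
      qed
    qed
    finally show ?thesis .
  qed
  have w1: "w t \<le> 1" if "t \<in> {0..T}" for t
    using that \<open>c > 0\<close> by (simp add: w_def)
  have "I \<le> (\<integral>\<^sup>+t\<in>{0..T}. w t * u t \<partial>lborel)"
    by (simp add: I_def)
  also have "\<dots> \<le> (\<integral>\<^sup>+t. a t * indicator {0..T} t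
      + ennreal c * (w t * (\<integral>\<^sup>+s\<in>{0..t}. u s \<partial>lborel) * indicator {0..T} t) \<partial>lborel)"
  proof (intro nn_integral_mono)
    fix t :: real
    have "w t * u t \<le> a t + ennreal c * (w t * (\<integral>\<^sup>+s\<in>{0..t}. u s \<partial>lborel))" if "t \<in> {0..T}"
    proof -
      have "w t * u t \<le> w t * (a t + ennreal c * (\<integral>\<^sup>+s\<in>{0..t}. u s \<partial>lborel))"
        by (intro mult_left_mono le that) simp
      also have "\<dots> \<le> 1 * a t + ennreal c * (w t * (\<integral>\<^sup>+s\<in>{0..t}. u s \<partial>lborel))"
        unfolding distrib_left
        by (intro add_mono mult_right_mono w1 that) (simp_all add: ac_simps)
      finally show ?thesis by simp
    qed
    then show "w t * u t * indicator {0..T} t \<le> a t * indicator {0..T} t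
      + ennreal c * (w t * (\<integral>\<^sup>+s\<in>{0..t}. u s \<partial>lborel) * indicator {0..T} t)"
      by (auto split: split_indicator)
  qed
  also have "\<dots> = (\<integral>\<^sup>+t\<in>{0..T}. a t \<partial>lborel)
      + ennreal c * (\<integral>\<^sup>+t\<in>{0..T}. w t * (\<integral>\<^sup>+s\<in>{0..t}. u s \<partial>lborel) \<partial>lborel)"
  proof -
    have "(\<lambda>t. (\<integral>\<^sup>+s\<in>{0..t}. u s \<partial>lborel)) = (\<lambda>t. (\<integral>\<^sup>+s. (if 0 \<le> s \<and> s \<le> t then u s else 0) \<partial>lborel))"
      by (auto intro!: ext nn_integral_cong split: split_indicator)
    also have "\<dots> \<in> borel_measurable borel" by measurable
    finally have [measurable]: "(\<lambda>t. (\<integral>\<^sup>+s\<in>{0..t}. u s \<partial>lborel)) \<in> borel_measurable borel" .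
    show ?thesis
      by (subst nn_integral_add) (auto simp: nn_integral_cmult)
  qed
  also have "\<dots> \<le> (\<integral>\<^sup>+t\<in>{0..T}. a t \<partial>lborel) + ennreal c * (ennreal (1 / (2 * c)) * I)"
  proof -
    have "(\<integral>\<^sup>+s\<in>{0..T}. u s * (\<integral>\<^sup>+t\<in>{s..T}. w t \<partial>lborel) \<partial>lborel)
        \<le> (\<integral>\<^sup>+s. ennreal (1 / (2 * c)) * (w s * u s * indicator {0..T} s) \<partial>lborel)"
    proof (intro nn_integral_mono)
      fix s :: real
      have "u s * (\<integral>\<^sup>+t\<in>{s..T}. w t \<partial>lborel) \<le> u s * (ennreal (1 / (2 * c)) * w s)"
        by (intro mult_left_mono tail) simp
      then show "u s * (\<integral>\<^sup>+t\<in>{s..T}. w t \<partial>lborel) * indicator {0..T} s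
          \<le> ennreal (1 / (2 * c)) * (w s * u s * indicator {0..T} s)"
        by (auto split: split_indicator simp: ac_simps)
    qed
    also have "\<dots> = ennreal (1 / (2 * c)) * I"
      unfolding I_def by (intro nn_integral_cmult) measurable
    finally show ?thesis unfolding swap by (intro add_left_mono mult_left_mono) auto
  qed
  also have "ennreal c * (ennreal (1 / (2 * c)) * I) = ennreal (1 / 2) * I"
    using \<open>c > 0\<close> by (simp add: mult.assoc[symmetric] ennreal_mult'[symmetric])
  finally have half: "I \<le> (\<integral>\<^sup>+t\<in>{0..T}. a t \<partial>lborel) + ennreal (1 / 2) * I" .
  have "I \<le> (\<integral>\<^sup>+t\<in>{0..T}. u t \<partial>lborel)"
    unfolding I_def
    by (intro nn_integral_mono) (auto split: split_indicator intro: mult_right_mono[OF w1, simplified])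
  with fin have Ifin: "I < \<infinity>" by (rule le_less_trans[rotated])
  have I2: "I \<le> 2 * (\<integral>\<^sup>+t\<in>{0..T}. a t \<partial>lborel)"
  proof (cases "(\<integral>\<^sup>+t\<in>{0..T}. a t \<partial>lborel) = \<infinity>")
    case True then show ?thesis by (simp add: ennreal_mult_top)
  next
    case False
    obtain x where x: "I = ennreal x" "x \<ge> 0"
      using Ifin by (cases I) auto
    obtain y where y: "(\<integral>\<^sup>+t\<in>{0..T}. a t \<partial>lborel) = ennreal y" "y \<ge> 0"
      using False by (cases "(\<integral>\<^sup>+t\<in>{0..T}. a t \<partial>lborel)") auto
    have "ennreal x \<le> ennreal (y + 1/2 * x)"
      using half x y by (subst ennreal_plus, simp, simp, subst ennreal_mult') simp_all
    then have "x \<le> y + 1/2 * x" using x y by (subst (asm) ennreal_le_iff) auto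
    then have "x \<le> 2 * y" by simp
    then have "ennreal x \<le> ennreal (2 * y)" by (rule ennreal_leI)
    then show ?thesis unfolding x y by (simp add: ennreal_mult')
  qed
  have "(\<integral>\<^sup>+t\<in>{0..T}. u t \<partial>lborel) \<le> (\<integral>\<^sup>+t. ennreal (exp (2 * c * T)) * (w t * u t * indicator {0..T} t) \<partial>lborel)"
  proof (intro nn_integral_mono)
    fix t :: real
    have "u t \<le> ennreal (exp (2 * c * T)) * w t * u t" if "t \<in> {0..T}"
    proof -
      have "1 \<le> ennreal (exp (2 * c * T)) * w t"
        unfolding w_def ennreal_mult'[symmetric, OF exp_ge_zero] exp_add[symmetric]
        using that \<open>c > 0\<close> by (simp add: mult_left_mono flip: exp_minus)
      from mult_right_mono[OF this, of "u t"] show ?thesis by simp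
    qed
    then show "u t * indicator {0..T} t \<le> ennreal (exp (2 * c * T)) * (w t * u t * indicator {0..T} t)"
      by (auto split: split_indicator simp: ac_simps)
  qed
  also have "\<dots> = ennreal (exp (2 * c * T)) * I"
    unfolding I_def by (intro nn_integral_cmult) measurable
  also have "\<dots> \<le> ennreal (exp (2 * c * T)) * (2 * (\<integral>\<^sup>+t\<in>{0..T}. a t \<partial>lborel))"
    by (intro mult_left_mono I2) simp
  finally show ?thesis by (simp add: ennreal_mult' ac_simps)
qed simp

lemma nn_integral_swap_set:
  fixes k :: "real \<Rightarrow> 'w \<Rightarrow> ennreal" and A :: "real set"
  assumes "sigma_finite_measure M" and [measurable]: "A \<in> sets borel"
    and [measurable]: "(\<lambda>(s, \<omega>). k s \<omega>) \<in> borel_measurable (borel \<Otimes>\<^sub>M M)"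
  shows "(\<integral>\<^sup>+\<omega>. (\<integral>\<^sup>+s\<in>A. k s \<omega> \<partial>lborel) \<partial>M) = (\<integral>\<^sup>+s\<in>A. (\<integral>\<^sup>+\<omega>. k s \<omega> \<partial>M) \<partial>lborel)"
proof -
  interpret sigma_finite_measure M by fact
  interpret pair_sigma_finite lborel M ..
  have "(\<integral>\<^sup>+\<omega>. (\<integral>\<^sup>+s\<in>A. k s \<omega> \<partial>lborel) \<partial>M) = (\<integral>\<^sup>+s. (\<integral>\<^sup>+\<omega>. k s \<omega> * indicator A s \<partial>M) \<partial>lborel)"
    by (intro Fubini') measurable
  also have "\<dots> = (\<integral>\<^sup>+s\<in>A. (\<integral>\<^sup>+\<omega>. k s \<omega> \<partial>M) \<partial>lborel)"
    by (intro nn_integral_cong nn_integral_multc) measurable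
  finally show ?thesis .
qed

lemma norm_set_integral_le_nn_integral:
  fixes g :: "real \<Rightarrow> 'a::euclidean_space"
  assumes "set_integrable lborel A g"
  shows "ennreal (norm (LBINT s:A. g s)) \<le> (\<integral>\<^sup>+s\<in>A. ennreal (norm (g s)) \<partial>lborel)"
proof -
  have "ennreal (norm (LBINT s:A. g s)) \<le> (\<integral>\<^sup>+s. ennreal (norm (indicator A s *\<^sub>R g s)) \<partial>lborel)"
    unfolding set_lebesgue_integral_def
    by (intro integral_norm_bound_ennreal assms[unfolded set_integrable_def])
  also have "\<dots> = (\<integral>\<^sup>+s\<in>A. ennreal (norm (g s)) \<partial>lborel)"
    by (intro nn_integral_cong) (simp split: split_indicator)
  finally show ?thesis .
qed

lemma continuous_imp_nn_integrable:
  fixes g :: "real \<Rightarrow> 'a::euclidean_space"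
  assumes "continuous_on {a..b} g"
  shows "(\<integral>\<^sup>+s\<in>{a..b}. ennreal (norm (g s)) \<partial>lborel) < \<infinity>"
proof -
  have "integrable lborel (\<lambda>s. indicator {a..b} s *\<^sub>R g s)"
    using borel_integrable_atLeastAtMost'[OF assms] by (simp add: set_integrable_def)
  then have "(\<integral>\<^sup>+s. ennreal (norm (indicator {a..b} s *\<^sub>R g s)) \<partial>lborel) < \<infinity>"
    by (simp add: integrable_iff_bounded)
  moreover have "ennreal (norm (indicator {a..b} s *\<^sub>R g s)) = ennreal (norm (g s)) * indicator {a..b} s" for s
    by (simp split: split_indicator)
  ultimately show ?thesis by simp
qed

lemma set_integral_rescale:
  fixes g :: "real \<Rightarrow> 'a::euclidean_space"
  assumes "c > 0"
  shows "(LBINT r:{0..c * s}. g r) = c *\<^sub>R (LBINT r:{0..s}. g (c * r))"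
proof -
  have "(LBINT r:{0..c * s}. g r) = \<bar>c\<bar> *\<^sub>R (\<integral>r. indicator {0..c * s} (0 + c * r) *\<^sub>R g (0 + c * r) \<partial>lborel)"
    unfolding set_lebesgue_integral_def using \<open>c > 0\<close> by (intro lborel_integral_real_affine) simp
  also have "(\<lambda>r. indicator {0..c * s} (0 + c * r) *\<^sub>R g (0 + c * r)) = (\<lambda>r. indicator {0..s} r *\<^sub>R g (c * r))"
    using \<open>c > 0\<close> by (auto simp: fun_eq_iff zero_le_mult_iff split: split_indicator)
  finally show ?thesis using \<open>c > 0\<close> by (simp add: set_lebesgue_integral_def)
qed

lemma set_integrable_rescale:
  fixes g :: "real \<Rightarrow> 'a::euclidean_space"
  assumes "c > 0" "set_integrable lborel {0..c * s} g"
  shows "set_integrable lborel {0..s} (\<lambda>r. g (c * r))"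
proof -
  have "integrable lborel (\<lambda>r. indicator {0..c * s} (0 + c * r) *\<^sub>R g (0 + c * r))"
    using assms unfolding set_integrable_def by (intro lborel_integrable_real_affine) auto
  also have "(\<lambda>r. indicator {0..c * s} (0 + c * r) *\<^sub>R g (0 + c * r)) = (\<lambda>r. indicator {0..s} r *\<^sub>R g (c * r))"
    using \<open>c > 0\<close> by (auto simp: fun_eq_iff zero_le_mult_iff split: split_indicator)
  finally show ?thesis by (simp add: set_integrable_def)
qed

section \<open>Random vectors, their laws, and processes with continuous paths\<close>

text \<open>Solutions are continuous in time only almost surely, so that they need not be jointly
  measurable. This version provides the joint measurability that Fubini's theorem requires.\<close>

lemma continuous_process_measurable_version:
  fixes Z :: "real \<Rightarrow> 'w \<Rightarrow> 'a::euclidean_space"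
  assumes Z: "\<And>t. t \<ge> 0 \<Longrightarrow> Z t \<in> borel_measurable M"
    and cont: "AE \<omega> in M. continuous_on {0..} (\<lambda>t. Z t \<omega>)"
  obtains Z' where "(\<lambda>(t :: real, \<omega>). Z' t \<omega>) \<in> borel_measurable (borel \<Otimes>\<^sub>M M)"
    and "AE \<omega> in M. \<forall>t\<ge>0. Z' t \<omega> = Z t \<omega>"
proof -
  obtain N where N: "{\<omega> \<in> space M. \<not> continuous_on {0..} (\<lambda>t. Z t \<omega>)} \<subseteq> N" "emeasure M N = 0" "N \<in> sets M"
    using cont by (rule AE_E)
  have [measurable]: "N \<in> sets M" by (rule N)
  define Z' where "Z' t \<omega> = (if \<omega> \<in> N then 0 else Z (max 0 t) \<omega>)" for t \<omega>
  \<comment> \<open>\<open>q i t / (i + 1)\<close> is \<open>max 0 t\<close> rounded down to the grid of mesh \<open>1 / (i + 1)\<close>\<close>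
  define q where "q i t = nat \<lfloor>max 0 t * real (Suc i)\<rfloor>" for i :: nat and t :: real
  have [measurable]: "(\<lambda>(t :: real, \<omega>). Z (real (q i t) / real (Suc i)) \<omega>) \<in> borel_measurable (borel \<Otimes>\<^sub>M M)" for i
  proof -
    have [measurable]: "Z (real k / real (Suc i)) \<in> borel_measurable M" for k
      by (rule Z) simp
    have "(\<lambda>x :: real \<times> 'w. Z (real (q i (fst x)) / real (Suc i)) (snd x)) \<in> borel_measurable (borel \<Otimes>\<^sub>M M)"
      by (rule measurable_compose_countable[where f="\<lambda>k (x :: real \<times> 'w). Z (real k / real (Suc i)) (snd x)"
            and g="\<lambda>x :: real \<times> 'w. q i (fst x)"]) (measurable, simp add: q_def)
    then show ?thesis by (simp add: case_prod_beta')
  qed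
  have "(\<lambda>(t :: real, \<omega>). Z' t \<omega>) \<in> borel_measurable (borel \<Otimes>\<^sub>M M)"
  proof (rule borel_measurable_LIMSEQ_metric)
    show "(\<lambda>(t :: real, \<omega>). if \<omega> \<in> N then 0 else Z (real (q i t) / real (Suc i)) \<omega>) \<in> borel_measurable (borel \<Otimes>\<^sub>M M)" for i
      by measurable
  next
    fix x :: "real \<times> 'w" assume "x \<in> space (borel \<Otimes>\<^sub>M M)"
    then obtain t \<omega> where x: "x = (t, \<omega>)" "\<omega> \<in> space M" by (auto simp: space_pair_measure)
    have "(\<lambda>i. Z (real (q i t) / real (Suc i)) \<omega>) \<longlonglongrightarrow> Z (max 0 t) \<omega>" if "\<omega> \<notin> N"
    proof -
      have c: "continuous_on {0..} (\<lambda>t. Z t \<omega>)" using N that x by auto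
      have "(\<lambda>i. real (q i t) / real (Suc i)) \<longlonglongrightarrow> max 0 t"
      proof (rule tendsto_sandwich)
        have le: "real (q i t) \<le> max 0 t * real (Suc i)" "max 0 t * real (Suc i) - 1 \<le> real (q i t)" for i
        proof -
          have "0 \<le> max 0 t * real (Suc i)" by simp
          then show "real (q i t) \<le> max 0 t * real (Suc i)" "max 0 t * real (Suc i) - 1 \<le> real (q i t)"
            unfolding q_def by linarith+
        qed
        show "\<forall>\<^sub>F i in sequentially. max 0 t - 1 / real (Suc i) \<le> real (q i t) / real (Suc i)"
        proof (intro always_eventually allI)
          fix i
          have "max 0 t - 1 / real (Suc i) = (max 0 t * real (Suc i) - 1) / real (Suc i)"
            by (simp add: field_simps)
          also have "\<dots> \<le> real (q i t) / real (Suc i)"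
            by (intro divide_right_mono le) simp
          finally show "max 0 t - 1 / real (Suc i) \<le> real (q i t) / real (Suc i)" .
        qed
        show "\<forall>\<^sub>F i in sequentially. real (q i t) / real (Suc i) \<le> max 0 t"
          using le(1) by (intro always_eventually allI) (simp add: field_simps del: of_nat_Suc)
        show "(\<lambda>i. max 0 t - 1 / real (Suc i)) \<longlonglongrightarrow> max 0 t"
          using tendsto_diff[OF tendsto_const lim_inverse_n'[THEN LIMSEQ_Suc], of "max 0 t"]
          by (simp add: field_simps)
      qed simp
      then show ?thesis
        by (rule continuous_on_tendsto_compose[OF c]) auto
    qed
    then show "(\<lambda>i. (\<lambda>(t :: real, \<omega>). if \<omega> \<in> N then 0 else Z (real (q i t) / real (Suc i)) \<omega>) x)
        \<longlonglongrightarrow> (\<lambda>(t :: real, \<omega>). Z' t \<omega>) x"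
      by (auto simp: x Z'_def)
  qed
  moreover have "AE \<omega> in M. \<forall>t\<ge>0. Z' t \<omega> = Z t \<omega>"
  proof -
    have "AE \<omega> in M. \<omega> \<notin> N" using N(2,3) by (intro AE_not_in) auto
    then show ?thesis by eventually_elim (auto simp: Z'_def max_def)
  qed
  ultimately show ?thesis by (rule that)
qed

lemma distr_in_P2_iff:
  assumes "prob_space M" and [measurable]: "X \<in> borel_measurable M"
  shows "distr M borel X \<in> P2 \<longleftrightarrow> (\<integral>\<^sup>+\<omega>. ennreal ((norm (X \<omega>))\<^sup>2) \<partial>M) < \<infinity>"
  using prob_space.prob_space_distr[OF assms] by (simp add: P2_def nn_integral_distr)

lemma distr_in_P2_dominated:
  fixes X :: "'w \<Rightarrow> 'a::euclidean_space" and Y :: "'w \<Rightarrow> 'b::euclidean_space"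
    and Z :: "'w \<Rightarrow> 'c::euclidean_space"
  assumes M: "prob_space M" and [measurable]: "X \<in> borel_measurable M" "Y \<in> borel_measurable M"
    "Z \<in> borel_measurable M"
    and X: "(\<integral>\<^sup>+\<omega>. ennreal ((norm (X \<omega>))\<^sup>2) \<partial>M) < \<infinity>"
    and Y: "(\<integral>\<^sup>+\<omega>. ennreal ((norm (Y \<omega>))\<^sup>2) \<partial>M) < \<infinity>"
    and le: "\<And>\<omega>. norm (Z \<omega>) \<le> a + c * norm (X \<omega>) + d * norm (Y \<omega>)"
  shows "distr M borel Z \<in> P2"
proof -
  interpret prob_space M by fact
  have "(norm (Z \<omega>))\<^sup>2 \<le> 3 * a\<^sup>2 + 3 * c\<^sup>2 * (norm (X \<omega>))\<^sup>2 + 3 * d\<^sup>2 * (norm (Y \<omega>))\<^sup>2" for \<omega>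
  proof -
    have sq: "(p + q + r)\<^sup>2 \<le> 3 * p\<^sup>2 + 3 * q\<^sup>2 + 3 * r\<^sup>2" for p q r :: real
    proof -
      have "0 \<le> (p - q)\<^sup>2 + (q - r)\<^sup>2 + (p - r)\<^sup>2" by simp
      then show ?thesis by (simp add: power2_eq_square algebra_simps)
    qed
    have "(norm (Z \<omega>))\<^sup>2 \<le> (a + c * norm (X \<omega>) + d * norm (Y \<omega>))\<^sup>2"
      by (intro power_mono le norm_ge_zero)
    also note sq
    finally show ?thesis by (simp add: power_mult_distrib)
  qed
  then have "(\<integral>\<^sup>+\<omega>. ennreal ((norm (Z \<omega>))\<^sup>2) \<partial>M)
    \<le> (\<integral>\<^sup>+\<omega>. ennreal (3 * a\<^sup>2 + 3 * c\<^sup>2 * (norm (X \<omega>))\<^sup>2 + 3 * d\<^sup>2 * (norm (Y \<omega>))\<^sup>2) \<partial>M)"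
    by (intro nn_integral_mono ennreal_leI)
  also have "\<dots> = (\<integral>\<^sup>+\<omega>. ennreal (3 * a\<^sup>2) + ennreal (3 * c\<^sup>2) * ennreal ((norm (X \<omega>))\<^sup>2)
      + ennreal (3 * d\<^sup>2) * ennreal ((norm (Y \<omega>))\<^sup>2) \<partial>M)"
    by (simp add: ennreal_plus ennreal_mult')
  also have "\<dots> = ennreal (3 * a\<^sup>2) + ennreal (3 * c\<^sup>2) * (\<integral>\<^sup>+\<omega>. ennreal ((norm (X \<omega>))\<^sup>2) \<partial>M)
      + ennreal (3 * d\<^sup>2) * (\<integral>\<^sup>+\<omega>. ennreal ((norm (Y \<omega>))\<^sup>2) \<partial>M)"
    by (simp add: nn_integral_add nn_integral_cmult emeasure_space_1)
  also have "\<dots> < \<infinity>"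
    using X Y by (auto simp: ennreal_mult_less_top)
  finally show ?thesis
    by (simp add: distr_in_P2_iff[OF M])
qed

lemma P2_first_moment:
  assumes "\<mu> \<in> P2"
  shows "(\<integral>\<^sup>+x. ennreal (norm x) \<partial>\<mu>) < \<infinity>"
proof -
  have \<mu>: "prob_space \<mu>" "sets \<mu> = sets borel" "(\<integral>\<^sup>+x. ennreal ((norm x)\<^sup>2) \<partial>\<mu>) < \<infinity>"
    using assms by (auto simp: P2_def)
  interpret prob_space \<mu> by fact
  note [measurable_cong] = \<mu>(2)
  have le: "y \<le> 1 + y\<^sup>2" for y :: real
    using zero_le_power2[of "y - 1 / 2"] by (simp add: power2_eq_square algebra_simps)
  have "(\<integral>\<^sup>+x. ennreal (norm x) \<partial>\<mu>) \<le> (\<integral>\<^sup>+x. 1 + ennreal ((norm x)\<^sup>2) \<partial>\<mu>)"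
    by (intro nn_integral_mono) (simp add: ennreal_leI le flip: ennreal_1 ennreal_plus)
  also have "\<dots> = 1 + (\<integral>\<^sup>+x. ennreal ((norm x)\<^sup>2) \<partial>\<mu>)"
    by (simp add: nn_integral_add emeasure_space_1)
  also have "\<dots> < \<infinity>" using \<mu> by simp
  finally show ?thesis .
qed

text \<open>The joint law of \<open>(X, Y)\<close> is one of the couplings over which the infimum is taken.\<close>

lemma wasserstein1_le_expected_distance:
  fixes X Y :: "'w \<Rightarrow> 'a::euclidean_space"
  assumes [measurable]: "X \<in> borel_measurable M" "Y \<in> borel_measurable M"
  shows "ennreal (wasserstein 1 (distr M borel X) (distr M borel Y))
    \<le> (\<integral>\<^sup>+\<omega>. ennreal (norm (X \<omega> - Y \<omega>)) \<partial>M)"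
proof -
  define \<pi> where "\<pi> = distr M borel (\<lambda>\<omega>. (X \<omega>, Y \<omega>))"
  have "\<pi> \<in> couplings (distr M borel X) (distr M borel Y)"
  proof -
    have [measurable]: "(\<lambda>\<omega>. (X \<omega>, Y \<omega>)) \<in> measurable M borel" by simp
    have [measurable]: "fst \<in> measurable borel (borel :: 'a measure)" "snd \<in> measurable borel (borel :: 'a measure)"
      by (auto intro!: borel_measurable_continuous_onI continuous_intros)
    show ?thesis
      unfolding couplings_def \<pi>_def by (auto simp: distr_distr comp_def)
  qed
  then have "(INF \<pi> \<in> couplings (distr M borel X) (distr M borel Y).
        \<integral>\<^sup>+z. ennreal (dist (fst z) (snd z) powr 1) \<partial>\<pi>) \<le> (\<integral>\<^sup>+z. ennreal (dist (fst z) (snd z) powr 1) \<partial>\<pi>)"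
    by (rule INF_lower)
  also have "\<dots> = (\<integral>\<^sup>+\<omega>. ennreal (norm (X \<omega> - Y \<omega>)) \<partial>M)"
    unfolding \<pi>_def by (subst nn_integral_distr)
      (auto simp: dist_norm intro!: borel_measurable_continuous_onI continuous_intros)
  finally show ?thesis
    unfolding wasserstein_def
    by (auto simp: ennreal_enn2real_if intro: order_trans)
qed

section \<open>Stability of mean-field equations with Lipschitz drift\<close>

locale lipschitz_drift =
  fixes b :: "'a::euclidean_space measure \<Rightarrow> 'a \<Rightarrow> 'a" and C :: real
  assumes C_pos: "0 < C"
    and lipschitz: "\<And>\<mu> \<nu> x y. \<mu> \<in> P2 \<Longrightarrow> \<nu> \<in> P2 \<Longrightarrow>
      norm (b \<mu> x - b \<nu> y) \<le> C * (wasserstein 1 \<mu> \<nu> + norm (x - y))"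
begin

lemma lipschitz_space:
  assumes "\<mu> \<in> P2"
  shows "norm (b \<mu> x - b \<mu> y) \<le> C * norm (x - y)"
proof -
  have sets: "sets \<mu> = sets borel" using assms by (simp add: P2_def)
  have [measurable]: "(\<lambda>x. x) \<in> measurable \<mu> borel"
    using measurable_ident_sets[OF sets] by simp
  have "distr \<mu> borel (\<lambda>x. x) = \<mu>"
    using distr_id2[OF sets[symmetric]] by (simp add: id_def)
  then have "ennreal (wasserstein 1 \<mu> \<mu>) \<le> 0"
    using wasserstein1_le_expected_distance[of "\<lambda>x. x" \<mu> "\<lambda>x. x"] by simp
  then have "wasserstein 1 \<mu> \<mu> \<le> 0" by (simp add: ennreal_eq_0_iff)
  then have "C * (wasserstein 1 \<mu> \<mu> + norm (x - y)) \<le> C * norm (x - y)"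
    using C_pos by simp
  with lipschitz[OF assms assms, of x y] show ?thesis by linarith
qed

lemma drift_measurable:
  assumes "\<mu> \<in> P2"
  shows "b \<mu> \<in> borel_measurable borel"
proof -
  have "C-lipschitz_on UNIV (b \<mu>)"
    using lipschitz_space[OF assms] C_pos by (intro lipschitz_onI) (auto simp: dist_norm)
  then show ?thesis
    by (intro borel_measurable_continuous_onI lipschitz_on_continuous_on)
qed

text \<open>For two processes the expected distance is a measurable function of time by Fubini's theorem, while
  this is not clear for the Wasserstein distance of their laws. Integration in time therefore uses
  the expected distance.\<close>

lemma lipschitz_laws:
  assumes [measurable]: "X \<in> borel_measurable M" "Y \<in> borel_measurable M"
    and P2: "distr M borel X \<in> P2" "distr M borel Y \<in> P2"
  shows "ennreal (norm (b (distr M borel X) x - b (distr M borel Y) y))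
    \<le> ennreal C * ((\<integral>\<^sup>+\<omega>. ennreal (norm (X \<omega> - Y \<omega>)) \<partial>M) + ennreal (norm (x - y)))"
proof -
  have "ennreal (norm (b (distr M borel X) x - b (distr M borel Y) y))
      \<le> ennreal (C * (wasserstein 1 (distr M borel X) (distr M borel Y) + norm (x - y)))"
    by (intro ennreal_leI lipschitz P2)
  also have "\<dots> = ennreal C * (ennreal (wasserstein 1 (distr M borel X) (distr M borel Y)) + ennreal (norm (x - y)))"
    using C_pos by (simp add: ennreal_mult' wasserstein_def)
  finally show ?thesis
    by (rule order_trans)
      (intro mult_left_mono add_right_mono wasserstein1_le_expected_distance, simp_all)
qed

text \<open>Compare with the drift at the Dirac measure at 0; the expectation of \<open>norm X\<close> enters twice, once
  through the state and once through the law.\<close>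

lemma drift_linear_growth:
  assumes M: "prob_space M" and [measurable]: "X \<in> borel_measurable M" and P2: "distr M borel X \<in> P2"
  shows "(\<integral>\<^sup>+\<omega>. ennreal (norm (b (distr M borel X) (X \<omega>))) \<partial>M)
    \<le> ennreal (norm (b (return borel 0) 0)) + ennreal (2 * C) * (\<integral>\<^sup>+\<omega>. ennreal (norm (X \<omega>)) \<partial>M)"
proof -
  interpret prob_space M by fact
  let ?m = "\<integral>\<^sup>+\<omega>. ennreal (norm (X \<omega>)) \<partial>M"
  have 0: "distr M borel (\<lambda>_. 0 :: 'a) = return borel 0"
    by (intro measure_eqI) (simp_all add: emeasure_distr emeasure_space_1 split: split_indicator)
  have P2': "return borel (0 :: 'a) \<in> P2"
    by (simp add: P2_def nn_integral_return prob_space_return)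
  have "ennreal (norm (b (distr M borel X) (X \<omega>)))
      \<le> ennreal (norm (b (return borel 0) 0)) + ennreal C * ?m + ennreal C * ennreal (norm (X \<omega>))" for \<omega>
  proof -
    have "norm (b (distr M borel X) (X \<omega>)) \<le> norm (b (return borel 0) 0)
        + norm (b (distr M borel X) (X \<omega>) - b (return borel 0) 0)"
      by (metis norm_triangle_sub)
    then have "ennreal (norm (b (distr M borel X) (X \<omega>))) \<le> ennreal (norm (b (return borel 0) 0))
        + ennreal (norm (b (distr M borel X) (X \<omega>) - b (return borel 0) 0))"
      by (simp add: ennreal_leI flip: ennreal_plus)
    also have "\<dots> \<le> ennreal (norm (b (return borel 0) 0)) + ennreal C * (?m + ennreal (norm (X \<omega>)))"
      using lipschitz_laws[of X M "\<lambda>_. 0" "X \<omega>" 0] P2 P2' by (intro add_left_mono) (simp add: 0)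
    finally show ?thesis by (simp add: distrib_left add.assoc)
  qed
  then have "(\<integral>\<^sup>+\<omega>. ennreal (norm (b (distr M borel X) (X \<omega>))) \<partial>M)
      \<le> (\<integral>\<^sup>+\<omega>. ennreal (norm (b (return borel 0) 0)) + ennreal C * ?m + ennreal C * ennreal (norm (X \<omega>)) \<partial>M)"
    by (intro nn_integral_mono)
  also have "\<dots> = ennreal (norm (b (return borel 0) 0)) + (ennreal C * ?m + ennreal C * ?m)"
    by (simp add: nn_integral_add nn_integral_cmult emeasure_space_1 add.assoc)
  also have "ennreal C * ?m + ennreal C * ?m = ennreal (2 * C) * ?m"
    using C_pos by (simp add: ennreal_mult' mult.assoc flip: mult_2)
  finally show ?thesis .
qed

text \<open>The process \<open>Z\<close> follows \<open>H\<close> up to the error \<open>R\<close> and the difference of the accumulated drifts. In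
  expectation the Lipschitz property of the drift bounds the latter by \<open>2 C\<close> times the integral of the
  expected distance \<open>\<phi>\<close>, once for the state and once for the law, and Gronwall's inequality applies
  if \<open>\<phi>\<close> is integrable over \<open>[0, T]\<close>.

  This integrability is not evident, since the laws of \<open>Z\<close> are only known to have moments at each
  single time. It is obtained pathwise: along one fixed good sample \<open>\<omega>\<^sub>0\<close> the drift is
  integrable in time, and at equal times the drifts along \<open>\<omega>\<close> and \<open>\<omega>\<^sub>0\<close> involve the same laws, so that
  they differ at most by \<open>C\<close> times the distance of the states. This gives a linear integral
  inequality for each path, whose solution has finite expectation.\<close>

lemma mean_field_stability:
  fixes Z H :: "real \<Rightarrow> 'w \<Rightarrow> 'a" and R :: "real \<Rightarrow> 'w \<Rightarrow> ennreal" and T \<epsilon> :: real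
  assumes M: "prob_space M" and "T \<ge> 0" "\<epsilon> \<ge> 0"
    and Z[measurable]: "(\<lambda>(s, \<omega>). Z s \<omega>) \<in> borel_measurable (borel \<Otimes>\<^sub>M M)"
    and H[measurable]: "(\<lambda>(s, \<omega>). H s \<omega>) \<in> borel_measurable (borel \<Otimes>\<^sub>M M)"
    and R[measurable]: "(\<lambda>(s, \<omega>). R s \<omega>) \<in> borel_measurable (borel \<Otimes>\<^sub>M M)"
    and P2: "\<And>s. s \<in> {0..T} \<Longrightarrow> distr M borel (Z s) \<in> P2" "\<And>s. s \<in> {0..T} \<Longrightarrow> distr M borel (H s) \<in> P2"
    and H_int: "(\<integral>\<^sup>+s\<in>{0..T}. (\<integral>\<^sup>+\<omega>. ennreal (norm (H s \<omega>)) \<partial>M) \<partial>lborel) < \<infinity>"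
    and R_int: "\<And>s. s \<in> {0..T} \<Longrightarrow> (\<integral>\<^sup>+\<omega>. R s \<omega> \<partial>M) \<le> ennreal \<epsilon>"
    and Z_int: "AE \<omega> in M. (\<integral>\<^sup>+s\<in>{0..T}. ennreal (norm (Z s \<omega>)) \<partial>lborel) < \<infinity>"
    and b_int: "AE \<omega> in M. set_integrable lborel {0..T}
        (\<lambda>s. b (distr M borel (Z s)) (Z s \<omega>) - b (distr M borel (H s)) (H s \<omega>))"
    and le: "AE \<omega> in M. \<forall>t\<in>{0..T}. ennreal (norm (Z t \<omega> - H t \<omega>)) \<le> R t \<omega> + (\<integral>\<^sup>+s\<in>{0..t}.
        ennreal (norm (b (distr M borel (Z s)) (Z s \<omega>) - b (distr M borel (H s)) (H s \<omega>))) \<partial>lborel)"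
  shows "(\<integral>\<^sup>+\<omega>. ennreal (norm (Z T \<omega> - H T \<omega>)) \<partial>M) \<le> ennreal (\<epsilon> * (1 + 4 * C * T * exp (4 * C * T)))"
proof -
  interpret prob_space M by fact
  define D where "D s \<omega> = ennreal (norm (b (distr M borel (Z s)) (Z s \<omega>) - b (distr M borel (H s)) (H s \<omega>)))" for s \<omega>
  define d where "d s \<omega> = ennreal (norm (Z s \<omega> - H s \<omega>))" for s \<omega>
  define h where "h s \<omega> = ennreal (norm (H s \<omega>))" for s \<omega>
  define \<phi> where "\<phi> s = (\<integral>\<^sup>+\<omega>. d s \<omega> \<partial>M)" for s
  let ?C = "ennreal C"
  have [measurable]: "Z s \<in> borel_measurable M" "H s \<in> borel_measurable M" for s
    by measurable
  have d[measurable]: "(\<lambda>(s, \<omega>). d s \<omega>) \<in> borel_measurable (borel \<Otimes>\<^sub>M M)"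
    unfolding d_def by measurable
  have h[measurable]: "(\<lambda>(s, \<omega>). h s \<omega>) \<in> borel_measurable (borel \<Otimes>\<^sub>M M)"
    unfolding h_def by measurable
  have [measurable]: "\<phi> \<in> borel_measurable borel"
    unfolding \<phi>_def by measurable
  note swap = nn_integral_swap_set[OF sigma_finite_measure_axioms]
  have H_int_AE: "AE \<omega> in M. (\<integral>\<^sup>+s\<in>{0..T}. h s \<omega> \<partial>lborel) < \<infinity>"
  proof -
    have "(\<integral>\<^sup>+\<omega>. (\<integral>\<^sup>+s\<in>{0..T}. h s \<omega> \<partial>lborel) \<partial>M) < \<infinity>"
      using H_int by (simp add: swap) (simp add: h_def)
    then have "AE \<omega> in M. (\<integral>\<^sup>+s\<in>{0..T}. h s \<omega> \<partial>lborel) \<noteq> \<infinity>"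
      by (intro nn_integral_PInf_AE) auto
    then show ?thesis by eventually_elim (metis infinity_ennreal_def less_top)
  qed
  have d_le: "d s \<omega> \<le> ennreal (norm (Z s \<omega>)) + h s \<omega>" for s \<omega>
    unfolding d_def h_def by (simp flip: ennreal_plus add: ennreal_leI norm_triangle_ineq4)
  have d_int_AE: "AE \<omega> in M. (\<integral>\<^sup>+s\<in>{0..T}. d s \<omega> \<partial>lborel) < \<infinity>"
    using Z_int H_int_AE AE_space
  proof eventually_elim
    case (elim \<omega>)
    have [measurable]: "\<omega> \<in> space M" using elim by simp
    have "(\<integral>\<^sup>+s\<in>{0..T}. d s \<omega> \<partial>lborel)
        \<le> (\<integral>\<^sup>+s. ennreal (norm (Z s \<omega>)) * indicator {0..T} s + h s \<omega> * indicator {0..T} s \<partial>lborel)"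
      by (intro nn_integral_mono) (auto split: split_indicator intro: d_le)
    also have "\<dots> < \<infinity>"
      using elim by (subst nn_integral_add) auto
    finally show ?case .
  qed
  have "\<exists>\<omega>\<^sub>0. \<omega>\<^sub>0 \<in> space M \<and> (\<integral>\<^sup>+s\<in>{0..T}. d s \<omega>\<^sub>0 \<partial>lborel) < \<infinity> \<and> (\<integral>\<^sup>+s\<in>{0..T}. h s \<omega>\<^sub>0 \<partial>lborel) < \<infinity> \<and>
      set_integrable lborel {0..T} (\<lambda>s. b (distr M borel (Z s)) (Z s \<omega>\<^sub>0) - b (distr M borel (H s)) (H s \<omega>\<^sub>0))"
  proof (rule eventually_happens'[of "ae_filter M"])
    show "ae_filter M \<noteq> bot" by (simp add: ae_filter_eq_bot_iff emeasure_space_1)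
    show "AE \<omega>\<^sub>0 in M. \<omega>\<^sub>0 \<in> space M \<and> (\<integral>\<^sup>+s\<in>{0..T}. d s \<omega>\<^sub>0 \<partial>lborel) < \<infinity> \<and> (\<integral>\<^sup>+s\<in>{0..T}. h s \<omega>\<^sub>0 \<partial>lborel) < \<infinity> \<and>
      set_integrable lborel {0..T} (\<lambda>s. b (distr M borel (Z s)) (Z s \<omega>\<^sub>0) - b (distr M borel (H s)) (H s \<omega>\<^sub>0))"
      using d_int_AE H_int_AE b_int AE_space by eventually_elim auto
  qed
  then obtain \<omega>\<^sub>0 where \<omega>\<^sub>0: "\<omega>\<^sub>0 \<in> space M" "(\<integral>\<^sup>+s\<in>{0..T}. d s \<omega>\<^sub>0 \<partial>lborel) < \<infinity>" "(\<integral>\<^sup>+s\<in>{0..T}. h s \<omega>\<^sub>0 \<partial>lborel) < \<infinity>"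
     and b\<omega>\<^sub>0: "set_integrable lborel {0..T} (\<lambda>s. b (distr M borel (Z s)) (Z s \<omega>\<^sub>0) - b (distr M borel (H s)) (H s \<omega>\<^sub>0))"
    by blast
  note [measurable] = \<omega>\<^sub>0(1)
  have D_ind: "D s \<omega>\<^sub>0 * indicator {0..T} s = ennreal (norm (indicator {0..T} s *\<^sub>R
      (b (distr M borel (Z s)) (Z s \<omega>\<^sub>0) - b (distr M borel (H s)) (H s \<omega>\<^sub>0))))" for s
    by (simp add: D_def split: split_indicator)
  have D_meas[measurable]: "(\<lambda>s. D s \<omega>\<^sub>0 * indicator {0..T} s) \<in> borel_measurable borel"
    using borel_measurable_integrable[OF b\<omega>\<^sub>0[unfolded set_integrable_def]]
    unfolding D_ind by (intro measurable_compose[OF _ measurable_ennreal] borel_measurable_norm)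
      (simp del: norm_scaleR)
  have D_fin: "(\<integral>\<^sup>+s\<in>{0..T}. D s \<omega>\<^sub>0 \<partial>lborel) < \<infinity>"
    using b\<omega>\<^sub>0 unfolding D_ind set_integrable_def by (simp add: integrable_iff_bounded)
  \<comment> \<open>the bound \<open>q\<close> on the drift does not depend on the sample \<open>\<omega>\<close>\<close>
  define q where "q s = D s \<omega>\<^sub>0 * indicator {0..T} s + (?C * d s \<omega>\<^sub>0 + (2 * ?C) * h s \<omega>\<^sub>0) * indicator {0..T} s" for s
  have q_meas[measurable]: "q \<in> borel_measurable borel"
    unfolding q_def by measurable
  define G where "G = (\<integral>\<^sup>+s. q s \<partial>lborel)"
  have G: "G < \<infinity>"
  proof -
    have "G = (\<integral>\<^sup>+s\<in>{0..T}. D s \<omega>\<^sub>0 \<partial>lborel)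
        + (?C * (\<integral>\<^sup>+s\<in>{0..T}. d s \<omega>\<^sub>0 \<partial>lborel) + (2 * ?C) * (\<integral>\<^sup>+s\<in>{0..T}. h s \<omega>\<^sub>0 \<partial>lborel))"
      unfolding G_def q_def distrib_right
      by (simp add: nn_integral_add nn_integral_cmult mult.assoc)
    then show ?thesis
      using D_fin \<omega>\<^sub>0 by (auto simp: ennreal_mult_less_top)
  qed
  have D_le: "D s \<omega> \<le> q s + (?C * d s \<omega> + (2 * ?C) * h s \<omega>)" if "s \<in> {0..T}" for s \<omega>
  proof -
    have "norm (b (distr M borel (Z s)) (Z s \<omega>) - b (distr M borel (H s)) (H s \<omega>))
      \<le> norm (b (distr M borel (Z s)) (Z s \<omega>\<^sub>0) - b (distr M borel (H s)) (H s \<omega>\<^sub>0))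
        + norm (b (distr M borel (Z s)) (Z s \<omega>) - b (distr M borel (Z s)) (Z s \<omega>\<^sub>0))
        + norm (b (distr M borel (H s)) (H s \<omega>\<^sub>0) - b (distr M borel (H s)) (H s \<omega>))"
      by norm
    also have "\<dots> \<le> norm (b (distr M borel (Z s)) (Z s \<omega>\<^sub>0) - b (distr M borel (H s)) (H s \<omega>\<^sub>0))
        + C * norm (Z s \<omega> - Z s \<omega>\<^sub>0) + C * norm (H s \<omega>\<^sub>0 - H s \<omega>)"
      using that by (intro add_mono order_refl lipschitz_space P2)
    also have "\<dots> \<le> norm (b (distr M borel (Z s)) (Z s \<omega>\<^sub>0) - b (distr M borel (H s)) (H s \<omega>\<^sub>0))
        + C * (norm (Z s \<omega> - H s \<omega>) + norm (Z s \<omega>\<^sub>0 - H s \<omega>\<^sub>0) + norm (H s \<omega>) + norm (H s \<omega>\<^sub>0))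
        + C * (norm (H s \<omega>) + norm (H s \<omega>\<^sub>0))"
      using C_pos by (intro add_mono order_refl mult_left_mono) (norm, simp, norm, simp)
    also have "\<dots> = norm (b (distr M borel (Z s)) (Z s \<omega>\<^sub>0) - b (distr M borel (H s)) (H s \<omega>\<^sub>0))
        + (C * norm (Z s \<omega>\<^sub>0 - H s \<omega>\<^sub>0) + (2 * C) * norm (H s \<omega>\<^sub>0))
        + (C * norm (Z s \<omega> - H s \<omega>) + (2 * C) * norm (H s \<omega>))"
      by (simp add: algebra_simps)
    finally have "ennreal (norm (b (distr M borel (Z s)) (Z s \<omega>) - b (distr M borel (H s)) (H s \<omega>)))
        \<le> ennreal \<dots>" by (rule ennreal_leI)
    also have "\<dots> = q s + (?C * d s \<omega> + (2 * ?C) * h s \<omega>)"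
      using that C_pos by (simp add: q_def D_def d_def h_def ennreal_mult' ac_simps)
    finally show ?thesis by (simp add: D_def)
  qed
  \<comment> \<open>Gronwall's inequality for each path, followed by integration over the samples\<close>
  have fin: "(\<integral>\<^sup>+s\<in>{0..T}. \<phi> s \<partial>lborel) < \<infinity>"
  proof -
    let ?K = "ennreal (2 * exp (2 * C * T))"
    define a where "a t \<omega> = R t \<omega> + (G + (2 * ?C) * (\<integral>\<^sup>+s\<in>{0..T}. h s \<omega> \<partial>lborel))" for t \<omega>
    have [measurable]: "(\<lambda>(t, \<omega>). a t \<omega>) \<in> borel_measurable (borel \<Otimes>\<^sub>M M)"
      unfolding a_def by measurable
    have "AE \<omega> in M. (\<integral>\<^sup>+s\<in>{0..T}. d s \<omega> \<partial>lborel) \<le> ?K * (\<integral>\<^sup>+t\<in>{0..T}. a t \<omega> \<partial>lborel)"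
      using le d_int_AE AE_space
    proof eventually_elim
      case (elim \<omega>)
      have [measurable]: "\<omega> \<in> space M" using elim by simp
      show ?case
      proof (rule gronwall_nn_integral[OF _ _ C_pos _ elim(2)])
        fix t assume t: "t \<in> {0..T}"
        have "(\<integral>\<^sup>+s\<in>{0..t}. D s \<omega> \<partial>lborel)
            \<le> (\<integral>\<^sup>+s. q s + (?C * (d s \<omega> * indicator {0..t} s) + (2 * ?C) * (h s \<omega> * indicator {0..T} s)) \<partial>lborel)"
          using t by (intro nn_integral_mono)
            (auto split: split_indicator intro: D_le)
        also have "\<dots> = G + (?C * (\<integral>\<^sup>+s\<in>{0..t}. d s \<omega> \<partial>lborel) + (2 * ?C) * (\<integral>\<^sup>+s\<in>{0..T}. h s \<omega> \<partial>lborel))"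
          by (simp add: nn_integral_add nn_integral_cmult G_def)
        finally have *: "(\<integral>\<^sup>+s\<in>{0..t}. D s \<omega> \<partial>lborel) \<le> \<dots>" .
        have "d t \<omega> \<le> R t \<omega> + (\<integral>\<^sup>+s\<in>{0..t}. D s \<omega> \<partial>lborel)"
          using elim(1) t by (simp add: d_def D_def)
        also note *
        finally show "d t \<omega> \<le> a t \<omega> + ?C * (\<integral>\<^sup>+s\<in>{0..t}. d s \<omega> \<partial>lborel)"
          by (simp add: a_def ac_simps add_left_mono)
      qed measurable
    qed
    then have "(\<integral>\<^sup>+\<omega>. (\<integral>\<^sup>+s\<in>{0..T}. d s \<omega> \<partial>lborel) \<partial>M) \<le> (\<integral>\<^sup>+\<omega>. ?K * (\<integral>\<^sup>+t\<in>{0..T}. a t \<omega> \<partial>lborel) \<partial>M)"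
      by (rule nn_integral_mono_AE)
    also have "\<dots> = ?K * (\<integral>\<^sup>+t\<in>{0..T}. (\<integral>\<^sup>+\<omega>. a t \<omega> \<partial>M) \<partial>lborel)"
      by (subst nn_integral_cmult) (measurable, subst swap, simp_all)
    also have "\<dots> \<le> ?K * (\<integral>\<^sup>+t\<in>{0..T}. (ennreal \<epsilon> + (G + (2 * ?C) * (\<integral>\<^sup>+s\<in>{0..T}. (\<integral>\<^sup>+\<omega>. h s \<omega> \<partial>M) \<partial>lborel))) \<partial>lborel)"
    proof (intro mult_left_mono nn_integral_mono)
      fix t
      have "(\<integral>\<^sup>+\<omega>. a t \<omega> \<partial>M) \<le> ennreal \<epsilon> + (G + (2 * ?C) * (\<integral>\<^sup>+s\<in>{0..T}. (\<integral>\<^sup>+\<omega>. h s \<omega> \<partial>M) \<partial>lborel))"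
        if "t \<in> {0..T}"
        unfolding a_def using R_int[OF that]
        by (simp add: nn_integral_add nn_integral_cmult swap emeasure_space_1 add_right_mono)
      then show "(\<integral>\<^sup>+\<omega>. a t \<omega> \<partial>M) * indicator {0..T} t
         \<le> (ennreal \<epsilon> + (G + (2 * ?C) * (\<integral>\<^sup>+s\<in>{0..T}. (\<integral>\<^sup>+\<omega>. h s \<omega> \<partial>M) \<partial>lborel))) * indicator {0..T} t"
        by (auto split: split_indicator)
    qed simp
    also have "\<dots> < \<infinity>"
      using G H_int \<open>T \<ge> 0\<close> by (auto simp: nn_integral_cmult_indicator ennreal_mult_less_top h_def)
    finally show ?thesis
      by (simp add: swap \<phi>_def)
  qed
  \<comment> \<open>the inequality for the expected distance, in which the laws are compared by \<open>\<phi>\<close>\<close>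
  have step: "\<phi> t \<le> ennreal \<epsilon> + ennreal (2 * C) * (\<integral>\<^sup>+s\<in>{0..t}. \<phi> s \<partial>lborel)" if t: "t \<in> {0..T}" for t
  proof -
    have "AE \<omega> in M. d t \<omega> \<le> R t \<omega> + ?C * ((\<integral>\<^sup>+s\<in>{0..t}. \<phi> s \<partial>lborel) + (\<integral>\<^sup>+s\<in>{0..t}. d s \<omega> \<partial>lborel))"
      using le AE_space
    proof eventually_elim
      case (elim \<omega>)
      have [measurable]: "\<omega> \<in> space M" using elim by simp
      have "(\<integral>\<^sup>+s\<in>{0..t}. D s \<omega> \<partial>lborel)
          \<le> (\<integral>\<^sup>+s. ?C * (\<phi> s * indicator {0..t} s + d s \<omega> * indicator {0..t} s) \<partial>lborel)"
        using t by (intro nn_integral_mono)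
          (auto split: split_indicator simp: D_def d_def \<phi>_def intro!: lipschitz_laws P2)
      also have "\<dots> = ?C * ((\<integral>\<^sup>+s\<in>{0..t}. \<phi> s \<partial>lborel) + (\<integral>\<^sup>+s\<in>{0..t}. d s \<omega> \<partial>lborel))"
        by (simp add: nn_integral_add nn_integral_cmult)
      finally have *: "(\<integral>\<^sup>+s\<in>{0..t}. D s \<omega> \<partial>lborel) \<le> \<dots>" .
      have "d t \<omega> \<le> R t \<omega> + (\<integral>\<^sup>+s\<in>{0..t}. D s \<omega> \<partial>lborel)"
        using elim(1) t by (simp add: d_def D_def)
      also note *
      finally show ?case by (simp add: add_left_mono)
    qed
    then have "\<phi> t \<le> (\<integral>\<^sup>+\<omega>. R t \<omega> + ?C * ((\<integral>\<^sup>+s\<in>{0..t}. \<phi> s \<partial>lborel) + (\<integral>\<^sup>+s\<in>{0..t}. d s \<omega> \<partial>lborel)) \<partial>M)"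
      unfolding \<phi>_def[of t] by (rule nn_integral_mono_AE)
    also have "\<dots> = (\<integral>\<^sup>+\<omega>. R t \<omega> \<partial>M) + ?C * ((\<integral>\<^sup>+s\<in>{0..t}. \<phi> s \<partial>lborel) + (\<integral>\<^sup>+s\<in>{0..t}. \<phi> s \<partial>lborel))"
      by (simp add: nn_integral_add nn_integral_cmult swap emeasure_space_1 flip: \<phi>_def)
    also have "\<dots> \<le> ennreal \<epsilon> + ennreal (2 * C) * (\<integral>\<^sup>+s\<in>{0..t}. \<phi> s \<partial>lborel)"
      using R_int[OF t] C_pos by (simp add: ennreal_mult' add_right_mono ac_simps flip: mult_2)
    finally show ?thesis .
  qed
  have "(\<integral>\<^sup>+s\<in>{0..T}. \<phi> s \<partial>lborel) \<le> ennreal (2 * exp (2 * (2 * C) * T)) * (\<integral>\<^sup>+s\<in>{0..T}. ennreal \<epsilon> \<partial>lborel)"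
    using C_pos step by (intro gronwall_nn_integral[OF _ _ _ _ fin]) auto
  also have "\<dots> = ennreal (2 * exp (4 * C * T) * (\<epsilon> * T))"
    using \<open>T \<ge> 0\<close> \<open>\<epsilon> \<ge> 0\<close> by (simp add: nn_integral_cmult_indicator ennreal_mult' mult.assoc)
  finally have int: "(\<integral>\<^sup>+s\<in>{0..T}. \<phi> s \<partial>lborel) \<le> \<dots>" .
  have "\<phi> T \<le> ennreal \<epsilon> + ennreal (2 * C) * (\<integral>\<^sup>+s\<in>{0..T}. \<phi> s \<partial>lborel)"
    using \<open>T \<ge> 0\<close> by (intro step) auto
  also have "\<dots> \<le> ennreal \<epsilon> + ennreal (2 * C) * ennreal (2 * exp (4 * C * T) * (\<epsilon> * T))"
    by (intro add_left_mono mult_left_mono int) simp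
  also have "\<dots> = ennreal (\<epsilon> * (1 + 4 * C * T * exp (4 * C * T)))"
    using \<open>T \<ge> 0\<close> \<open>\<epsilon> \<ge> 0\<close> C_pos by (simp flip: ennreal_mult' ennreal_plus add: algebra_simps)
  finally show ?thesis by (simp add: \<phi>_def d_def)
qed

end

section \<open>Gaussian increments of Brownian motion\<close>

definition gaussian_measure :: "real \<Rightarrow> (real^'n) measure" where
  "gaussian_measure \<tau> = density lborel (\<lambda>x. ennreal (\<Prod>i\<in>UNIV. normal_density 0 (sqrt \<tau>) (x $ i)))"

lemma nn_integral_lborel_vec_prod:
  fixes g :: "'n::finite \<Rightarrow> real \<Rightarrow> ennreal"
  assumes "\<And>i. g i \<in> borel_measurable borel"
  shows "(\<integral>\<^sup>+x. (\<Prod>i\<in>UNIV. g i (x $ i)) \<partial>lborel) = (\<Prod>i\<in>UNIV. (\<integral>\<^sup>+x. g i x \<partial>lborel))"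
proof -
  have inj: "inj (\<lambda>i::'n. axis i (1::real))"
    by (auto intro!: injI simp: axis_eq_axis)
  have B: "Basis = range (\<lambda>i::'n. axis i (1::real))"
    by (auto simp: Basis_vec_def)
  define f where "f b = g (inv (\<lambda>i::'n. axis i (1::real)) b)" for b
  have f: "f (axis i 1) = g i" for i
    by (simp add: f_def inv_f_f[OF inj])
  have "(\<integral>\<^sup>+x. (\<Prod>b\<in>Basis. f b (x \<bullet> b)) \<partial>lborel) = (\<Prod>b\<in>Basis. (\<integral>\<^sup>+x. f b x \<partial>lborel))"
    using assms by (intro nn_integral_lborel_prod) (auto simp: f_def)
  then show ?thesis
    by (simp add: B prod.reindex[OF inj] f inner_axis)
qed

text \<open>Each summand \<open>(x $ j)\<^sup>2\<close> of \<open>(norm x)\<^sup>2\<close> times the density is a product over the coordinates, and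
  its integral is the variance \<open>\<tau>\<close> of the coordinate \<open>j\<close>.\<close>

lemma gaussian_second_moment:
  assumes "\<tau> > 0"
  shows "(\<integral>\<^sup>+x. ennreal ((norm x)\<^sup>2) \<partial>(gaussian_measure \<tau> :: (real^'n) measure)) = ennreal (real CARD('n) * \<tau>)"
proof -
  let ?N = "normal_density 0 (sqrt \<tau>)"
  have [simp]: "sqrt \<tau> > 0" using assms by simp
  have one: "(\<integral>\<^sup>+x. ennreal (?N x) \<partial>lborel) = 1"
    using assms by (subst nn_integral_eq_integral) auto
  have two: "(\<integral>\<^sup>+x. ennreal (?N x * x\<^sup>2) \<partial>lborel) = ennreal \<tau>"
    using normal_moment_even[OF \<open>sqrt \<tau> > 0\<close>, of 0 1] assms
    by (subst nn_integral_eq_integral)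
       (auto simp: has_bochner_integral_iff fact_numeral)
  define g where "g j i x = ennreal (?N x * (if i = j then x\<^sup>2 else 1))" for i j :: 'n and x
  have [measurable]: "g j i \<in> borel_measurable borel" for i j
    unfolding g_def by measurable
  have "(\<integral>\<^sup>+x. ennreal ((norm x)\<^sup>2) \<partial>(gaussian_measure \<tau> :: (real^'n) measure))
      = (\<integral>\<^sup>+x. ennreal (\<Prod>i\<in>UNIV. ?N (x $ i)) * ennreal ((norm x)\<^sup>2) \<partial>(lborel :: (real^'n) measure))"
    unfolding gaussian_measure_def by (subst nn_integral_density) auto
  also have "\<dots> = (\<integral>\<^sup>+x. (\<Sum>j\<in>UNIV. \<Prod>i\<in>UNIV. g j i (x $ i)) \<partial>(lborel :: (real^'n) measure))"
  proof (intro nn_integral_cong)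
    fix x :: "real^'n"
    have "(\<Prod>i\<in>UNIV. ?N (x $ i)) * (norm x)\<^sup>2
        = (\<Sum>j\<in>UNIV. (\<Prod>i\<in>UNIV. ?N (x $ i)) * (x $ j)\<^sup>2)"
      by (simp add: norm_vec_def L2_set_def sum_nonneg sum_distrib_left)
    also have "\<dots> = (\<Sum>j\<in>UNIV. \<Prod>i\<in>UNIV. ?N (x $ i) * (if i = j then (x $ i)\<^sup>2 else 1))"
      by (simp add: prod.distrib)
    finally show "ennreal (\<Prod>i\<in>UNIV. ?N (x $ i)) * ennreal ((norm x)\<^sup>2)
        = (\<Sum>j\<in>UNIV. \<Prod>i\<in>UNIV. g j i (x $ i))"
      unfolding g_def by (simp add: prod_ennreal sum_ennreal prod_nonneg flip: ennreal_mult')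
  qed
  also have "\<dots> = (\<Sum>j\<in>(UNIV :: 'n set). \<Prod>i\<in>(UNIV :: 'n set). \<integral>\<^sup>+x. g j i x \<partial>lborel)"
    by (simp add: nn_integral_sum nn_integral_lborel_vec_prod)
  also have "\<dots> = (\<Sum>j\<in>(UNIV :: 'n set). \<Prod>i\<in>(UNIV :: 'n set). if i = j then ennreal \<tau> else 1)"
    by (intro sum.cong prod.cong refl) (simp add: g_def one two)
  also have "\<dots> = ennreal (real CARD('n) * \<tau>)"
    using assms by (simp add: ennreal_mult'' ennreal_of_nat_eq_real_of_nat)
  finally show ?thesis .
qed

lemma distributed_scaleR:
  fixes X :: "'w \<Rightarrow> 'a::euclidean_space"
  assumes X: "distributed M lborel X f" and "a > 0"
  shows "distributed M lborel (\<lambda>\<omega>. X \<omega> /\<^sub>R a) (\<lambda>x. ennreal (a ^ DIM('a)) * f (a *\<^sub>R x))"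
proof -
  have [measurable]: "X \<in> borel_measurable M" "f \<in> borel_measurable borel"
    using X by (auto simp: distributed_def)
  have "distr M lborel (\<lambda>\<omega>. X \<omega> /\<^sub>R a) = density lborel (\<lambda>x. ennreal (a ^ DIM('a)) * f (a *\<^sub>R x))"
  proof (rule measure_eqI)
    fix A :: "'a set" assume "A \<in> sets (distr M lborel (\<lambda>\<omega>. X \<omega> /\<^sub>R a))"
    then have [measurable]: "A \<in> sets borel" by simp
    have "emeasure (distr M lborel (\<lambda>\<omega>. X \<omega> /\<^sub>R a)) A
        = (\<integral>\<^sup>+\<omega>. indicator A (X \<omega> /\<^sub>R a) \<partial>M)"
    proof -
      have "emeasure (distr M lborel (\<lambda>\<omega>. X \<omega> /\<^sub>R a)) A
          = (\<integral>\<^sup>+x. indicator A x \<partial>distr M lborel (\<lambda>\<omega>. X \<omega> /\<^sub>R a))"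
        by (rule nn_integral_indicator[symmetric]) simp
      also have "\<dots> = (\<integral>\<^sup>+\<omega>. indicator A (X \<omega> /\<^sub>R a) \<partial>M)"
        by (rule nn_integral_distr[where f="indicator A"]) simp_all
      finally show ?thesis .
    qed
    also have "\<dots> = (\<integral>\<^sup>+x. f x * indicator A (x /\<^sub>R a) \<partial>lborel)"
      by (rule distributed_nn_integral[OF X, symmetric, where g="\<lambda>x. indicator A (x /\<^sub>R a)"]) simp
    also have "\<dots> = (\<integral>\<^sup>+x. f x * indicator A (x /\<^sub>R a) \<partial>density (distr lborel borel (\<lambda>x. 0 + a *\<^sub>R x)) (\<lambda>_. ennreal (\<bar>a\<bar> ^ DIM('a))))"
      by (rule arg_cong2[where f=nn_integral, OF lborel_affine refl]) (use \<open>a > 0\<close> in simp)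
    also have "\<dots> = (\<integral>\<^sup>+x. ennreal (\<bar>a\<bar> ^ DIM('a)) * (f (0 + a *\<^sub>R x) * indicator A ((0 + a *\<^sub>R x) /\<^sub>R a)) \<partial>lborel)"
    proof -
      define g where "g x = f x * indicator A (x /\<^sub>R a)" for x
      have [measurable]: "g \<in> borel_measurable borel"
        unfolding g_def by measurable
      have "(\<integral>\<^sup>+x. g x \<partial>density (distr lborel borel (\<lambda>x. 0 + a *\<^sub>R x)) (\<lambda>_. ennreal (\<bar>a\<bar> ^ DIM('a))))
          = (\<integral>\<^sup>+x. ennreal (\<bar>a\<bar> ^ DIM('a)) * g x \<partial>distr lborel borel (\<lambda>x. 0 + a *\<^sub>R x))"
        by (rule nn_integral_density) simp_all
      also have "\<dots> = (\<integral>\<^sup>+x. ennreal (\<bar>a\<bar> ^ DIM('a)) * g (0 + a *\<^sub>R x) \<partial>lborel)"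
        by (rule nn_integral_distr) simp_all
      finally show ?thesis unfolding g_def .
    qed
    also have "\<dots> = (\<integral>\<^sup>+x. ennreal (a ^ DIM('a)) * f (a *\<^sub>R x) * indicator A x \<partial>lborel)"
      using \<open>a > 0\<close> by (simp add: mult.assoc)
    finally show "emeasure (distr M lborel (\<lambda>\<omega>. X \<omega> /\<^sub>R a)) A
        = emeasure (density lborel (\<lambda>x. ennreal (a ^ DIM('a)) * f (a *\<^sub>R x))) A"
      by (simp add: emeasure_density)
  qed simp
  then show ?thesis by (simp add: distributed_def)
qed

text \<open>Brownian scaling together with the filtration: this makes \<open>W (\<gamma> s) / sqrt \<gamma>\<close> the noise of the
  rescaled underdamped equation.\<close>

lemma brownian_scaling:
  fixes W :: "real \<Rightarrow> 'w \<Rightarrow> real^'n"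
  assumes BM: "brownian_motion M F W" and "c > 0"
  shows "brownian_motion M (\<lambda>t. F (c * t)) (\<lambda>t \<omega>. W (c * t) \<omega> /\<^sub>R sqrt c)"
  unfolding brownian_motion_def
proof (intro conjI allI impI)
  have M: "prob_space M" using BM by (simp add: brownian_motion_def)
  interpret prob_space M by fact
  show "prob_space M" by fact
  have filt: "filtration (space M) F" using BM by (simp add: brownian_motion_def)
  show "filtration (space M) (\<lambda>t. F (c * t))"
    using filtration.space_F[OF filt] filtration.sets_F_mono[OF filt] \<open>c > 0\<close>
    by (intro filtration.intro) (auto simp: mult_left_mono)
  show "subalgebra M (F (c * t))" for t
    using BM by (simp add: brownian_motion_def)
  show "(\<lambda>\<omega>. W (c * t) \<omega> /\<^sub>R sqrt c) \<in> borel_measurable (F (c * t))" if "t \<ge> 0" for t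
  proof -
    have "\<forall>t\<ge>0. W t \<in> borel_measurable (F t)"
      using BM by (simp add: brownian_motion_def)
    then have "W (c * t) \<in> borel_measurable (F (c * t))"
      using that \<open>c > 0\<close> by simp
    then show ?thesis
      by (rule borel_measurable_scaleR[OF borel_measurable_const])
  qed
  have "AE \<omega> in M. W 0 \<omega> = 0 \<and> continuous_on {0..} (\<lambda>t. W t \<omega>)"
    using BM by (simp add: brownian_motion_def)
  then show "AE \<omega> in M. W (c * 0) \<omega> /\<^sub>R sqrt c = 0 \<and> continuous_on {0..} (\<lambda>t. W (c * t) \<omega> /\<^sub>R sqrt c)"
  proof eventually_elim
    case (elim \<omega>)
    have "continuous_on {0..} (\<lambda>t. W (c * t) \<omega>)"
    proof (rule continuous_on_compose2[of "{0..}" "\<lambda>t. W t \<omega>"])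
      show "continuous_on {0..} (\<lambda>t. W t \<omega>)" using elim by blast
      show "continuous_on {0..} (\<lambda>t. c * t)" by (intro continuous_intros)
      show "(*) c ` {0..} \<subseteq> {0..}" using \<open>c > 0\<close> by auto
    qed
    then have "continuous_on {0..} (\<lambda>t. W (c * t) \<omega> /\<^sub>R sqrt c)"
      by (rule continuous_on_scaleR[OF continuous_on_const])
    moreover have "W (c * 0) \<omega> /\<^sub>R sqrt c = 0" using elim by simp
    ultimately show ?case by blast
  qed
  fix s t :: real assume st: "0 \<le> s" "s < t"
  then have cst: "0 \<le> c * s" "c * s < c * t" using \<open>c > 0\<close> by auto
  have diff: "W (c * t) \<omega> /\<^sub>R sqrt c - W (c * s) \<omega> /\<^sub>R sqrt c = (W (c * t) \<omega> - W (c * s) \<omega>) /\<^sub>R sqrt c" for \<omega>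
    by (simp add: scaleR_diff_right)
  have ind: "indep_set (sets (F (c * s)))
      (sets (vimage_algebra (space M) (\<lambda>\<omega>. W (c * t) \<omega> - W (c * s) \<omega>) borel))"
    using BM cst unfolding brownian_motion_def by blast
  have sub: "sets (vimage_algebra (space M) (\<lambda>\<omega>. (W (c * t) \<omega> - W (c * s) \<omega>) /\<^sub>R sqrt c) borel)
      \<subseteq> sets (vimage_algebra (space M) (\<lambda>\<omega>. W (c * t) \<omega> - W (c * s) \<omega>) borel)"
  proof (rule sets_image_in_sets)
    have [measurable]: "(\<lambda>\<omega>. W (c * t) \<omega> - W (c * s) \<omega>)
        \<in> borel_measurable (vimage_algebra (space M) (\<lambda>\<omega>. W (c * t) \<omega> - W (c * s) \<omega>) borel)"
      by (rule measurable_vimage_algebra1) auto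
    show "(\<lambda>\<omega>. (W (c * t) \<omega> - W (c * s) \<omega>) /\<^sub>R sqrt c)
        \<in> borel_measurable (vimage_algebra (space M) (\<lambda>\<omega>. W (c * t) \<omega> - W (c * s) \<omega>) borel)"
      by measurable
  qed simp
  show "indep_set (sets (F (c * s)))
      (sets (vimage_algebra (space M) (\<lambda>\<omega>. W (c * t) \<omega> /\<^sub>R sqrt c - W (c * s) \<omega> /\<^sub>R sqrt c) borel))"
    unfolding diff using ind sub unfolding indep_sets2_eq by blast
  have "distributed M lborel (\<lambda>\<omega>. W (c * t) \<omega> - W (c * s) \<omega>)
      (\<lambda>x. ennreal (\<Prod>i\<in>UNIV. normal_density 0 (sqrt (c * t - c * s)) (x $ i)))"
    using BM cst unfolding brownian_motion_def by blast
  from distributed_scaleR[OF this, of "sqrt c"] \<open>c > 0\<close>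
  have d: "distributed M lborel (\<lambda>\<omega>. (W (c * t) \<omega> - W (c * s) \<omega>) /\<^sub>R sqrt c)
      (\<lambda>x. ennreal (sqrt c ^ CARD('n)) * ennreal (\<Prod>i\<in>UNIV. normal_density 0 (sqrt (c * t - c * s)) (sqrt c * x $ i)))"
    by simp
  have nd: "sqrt c * normal_density 0 (sqrt (c * t - c * s)) (sqrt c * y) = normal_density 0 (sqrt (t - s)) y" for y
  proof -
    define \<tau> where "\<tau> = t - s"
    have \<tau>: "\<tau> > 0" "c * t - c * s = c * \<tau>"
      using st by (auto simp: \<tau>_def algebra_simps)
    have 1: "sqrt (2 * pi * (c * \<tau>)) = sqrt c * sqrt (2 * pi * \<tau>)"
      by (simp add: real_sqrt_mult)
    have 2: "- ((sqrt c * y)\<^sup>2) / (2 * (c * \<tau>)) = - (y\<^sup>2) / (2 * \<tau>)"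
      using \<open>c > 0\<close> by (simp add: power_mult_distrib)
    have sq: "(sqrt (c * \<tau>))\<^sup>2 = c * \<tau>" "(sqrt \<tau>)\<^sup>2 = \<tau>"
      using \<tau> \<open>c > 0\<close> by simp_all
    show ?thesis
      unfolding \<tau>(2) \<tau>_def[symmetric] normal_density_def sq diff_zero 1 2
      using \<open>c > 0\<close> by simp
  qed
  have "ennreal (sqrt c ^ CARD('n)) * ennreal (\<Prod>i\<in>UNIV. normal_density 0 (sqrt (c * t - c * s)) (sqrt c * x $ i))
      = ennreal (\<Prod>i\<in>UNIV. normal_density 0 (sqrt (t - s)) (x $ i))" for x :: "real^'n"
  proof -
    have "sqrt c ^ CARD('n) * (\<Prod>i\<in>UNIV. normal_density 0 (sqrt (c * t - c * s)) (sqrt c * x $ i))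
        = (\<Prod>i\<in>UNIV. sqrt c * normal_density 0 (sqrt (c * t - c * s)) (sqrt c * x $ i))"
      by (simp add: prod.distrib)
    then show ?thesis
      using \<open>c > 0\<close> by (simp add: nd flip: ennreal_mult')
  qed
  with d show "distributed M lborel (\<lambda>\<omega>. W (c * t) \<omega> /\<^sub>R sqrt c - W (c * s) \<omega> /\<^sub>R sqrt c)
      (\<lambda>x. ennreal (\<Prod>i\<in>UNIV. normal_density 0 (sqrt (t - s)) (x $ i)))"
    by (simp add: diff)
qed

lemma brownian_measurable:
  assumes "brownian_motion M F W" "t \<ge> 0"
  shows "W t \<in> borel_measurable M"
  using assms measurable_from_subalg unfolding brownian_motion_def by blast

lemma brownian_increment_second_moment:
  fixes W :: "real \<Rightarrow> 'w \<Rightarrow> real^'n"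
  assumes BM: "brownian_motion M F W" and "0 \<le> s" "s \<le> t"
  shows "(\<integral>\<^sup>+\<omega>. ennreal ((norm (W t \<omega> - W s \<omega>))\<^sup>2) \<partial>M) = ennreal (real CARD('n) * (t - s))"
proof (cases "s = t")
  case False
  then have "s < t" using \<open>s \<le> t\<close> by simp
  have d: "distributed M lborel (\<lambda>\<omega>. W t \<omega> - W s \<omega>)
      (\<lambda>x. ennreal (\<Prod>i\<in>UNIV. normal_density 0 (sqrt (t - s)) (x $ i)))"
    using BM \<open>0 \<le> s\<close> \<open>s < t\<close> unfolding brownian_motion_def by blast
  show ?thesis
    using distributed_nn_integral[OF d, of "\<lambda>x. ennreal ((norm x)\<^sup>2)"]
      gaussian_second_moment[of "t - s", where 'n='n] \<open>s < t\<close>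
    by (simp add: gaussian_measure_def nn_integral_density)
qed simp

text \<open>From the second moment by \<open>x \<le> \<delta> + x\<^sup>2 / \<delta>\<close>. The choice \<open>\<delta> = sqrt (t - s)\<close> gives the right order
  \<open>sqrt (t - s)\<close>; a free \<open>\<delta>\<close> keeps the bound affine in \<open>t - s\<close>, which makes it easy to average
  over \<open>s\<close>.\<close>

lemma brownian_increment_first_moment:
  fixes W :: "real \<Rightarrow> 'w \<Rightarrow> real^'n"
  assumes BM: "brownian_motion M F W" and "0 \<le> s" "s \<le> t" and "\<delta> > 0"
  shows "(\<integral>\<^sup>+\<omega>. ennreal (norm (W t \<omega> - W s \<omega>)) \<partial>M) \<le> ennreal (\<delta> + real CARD('n) * (t - s) / \<delta>)"
proof -
  interpret prob_space M using BM by (simp add: brownian_motion_def)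
  have [measurable]: "W t \<in> borel_measurable M" "W s \<in> borel_measurable M"
    using assms by (auto intro: brownian_measurable)
  have "x \<le> \<delta> + (1 / \<delta>) * x\<^sup>2" if "x \<ge> 0" for x :: real
  proof (cases "x \<le> \<delta>")
    case True then show ?thesis using \<open>\<delta> > 0\<close> by (simp add: add_increasing2)
  next
    case False
    then have "x * \<delta> \<le> x * x" using that by (intro mult_left_mono) auto
    then have "x \<le> (1 / \<delta>) * x\<^sup>2" using \<open>\<delta> > 0\<close> by (simp add: field_simps power2_eq_square)
    then show ?thesis using \<open>\<delta> > 0\<close> by linarith
  qed
  note young = this
  define q where "q \<omega> = ennreal ((norm (W t \<omega> - W s \<omega>))\<^sup>2)" for \<omega>
  have [measurable]: "q \<in> borel_measurable M"
    unfolding q_def by measurable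
  have q: "(\<integral>\<^sup>+\<omega>. q \<omega> \<partial>M) = ennreal (real CARD('n) * (t - s))"
    unfolding q_def by (rule brownian_increment_second_moment[OF BM \<open>0 \<le> s\<close> \<open>s \<le> t\<close>])
  have "(\<integral>\<^sup>+\<omega>. ennreal (norm (W t \<omega> - W s \<omega>)) \<partial>M)
      \<le> (\<integral>\<^sup>+\<omega>. ennreal \<delta> + ennreal (1 / \<delta>) * q \<omega> \<partial>M)"
  proof (intro nn_integral_mono)
    fix \<omega>
    have "ennreal (norm (W t \<omega> - W s \<omega>)) \<le> ennreal (\<delta> + (1 / \<delta>) * (norm (W t \<omega> - W s \<omega>))\<^sup>2)"
      by (intro ennreal_leI young norm_ge_zero)
    also have "\<dots> = ennreal \<delta> + ennreal ((1 / \<delta>) * (norm (W t \<omega> - W s \<omega>))\<^sup>2)"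
      using \<open>\<delta> > 0\<close> by (intro ennreal_plus) auto
    also have "\<dots> = ennreal \<delta> + ennreal (1 / \<delta>) * q \<omega>"
      unfolding q_def using \<open>\<delta> > 0\<close> by (subst ennreal_mult') auto
    finally show "ennreal (norm (W t \<omega> - W s \<omega>)) \<le> ennreal \<delta> + ennreal (1 / \<delta>) * q \<omega>" .
  qed
  also have "\<dots> = ennreal \<delta> + ennreal (1 / \<delta>) * (\<integral>\<^sup>+\<omega>. q \<omega> \<partial>M)"
    by (simp add: nn_integral_add nn_integral_cmult emeasure_space_1)
  also have "\<dots> = ennreal \<delta> + ennreal ((1 / \<delta>) * (real CARD('n) * (t - s)))"
    unfolding q using \<open>\<delta> > 0\<close> by (subst ennreal_mult'[symmetric]) simp_all
  also have "\<dots> = ennreal (\<delta> + (1 / \<delta>) * (real CARD('n) * (t - s)))"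
    using \<open>\<delta> > 0\<close> \<open>s \<le> t\<close> by (intro ennreal_plus[symmetric]) auto
  finally show ?thesis by simp
qed

lemma brownian_increment_indep:
  fixes W :: "real \<Rightarrow> 'w \<Rightarrow> real^'n" and X :: "'w \<Rightarrow> real^'n"
  assumes BM: "brownian_motion M F W" and st: "0 \<le> s" "s < t" and X: "X \<in> borel_measurable (F s)"
  shows "distr M (borel \<Otimes>\<^sub>M borel) (\<lambda>\<omega>. (X \<omega>, W t \<omega> - W s \<omega>)) = distr M borel X \<Otimes>\<^sub>M gaussian_measure (t - s)"
proof -
  interpret prob_space M using BM by (simp add: brownian_motion_def)
  have sub: "subalgebra M (F s)" using BM by (simp add: brownian_motion_def)
  let ?D = "\<lambda>\<omega>. W t \<omega> - W s \<omega>"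
  have [measurable]: "W t \<in> borel_measurable M" "W s \<in> borel_measurable M"
    using BM st by (auto intro: brownian_measurable)
  have XM[measurable]: "X \<in> borel_measurable M"
    using measurable_from_subalg[OF sub X] .
  have ind: "indep_set (sets (F s)) (sets (vimage_algebra (space M) ?D borel))"
    using BM st unfolding brownian_motion_def by blast
  have "indep_var borel X borel ?D"
    unfolding indep_var_eq
  proof (intro conjI)
    have 1: "sigma_sets (space M) {X -` A \<inter> space M | A. A \<in> sets borel} \<subseteq> sets (F s)"
      using sets_image_in_sets[OF _ X] sub by (simp add: sets_vimage_algebra subalgebra_def)
    have 2: "sigma_sets (space M) {?D -` A \<inter> space M | A. A \<in> sets borel}
        \<subseteq> sets (vimage_algebra (space M) ?D borel)"
      by (simp add: sets_vimage_algebra)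
    show "indep_set (sigma_sets (space M) {X -` A \<inter> space M | A. A \<in> sets borel})
        (sigma_sets (space M) {?D -` A \<inter> space M | A. A \<in> sets borel})"
      using ind 1 2 unfolding indep_sets2_eq by blast
  qed measurable
  then have "distr M (borel \<Otimes>\<^sub>M borel) (\<lambda>\<omega>. (X \<omega>, ?D \<omega>)) = distr M borel X \<Otimes>\<^sub>M distr M borel ?D"
    by (simp add: indep_var_distribution_eq)
  also have "distr M borel ?D = gaussian_measure (t - s)"
  proof -
    have "distributed M lborel ?D (\<lambda>x. ennreal (\<Prod>i\<in>UNIV. normal_density 0 (sqrt (t - s)) (x $ i)))"
      using BM st unfolding brownian_motion_def by blast
    then have "distr M lborel ?D = gaussian_measure (t - s)"
      by (simp add: distributed_def gaussian_measure_def)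
    then show ?thesis by (simp cong: distr_cong)
  qed
  finally show ?thesis .
qed

lemma brownian_start:
  assumes "brownian_motion M F W"
  shows "AE \<omega> in M. W 0 \<omega> = 0"
  using assms by (simp add: brownian_motion_def)

lemma brownian_first_moment:
  fixes W :: "real \<Rightarrow> 'w \<Rightarrow> real^'n"
  assumes BM: "brownian_motion M F W" and "0 \<le> t"
  shows "(\<integral>\<^sup>+\<omega>. ennreal (norm (W t \<omega>)) \<partial>M) \<le> ennreal (1 + real CARD('n) * t)"
proof -
  have "(\<integral>\<^sup>+\<omega>. ennreal (norm (W t \<omega>)) \<partial>M) = (\<integral>\<^sup>+\<omega>. ennreal (norm (W t \<omega> - W 0 \<omega>)) \<partial>M)"
    using brownian_start[OF BM] by (intro nn_integral_cong_AE) auto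
  also have "\<dots> \<le> ennreal (1 + real CARD('n) * t)"
    using brownian_increment_first_moment[OF BM order_refl \<open>0 \<le> t\<close>, of 1] by simp
  finally show ?thesis .
qed

section \<open>The law of the Euler scheme\<close>

locale mean_field_sde = lipschitz_drift b C
  for b :: "(real^'n) measure \<Rightarrow> real^'n \<Rightarrow> real^'n" and C +
  fixes \<sigma> :: real and \<mu>\<^sub>0 :: "(real^'n) measure"
  assumes \<sigma>_nonneg: "0 \<le> \<sigma>" and initial_P2: "\<mu>\<^sub>0 \<in> P2"
begin

text \<open>The scheme for the law runs without reference to a probability space. The second scheme is run
  along a noise; it takes the law in the drift from the first one, which by
  \<open>euler_adapted_and_law\<close> is its own law.\<close>

primrec euler_law :: "real \<Rightarrow> nat \<Rightarrow> (real^'n) measure" where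
  "euler_law h 0 = \<mu>\<^sub>0"
| "euler_law h (Suc k) = distr (euler_law h k \<Otimes>\<^sub>M gaussian_measure h) borel
     (\<lambda>(x, z). x - h *\<^sub>R b (euler_law h k) x + \<sigma> *\<^sub>R z)"

primrec euler :: "real \<Rightarrow> ('w \<Rightarrow> real^'n) \<Rightarrow> (real \<Rightarrow> 'w \<Rightarrow> real^'n) \<Rightarrow> nat \<Rightarrow> 'w \<Rightarrow> real^'n" where
  "euler h \<xi> W 0 \<omega> = \<xi> \<omega>"
| "euler h \<xi> W (Suc k) \<omega> = euler h \<xi> W k \<omega> - h *\<^sub>R b (euler_law h k) (euler h \<xi> W k \<omega>)
     + \<sigma> *\<^sub>R (W (h * real (Suc k)) \<omega> - W (h * real k) \<omega>)"

text \<open>The state at time \<open>h k\<close> is measurable with respect to the past, hence independent of the next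
  increment. The joint law of the two is therefore the product measure in the recursion.\<close>

lemma euler_adapted_and_law:
  fixes \<xi> :: "'w \<Rightarrow> real^'n"
  assumes BM: "brownian_motion M F W" and \<xi>: "\<xi> \<in> borel_measurable (F 0)" "distr M borel \<xi> = \<mu>\<^sub>0"
    and "h > 0"
  shows "euler h \<xi> W k \<in> borel_measurable (F (h * real k))
    \<and> distr M borel (euler h \<xi> W k) = euler_law h k \<and> euler_law h k \<in> P2"
proof (induction k)
  case 0
  have "euler h \<xi> W 0 = \<xi>" by (simp add: fun_eq_iff)
  then show ?case using \<xi> initial_P2 by simp
next
  case (Suc k)
  let ?E = "euler h \<xi> W k" and ?\<mu> = "euler_law h k"
  define s t where "s = h * real k" and "t = h * real (Suc k)"
  have st: "0 \<le> s" "s < t" "t - s = h"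
    using \<open>h > 0\<close> by (auto simp: s_def t_def algebra_simps)
  have E: "?E \<in> borel_measurable (F s)" "distr M borel ?E = ?\<mu>" and \<mu>: "?\<mu> \<in> P2"
    using Suc by (auto simp: s_def)
  interpret prob_space M using BM by (simp add: brownian_motion_def)
  have filt: "filtration (space M) F" and sub: "subalgebra M (F r)" for r
    using BM by (auto simp: brownian_motion_def)
  have adapted: "\<forall>r\<ge>0. W r \<in> borel_measurable (F r)"
    using BM by (simp add: brownian_motion_def)
  have mono: "f \<in> borel_measurable (F t)" if "f \<in> borel_measurable (F s)" for f :: "'w \<Rightarrow> real^'n"
  proof -
    have "subalgebra (F t) (F s)"
      using filtration.space_F[OF filt] filtration.sets_F_mono[OF filt, of s t] st
      by (simp add: subalgebra_def)
    then show ?thesis using that by (rule measurable_from_subalg)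
  qed
  have [measurable]: "?E \<in> borel_measurable (F t)" "W t \<in> borel_measurable (F t)" "W s \<in> borel_measurable (F t)"
    using E(1) adapted st by (auto intro: mono)
  have EM[measurable]: "?E \<in> borel_measurable M"
    using measurable_from_subalg[OF sub E(1)] .
  have WM[measurable]: "W t \<in> borel_measurable M" "W s \<in> borel_measurable M"
    using BM st by (auto intro: brownian_measurable)
  have bm[measurable]: "b ?\<mu> \<in> borel_measurable borel"
    by (rule drift_measurable[OF \<mu>])
  have step: "euler h \<xi> W (Suc k) = (\<lambda>\<omega>. ?E \<omega> - h *\<^sub>R b ?\<mu> (?E \<omega>) + \<sigma> *\<^sub>R (W t \<omega> - W s \<omega>))"
    by (simp add: fun_eq_iff s_def t_def)
  have 1: "euler h \<xi> W (Suc k) \<in> borel_measurable (F (h * real (Suc k)))"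
    unfolding step t_def[symmetric] by measurable
  let ?\<Phi> = "\<lambda>(x, z). x - h *\<^sub>R b ?\<mu> x + \<sigma> *\<^sub>R z"
  have "distr M borel (euler h \<xi> W (Suc k))
      = distr (distr M (borel \<Otimes>\<^sub>M borel) (\<lambda>\<omega>. (?E \<omega>, W t \<omega> - W s \<omega>))) borel ?\<Phi>"
    unfolding step by (subst distr_distr) (auto simp: comp_def)
  also have "distr M (borel \<Otimes>\<^sub>M borel) (\<lambda>\<omega>. (?E \<omega>, W t \<omega> - W s \<omega>)) = ?\<mu> \<Otimes>\<^sub>M gaussian_measure h"
    using brownian_increment_indep[OF BM st(1,2) E(1)] E(2) st(3) by simp
  finally have 2: "distr M borel (euler h \<xi> W (Suc k)) = euler_law h (Suc k)"
    by (simp only: euler_law.simps)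
  have "distr M borel (euler h \<xi> W (Suc k)) \<in> P2"
    unfolding step
  proof (rule distr_in_P2_dominated[OF prob_space_axioms, where X="?E" and Y="\<lambda>\<omega>. W t \<omega> - W s \<omega>"
        and a="h * norm (b ?\<mu> 0)" and c="1 + h * C" and d=\<sigma>])
    show "(\<integral>\<^sup>+\<omega>. ennreal ((norm (?E \<omega>))\<^sup>2) \<partial>M) < \<infinity>"
      using \<mu> E(2) distr_in_P2_iff[OF prob_space_axioms EM] by simp
    show "(\<integral>\<^sup>+\<omega>. ennreal ((norm (W t \<omega> - W s \<omega>))\<^sup>2) \<partial>M) < \<infinity>"
      using brownian_increment_second_moment[OF BM, of s t] st by simp
    fix \<omega>
    have "norm (b ?\<mu> (?E \<omega>)) \<le> norm (b ?\<mu> 0) + C * norm (?E \<omega>)"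
      using lipschitz_space[OF \<mu>, of "?E \<omega>" 0] norm_triangle_sub[of "b ?\<mu> (?E \<omega>)" "b ?\<mu> 0"] by simp
    then have "h * norm (b ?\<mu> (?E \<omega>)) \<le> h * (norm (b ?\<mu> 0) + C * norm (?E \<omega>))"
      using \<open>h > 0\<close> by (intro mult_left_mono) auto
    then have "h * norm (b ?\<mu> (?E \<omega>)) \<le> h * norm (b ?\<mu> 0) + h * C * norm (?E \<omega>)"
      by (simp add: distrib_left)
    moreover have "norm (?E \<omega> - h *\<^sub>R b ?\<mu> (?E \<omega>) + \<sigma> *\<^sub>R (W t \<omega> - W s \<omega>))
        \<le> norm (?E \<omega>) + norm (h *\<^sub>R b ?\<mu> (?E \<omega>)) + norm (\<sigma> *\<^sub>R (W t \<omega> - W s \<omega>))"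
      using norm_triangle_ineq[of "?E \<omega> - h *\<^sub>R b ?\<mu> (?E \<omega>)" "\<sigma> *\<^sub>R (W t \<omega> - W s \<omega>)"]
        norm_triangle_ineq4[of "?E \<omega>" "h *\<^sub>R b ?\<mu> (?E \<omega>)"] by linarith
    moreover have "norm (h *\<^sub>R b ?\<mu> (?E \<omega>)) = h * norm (b ?\<mu> (?E \<omega>))"
      "norm (\<sigma> *\<^sub>R (W t \<omega> - W s \<omega>)) = \<sigma> * norm (W t \<omega> - W s \<omega>)"
      using \<open>h > 0\<close> \<sigma>_nonneg by simp_all
    moreover have "(1 + h * C) * norm (?E \<omega>) = norm (?E \<omega>) + h * C * norm (?E \<omega>)"
      by (simp add: distrib_right)
    ultimately show "norm (?E \<omega> - h *\<^sub>R b ?\<mu> (?E \<omega>) + \<sigma> *\<^sub>R (W t \<omega> - W s \<omega>))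
        \<le> h * norm (b ?\<mu> 0) + (1 + h * C) * norm (?E \<omega>) + \<sigma> * norm (W t \<omega> - W s \<omega>)"
      by linarith
  qed measurable
  then have "euler_law h (Suc k) \<in> P2"
    by (simp only: 2)
  with 1 2 show ?case by blast
qed

text \<open>The bound is on the laws, hence it holds on all spaces at once, and it is uniform in the step.
  The recursion is set up for \<open>S k = E (norm (E\<^sub>k - \<sigma> W\<^sub>h\<^sub>k))\<close>, from which the noise has been
  removed: in a recursion for \<open>E (norm E\<^sub>k)\<close> every step would add a term of order \<open>sqrt h\<close>, and these
  terms do not sum up to a bounded quantity, whereas here each step adds only a term of order \<open>h\<close>.\<close>

lemma euler_moments_bounded:
  fixes W :: "real \<Rightarrow> 'w \<Rightarrow> real^'n"
  assumes BM: "brownian_motion M F W" and \<xi>: "\<xi> \<in> borel_measurable (F 0)" "distr M borel \<xi> = \<mu>\<^sub>0"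
  obtains K where "K \<ge> 0"
    and "\<And>h k. h > 0 \<Longrightarrow> h * real k \<le> T \<Longrightarrow> (\<integral>\<^sup>+x. ennreal (norm x) \<partial>euler_law h k) \<le> ennreal K"
    and "\<And>h k. h > 0 \<Longrightarrow> h * real k \<le> T \<Longrightarrow>
      (\<integral>\<^sup>+x. ennreal (norm (b (euler_law h k) x)) \<partial>euler_law h k) \<le> ennreal K"
proof -
  interpret prob_space M using BM by (simp add: brownian_motion_def)
  have sub: "subalgebra M (F r)" for r
    using BM by (simp add: brownian_motion_def)
  define w where "w = 1 + real CARD('n) * max 0 T"
  define c0 where "c0 = norm (b (return borel 0) 0)"
  define c1 where "c1 = c0 + 2 * C * (\<sigma> * w)"
  define m where "m = enn2real (\<integral>\<^sup>+x. ennreal (norm x) \<partial>\<mu>\<^sub>0)"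
  define K1 where "K1 = exp (2 * C * max 0 T) * (m + max 0 T * c1) + \<sigma> * w"
  have nn: "w \<ge> 0" "c0 \<ge> 0" "c1 \<ge> 0" "m \<ge> 0" "C \<ge> 0"
    using C_pos \<sigma>_nonneg by (auto simp: w_def c0_def c1_def m_def)
  have K1: "K1 \<ge> 0" using nn \<sigma>_nonneg by (simp add: K1_def)
  have [measurable]: "\<xi> \<in> borel_measurable M"
    using measurable_from_subalg[OF sub \<xi>(1)] .
  have m: "(\<integral>\<^sup>+\<omega>. ennreal (norm (\<xi> \<omega>)) \<partial>M) = ennreal m"
  proof -
    have "(\<integral>\<^sup>+\<omega>. ennreal (norm (\<xi> \<omega>)) \<partial>M) = (\<integral>\<^sup>+x. ennreal (norm x) \<partial>\<mu>\<^sub>0)"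
      unfolding \<xi>(2)[symmetric] by (simp add: nn_integral_distr)
    then show ?thesis
      using P2_first_moment[OF initial_P2] by (simp add: m_def ennreal_enn2real)
  qed
  have main: "(\<integral>\<^sup>+x. ennreal (norm x) \<partial>euler_law h k) \<le> ennreal K1" if "h > 0" "h * real k \<le> T" for h k
  proof -
    define E where "E = euler h \<xi> W"
    have EM[measurable]: "E j \<in> borel_measurable M" for j
      using euler_adapted_and_law[OF BM \<xi> \<open>h > 0\<close>, of j] measurable_from_subalg[OF sub] by (auto simp: E_def)
    have law: "distr M borel (E j) = euler_law h j" "euler_law h j \<in> P2" for j
      using euler_adapted_and_law[OF BM \<xi> \<open>h > 0\<close>, of j] by (auto simp: E_def)
    have WM[measurable]: "W (h * real j) \<in> borel_measurable M" for j
      using \<open>h > 0\<close> by (intro brownian_measurable[OF BM]) simp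
    define S where "S j = (\<integral>\<^sup>+\<omega>. ennreal (norm (E j \<omega> - \<sigma> *\<^sub>R W (h * real j) \<omega>)) \<partial>M)" for j
    have ES: "(\<integral>\<^sup>+\<omega>. ennreal (norm (E j \<omega>)) \<partial>M) \<le> S j + ennreal (\<sigma> * w)" if "h * real j \<le> T" for j
    proof -
      have "(\<integral>\<^sup>+\<omega>. ennreal (norm (E j \<omega>)) \<partial>M)
          \<le> (\<integral>\<^sup>+\<omega>. ennreal (norm (E j \<omega> - \<sigma> *\<^sub>R W (h * real j) \<omega>)) + ennreal \<sigma> * ennreal (norm (W (h * real j) \<omega>)) \<partial>M)"
      proof (intro nn_integral_mono)
        fix \<omega>
        have "norm (E j \<omega>) \<le> norm (E j \<omega> - \<sigma> *\<^sub>R W (h * real j) \<omega>) + \<sigma> * norm (W (h * real j) \<omega>)"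
          using norm_triangle_sub[of "E j \<omega>" "\<sigma> *\<^sub>R W (h * real j) \<omega>"] \<sigma>_nonneg by simp
        then show "ennreal (norm (E j \<omega>)) \<le> ennreal (norm (E j \<omega> - \<sigma> *\<^sub>R W (h * real j) \<omega>)) + ennreal \<sigma> * ennreal (norm (W (h * real j) \<omega>))"
          using \<sigma>_nonneg by (simp add: ennreal_leI flip: ennreal_plus ennreal_mult')
      qed
      also have "\<dots> = S j + ennreal \<sigma> * (\<integral>\<^sup>+\<omega>. ennreal (norm (W (h * real j) \<omega>)) \<partial>M)"
        by (simp add: S_def nn_integral_add nn_integral_cmult)
      also have "\<dots> \<le> S j + ennreal \<sigma> * ennreal w"
      proof (intro add_left_mono mult_left_mono)
        have "(\<integral>\<^sup>+\<omega>. ennreal (norm (W (h * real j) \<omega>)) \<partial>M) \<le> ennreal (1 + real CARD('n) * (h * real j))"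
          using \<open>h > 0\<close> by (intro brownian_first_moment[OF BM]) simp
        also have "\<dots> \<le> ennreal w"
          unfolding w_def using that by (intro ennreal_leI add_left_mono mult_left_mono) auto
        finally show "(\<integral>\<^sup>+\<omega>. ennreal (norm (W (h * real j) \<omega>)) \<partial>M) \<le> ennreal w" .
      qed simp
      finally show ?thesis using \<sigma>_nonneg by (simp add: ennreal_mult')
    qed
    have S: "S j \<le> ennreal ((1 + 2 * C * h) ^ j * (m + h * real j * c1))" if "h * real j \<le> T" for j
      using that
    proof (induction j)
      case 0
      have "S 0 = (\<integral>\<^sup>+\<omega>. ennreal (norm (\<xi> \<omega>)) \<partial>M)"
        unfolding S_def E_def using brownian_start[OF BM] by (intro nn_integral_cong_AE) auto
      then show ?case by (simp add: m)
    next
      case (Suc j)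
      define B where "B = (1 + 2 * C * h) ^ j * (m + h * real j * c1)"
      have B: "B \<ge> 0" using nn \<open>h > 0\<close> by (simp add: B_def)
      have j: "h * real j \<le> T"
        using Suc.prems \<open>h > 0\<close> by (simp add: algebra_simps)
      have SB: "S j \<le> ennreal B" using Suc.IH[OF j] by (simp add: B_def)
      have [measurable]: "b (euler_law h j) \<in> borel_measurable borel"
        by (rule drift_measurable[OF law(2)])
      have "S (Suc j) \<le> (\<integral>\<^sup>+\<omega>. ennreal (norm (E j \<omega> - \<sigma> *\<^sub>R W (h * real j) \<omega>))
          + ennreal h * ennreal (norm (b (euler_law h j) (E j \<omega>))) \<partial>M)"
        unfolding S_def
      proof (intro nn_integral_mono)
        fix \<omega>
        have "E (Suc j) \<omega> - \<sigma> *\<^sub>R W (h * real (Suc j)) \<omega>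
            = (E j \<omega> - \<sigma> *\<^sub>R W (h * real j) \<omega>) - h *\<^sub>R b (euler_law h j) (E j \<omega>)"
          by (simp add: E_def algebra_simps)
        then have "norm (E (Suc j) \<omega> - \<sigma> *\<^sub>R W (h * real (Suc j)) \<omega>)
            \<le> norm (E j \<omega> - \<sigma> *\<^sub>R W (h * real j) \<omega>) + h * norm (b (euler_law h j) (E j \<omega>))"
          using norm_triangle_ineq4[of "E j \<omega> - \<sigma> *\<^sub>R W (h * real j) \<omega>" "h *\<^sub>R b (euler_law h j) (E j \<omega>)"] \<open>h > 0\<close>
          by simp
        then show "ennreal (norm (E (Suc j) \<omega> - \<sigma> *\<^sub>R W (h * real (Suc j)) \<omega>))
            \<le> ennreal (norm (E j \<omega> - \<sigma> *\<^sub>R W (h * real j) \<omega>)) + ennreal h * ennreal (norm (b (euler_law h j) (E j \<omega>)))"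
          using \<open>h > 0\<close> by (simp add: ennreal_leI flip: ennreal_plus ennreal_mult')
      qed
      also have "\<dots> = S j + ennreal h * (\<integral>\<^sup>+\<omega>. ennreal (norm (b (euler_law h j) (E j \<omega>))) \<partial>M)"
        by (simp add: S_def nn_integral_add nn_integral_cmult)
      also have "\<dots> \<le> S j + ennreal h * (ennreal c0 + ennreal (2 * C) * (S j + ennreal (\<sigma> * w)))"
      proof (intro add_left_mono mult_left_mono)
        have "(\<integral>\<^sup>+\<omega>. ennreal (norm (b (euler_law h j) (E j \<omega>))) \<partial>M)
            \<le> ennreal c0 + ennreal (2 * C) * (\<integral>\<^sup>+\<omega>. ennreal (norm (E j \<omega>)) \<partial>M)"
          using drift_linear_growth[OF prob_space_axioms EM[of j]] by (simp add: law c0_def)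
        also have "\<dots> \<le> ennreal c0 + ennreal (2 * C) * (S j + ennreal (\<sigma> * w))"
          by (intro add_left_mono mult_left_mono ES j) simp
        finally show "(\<integral>\<^sup>+\<omega>. ennreal (norm (b (euler_law h j) (E j \<omega>))) \<partial>M) \<le> \<dots>" .
      qed simp
      also have "\<dots> \<le> ennreal B + ennreal h * (ennreal c0 + ennreal (2 * C) * (ennreal B + ennreal (\<sigma> * w)))"
        by (intro add_mono mult_left_mono SB order_refl) simp_all
      also have "\<dots> = ennreal (B + h * (c0 + 2 * C * (B + \<sigma> * w)))"
        using nn B \<open>h > 0\<close> \<sigma>_nonneg by (simp flip: ennreal_plus ennreal_mult')
      also have "\<dots> = ennreal ((1 + 2 * C * h) * B + h * c1)"
        by (simp add: c1_def algebra_simps)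
      also have "\<dots> \<le> ennreal ((1 + 2 * C * h) ^ Suc j * (m + h * real (Suc j) * c1))"
      proof (intro ennreal_leI)
        have "1 \<le> (1 + 2 * C * h) ^ Suc j"
          using nn \<open>h > 0\<close> by (intro one_le_power) simp
        then have "1 * (h * c1) \<le> (1 + 2 * C * h) ^ Suc j * (h * c1)"
          using nn \<open>h > 0\<close> by (intro mult_right_mono) auto
        then show "(1 + 2 * C * h) * B + h * c1 \<le> (1 + 2 * C * h) ^ Suc j * (m + h * real (Suc j) * c1)"
          by (simp add: B_def algebra_simps)
      qed
      finally show ?case .
    qed
    have "(\<integral>\<^sup>+x. ennreal (norm x) \<partial>euler_law h k) = (\<integral>\<^sup>+\<omega>. ennreal (norm (E k \<omega>)) \<partial>M)"
      by (simp add: nn_integral_distr flip: law(1))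
    also have "\<dots> \<le> ennreal ((1 + 2 * C * h) ^ k * (m + h * real k * c1)) + ennreal (\<sigma> * w)"
      using ES[OF that(2)] S[OF that(2)] by (auto intro: order_trans add_right_mono)
    also have "\<dots> = ennreal ((1 + 2 * C * h) ^ k * (m + h * real k * c1) + \<sigma> * w)"
      using nn \<sigma>_nonneg \<open>h > 0\<close> by (intro ennreal_plus[symmetric]) auto
    also have "\<dots> \<le> ennreal K1"
      unfolding K1_def
    proof (intro ennreal_leI add_right_mono mult_mono)
      have "(1 + 2 * C * h) ^ k \<le> exp (2 * C * h) ^ k"
        using nn \<open>h > 0\<close> by (intro power_mono exp_ge_add_one_self) simp
      also have "\<dots> = exp (2 * C * (h * real k))"
        by (simp add: exp_of_nat_mult[symmetric] algebra_simps)
      also have "\<dots> \<le> exp (2 * C * max 0 T)"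
        using nn that by (simp add: mult_left_mono)
      finally show "(1 + 2 * C * h) ^ k \<le> exp (2 * C * max 0 T)" .
      show "m + h * real k * c1 \<le> m + max 0 T * c1"
        using nn that by (intro add_left_mono mult_right_mono) auto
    qed (use nn \<open>h > 0\<close> in auto)
    finally show ?thesis .
  qed
  define K where "K = K1 + (c0 + 2 * C * K1)"
  show ?thesis
  proof (rule that[of K])
    show "K \<ge> 0" using nn K1 by (simp add: K_def)
    fix h :: real and k :: nat assume hk: "h > 0" "h * real k \<le> T"
    show "(\<integral>\<^sup>+x. ennreal (norm x) \<partial>euler_law h k) \<le> ennreal K"
      by (rule order_trans[OF main[OF hk] ennreal_leI]) (use nn K1 in \<open>simp add: K_def\<close>)
    have EM[measurable]: "euler h \<xi> W k \<in> borel_measurable M"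
      and law: "distr M borel (euler h \<xi> W k) = euler_law h k" "euler_law h k \<in> P2"
      using euler_adapted_and_law[OF BM \<xi> \<open>h > 0\<close>, of k] measurable_from_subalg[OF sub] by auto
    have [measurable]: "b (euler_law h k) \<in> borel_measurable borel"
      by (rule drift_measurable[OF law(2)])
    have d1: "(\<integral>\<^sup>+x. ennreal (norm (b (euler_law h k) x)) \<partial>euler_law h k)
        = (\<integral>\<^sup>+\<omega>. ennreal (norm (b (euler_law h k) (euler h \<xi> W k \<omega>))) \<partial>M)"
      unfolding law(1)[symmetric, THEN arg_cong[where f="\<lambda>\<mu>. nn_integral \<mu> _"]]
      by (subst nn_integral_distr) auto
    have d2: "(\<integral>\<^sup>+x. ennreal (norm x) \<partial>euler_law h k) = (\<integral>\<^sup>+\<omega>. ennreal (norm (euler h \<xi> W k \<omega>)) \<partial>M)"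
      by (simp add: nn_integral_distr flip: law(1))
    have "(\<integral>\<^sup>+x. ennreal (norm (b (euler_law h k) x)) \<partial>euler_law h k)
        \<le> ennreal c0 + ennreal (2 * C) * (\<integral>\<^sup>+x. ennreal (norm x) \<partial>euler_law h k)"
      using drift_linear_growth[OF prob_space_axioms EM] by (simp add: law c0_def d1 d2)
    also have "\<dots> \<le> ennreal c0 + ennreal (2 * C) * ennreal K1"
      by (intro add_left_mono mult_left_mono main hk) simp
    also have "\<dots> = ennreal (c0 + 2 * C * K1)"
      using nn K1 by (simp flip: ennreal_plus ennreal_mult')
    also have "\<dots> \<le> ennreal K"
      using K1 by (intro ennreal_leI) (simp add: K_def)
    finally show "(\<integral>\<^sup>+x. ennreal (norm (b (euler_law h k) x)) \<partial>euler_law h k) \<le> ennreal K" .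
  qed
qed

end

section \<open>The Euler scheme in continuous time\<close>

locale euler_scheme = mean_field_sde b C \<sigma> \<mu>\<^sub>0
  for b :: "(real^'n) measure \<Rightarrow> real^'n \<Rightarrow> real^'n" and C \<sigma> \<mu>\<^sub>0 +
  fixes M :: "'w measure" and F :: "real \<Rightarrow> 'w measure" and W :: "real \<Rightarrow> 'w \<Rightarrow> real^'n"
    and \<xi> :: "'w \<Rightarrow> real^'n" and h :: real
  assumes BM: "brownian_motion M F W"
    and initial_measurable: "\<xi> \<in> borel_measurable (F 0)"
    and initial_law: "distr M borel \<xi> = \<mu>\<^sub>0"
    and h_pos: "h > 0"
begin

sublocale prob_space M
  using BM by (simp add: brownian_motion_def)

text \<open>The scheme in continuous time: \<open>euler_path\<close> is constant between grid points, \<open>drift\<close> is the drift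
  along it, and \<open>force\<close> is the displacement, without the initial value, that the noise and this drift produce
  together. The path \<open>\<xi> + force\<close> is the interpolation of the scheme (\<open>force_on_grid\<close>) that is driven by the
  Brownian path and not only by its values on the grid.\<close>

definition grid :: "real \<Rightarrow> nat" where
  "grid t = nat \<lfloor>t / h\<rfloor>"

definition euler_path :: "real \<Rightarrow> 'w \<Rightarrow> real^'n" where
  "euler_path t = euler h \<xi> W (grid t)"

definition drift :: "real \<Rightarrow> 'w \<Rightarrow> real^'n" where
  "drift t \<omega> = b (euler_law h (grid t)) (euler_path t \<omega>)"

definition force :: "real \<Rightarrow> 'w \<Rightarrow> real^'n" where
  "force t \<omega> = \<sigma> *\<^sub>R W t \<omega> - (LBINT s:{0..t}. drift s \<omega>)"

lemma subalgebra_F: "subalgebra M (F t)"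
  using BM by (simp add: brownian_motion_def)

lemma initial_measurable_M[measurable]: "\<xi> \<in> borel_measurable M"
  using measurable_from_subalg[OF subalgebra_F initial_measurable] .

lemma euler_measurable[measurable]: "euler h \<xi> W k \<in> borel_measurable M"
  using euler_adapted_and_law[OF BM initial_measurable initial_law h_pos, of k]
    measurable_from_subalg[OF subalgebra_F] by blast

lemma euler_distr: "distr M borel (euler h \<xi> W k) = euler_law h k"
  using euler_adapted_and_law[OF BM initial_measurable initial_law h_pos, of k] by blast

lemma euler_law_P2: "euler_law h k \<in> P2"
  using euler_adapted_and_law[OF BM initial_measurable initial_law h_pos, of k] by blast

lemma euler_law_drift_measurable[measurable]: "b (euler_law h k) \<in> borel_measurable borel"
  by (rule drift_measurable[OF euler_law_P2])

lemma euler_path_distr: "distr M borel (euler_path t) = euler_law h (grid t)"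
  unfolding euler_path_def by (rule euler_distr)

lemma grid_measurable[measurable]: "grid \<in> measurable borel (count_space UNIV)"
  unfolding grid_def by measurable

lemma grid_bounds:
  assumes "0 \<le> t"
  shows "h * real (grid t) \<le> t" "t - h * real (grid t) \<le> h"
proof -
  have "0 \<le> t / h" using assms h_pos by simp
  then have "real (grid t) \<le> t / h" "t / h < real (grid t) + 1"
    unfolding grid_def by linarith+
  then show "h * real (grid t) \<le> t" "t - h * real (grid t) \<le> h"
    using h_pos by (simp_all add: field_simps)
qed

lemma grid_eq:
  assumes "h * real k \<le> t" "t < h * real (Suc k)"
  shows "grid t = k"
proof -
  have "real k \<le> t / h" "t / h < real k + 1"
    using assms h_pos by (simp_all add: field_simps)
  then have "\<lfloor>t / h\<rfloor> = int k" by (simp add: floor_eq_iff)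
  then show ?thesis by (simp add: grid_def)
qed

lemma euler_path_measurable[measurable]: "(\<lambda>(t, \<omega>). euler_path t \<omega>) \<in> borel_measurable (borel \<Otimes>\<^sub>M M)"
proof -
  have "(\<lambda>x :: real \<times> 'w. euler h \<xi> W (grid (fst x)) (snd x)) \<in> borel_measurable (borel \<Otimes>\<^sub>M M)"
    by (rule measurable_compose_countable[where f="\<lambda>k (x :: real \<times> 'w). euler h \<xi> W k (snd x)"
        and g="\<lambda>x :: real \<times> 'w. grid (fst x)"]) measurable
  then show ?thesis by (simp add: euler_path_def case_prod_beta')
qed

lemma drift_joint_measurable[measurable]: "(\<lambda>(t, \<omega>). drift t \<omega>) \<in> borel_measurable (borel \<Otimes>\<^sub>M M)"
proof -
  have "(\<lambda>x :: real \<times> 'w. b (euler_law h (grid (fst x))) (euler h \<xi> W (grid (fst x)) (snd x)))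
      \<in> borel_measurable (borel \<Otimes>\<^sub>M M)"
    by (rule measurable_compose_countable[where
          f="\<lambda>k (x :: real \<times> 'w). b (euler_law h k) (euler h \<xi> W k (snd x))"
        and g="\<lambda>x :: real \<times> 'w. grid (fst x)"]) measurable
  then show ?thesis by (simp add: drift_def euler_path_def case_prod_beta')
qed

lemma drift_integrable:
  assumes "A \<in> sets borel" "A \<subseteq> {0..t}"
  shows "set_integrable lborel A (\<lambda>s. drift s \<omega>)"
proof -
  define v where "v k = b (euler_law h k) (euler h \<xi> W k \<omega>)" for k
  have v: "(\<lambda>s. drift s \<omega>) = (\<lambda>s. v (grid s))"
    by (simp add: fun_eq_iff drift_def euler_path_def v_def)
  have [measurable]: "(\<lambda>s. v (grid s)) \<in> borel_measurable borel"
    by (rule measurable_compose[OF grid_measurable]) simp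
  have "set_integrable lborel {0..t} (\<lambda>s. v (grid s))"
    unfolding set_integrable_def
  proof (rule integrableI_bounded_set_indicator)
    show "AE s in lborel. s \<in> {0..t} \<longrightarrow> norm (v (grid s)) \<le> (\<Sum>j\<le>grid t. norm (v j))"
    proof (intro AE_I2 impI)
      fix s assume "s \<in> {0..t}"
      then have "grid s \<le> grid t"
        unfolding grid_def using h_pos by (intro nat_mono floor_mono divide_right_mono) auto
      then show "norm (v (grid s)) \<le> (\<Sum>j\<le>grid t. norm (v j))"
        by (intro member_le_sum) auto
    qed
  qed (simp_all add: emeasure_lborel_Icc_eq)
  then show ?thesis
    unfolding v by (rule set_integrable_subset) (use assms in simp_all)
qed

lemma force_diff:
  assumes "0 \<le> s" "s \<le> t"
  shows "force t \<omega> - force s \<omega> = \<sigma> *\<^sub>R (W t \<omega> - W s \<omega>) - (LBINT r:{s<..t}. drift r \<omega>)"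
proof -
  have "{0..t} = {0..s} \<union> {s<..t}" using assms by auto
  then have "(LBINT r:{0..t}. drift r \<omega>) = (LBINT r:{0..s}. drift r \<omega>) + (LBINT r:{s<..t}. drift r \<omega>)"
    using assms by (simp, intro set_integral_Un drift_integrable[of _ t]) auto
  then show ?thesis
    by (simp add: force_def scaleR_diff_right)
qed

lemma force_on_grid:
  assumes "W 0 \<omega> = 0"
  shows "\<xi> \<omega> + force (h * real k) \<omega> = euler h \<xi> W k \<omega>"
proof (induction k)
  case 0
  have "(LBINT s:{0..0::real}. drift s \<omega>) = 0"
    unfolding set_lebesgue_integral_def
    by (rule integral_eq_zero_AE, rule AE_mp[OF AE_lborel_singleton[of "0::real"]]) (simp add: indicator_def)
  then show ?case using assms by (simp add: force_def)
next
  case (Suc k)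
  define s t where "s = h * real k" and "t = h * real (Suc k)"
  have st: "0 \<le> s" "s \<le> t" "t - s = h"
    using h_pos by (auto simp: s_def t_def algebra_simps)
  define v where "v = b (euler_law h k) (euler h \<xi> W k \<omega>)"
  have "(LBINT r:{s<..t}. drift r \<omega>) = (LBINT r:{s<..t}. v)"
    unfolding set_lebesgue_integral_def
  proof (rule integral_cong_AE)
    have "AE r in lborel. r \<noteq> t" by (rule AE_lborel_singleton)
    then show "AE r in lborel. indicator {s<..t} r *\<^sub>R drift r \<omega> = indicator {s<..t} r *\<^sub>R v"
    proof eventually_elim
      case (elim r)
      have "drift r \<omega> = v" if "r \<in> {s<..t}"
      proof -
        have "grid r = k"
          using that elim by (intro grid_eq) (auto simp: s_def t_def)
        then show ?thesis by (simp add: drift_def euler_path_def v_def)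
      qed
      then show ?case by (simp split: split_indicator)
    qed
    show "(\<lambda>r. indicator {s<..t} r *\<^sub>R drift r \<omega>) \<in> borel_measurable lborel"
      by (intro borel_measurable_integrable drift_integrable[of _ t, unfolded set_integrable_def])
         (use st in auto)
  qed simp
  also have "\<dots> = h *\<^sub>R v"
    unfolding set_lebesgue_integral_def using st by (simp add: measure_def)
  finally have "force t \<omega> = force s \<omega> + \<sigma> *\<^sub>R (W t \<omega> - W s \<omega>) - h *\<^sub>R v"
    using force_diff[OF st(1,2), of \<omega>] by (simp add: algebra_simps)
  moreover have "\<xi> \<omega> + force s \<omega> = euler h \<xi> W k \<omega>"
    using Suc by (simp only: s_def)
  moreover have "euler h \<xi> W (Suc k) \<omega> = euler h \<xi> W k \<omega> - h *\<^sub>R v + \<sigma> *\<^sub>R (W t \<omega> - W s \<omega>)"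
    by (simp only: euler.simps v_def s_def t_def)
  ultimately have "\<xi> \<omega> + force t \<omega> = euler h \<xi> W (Suc k) \<omega>"
    by (simp only: add.assoc[symmetric] add_diff_eq diff_add_eq)
  then show ?case by (simp only: t_def)
qed

context
  fixes K T :: real
  assumes K_nonneg: "K \<ge> 0"
    and speed: "\<And>k. h * real k \<le> T \<Longrightarrow> (\<integral>\<^sup>+x. ennreal (norm (b (euler_law h k) x)) \<partial>euler_law h k) \<le> ennreal K"
begin

lemma expected_drift_le:
  assumes "0 \<le> t" "t \<le> T"
  shows "(\<integral>\<^sup>+\<omega>. ennreal (norm (drift t \<omega>)) \<partial>M) \<le> ennreal K"
proof -
  have "(\<integral>\<^sup>+\<omega>. ennreal (norm (drift t \<omega>)) \<partial>M)
      = (\<integral>\<^sup>+x. ennreal (norm (b (euler_law h (grid t)) x)) \<partial>distr M borel (euler h \<xi> W (grid t)))"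
    unfolding drift_def euler_path_def by (subst nn_integral_distr) auto
  then show ?thesis
    using speed[of "grid t"] grid_bounds[OF assms(1)] assms(2) by (simp add: euler_distr)
qed

text \<open>Affine in \<open>t - s\<close>, with a free parameter \<open>\<delta>\<close> that is taken of the order of the square root of the
  relevant \<open>t - s\<close>: \<open>sqrt h\<close> for the discretisation error, and the square root of the memory of the moving
  average for the relaxation error.\<close>

lemma expected_force_increment_le:
  assumes "0 \<le> s" "s \<le> t" "t \<le> T" "\<delta> > 0"
  shows "(\<integral>\<^sup>+\<omega>. ennreal (norm (force t \<omega> - force s \<omega>)) \<partial>M)
    \<le> ennreal (\<sigma> * \<delta> + (K + \<sigma> * real CARD('n) / \<delta>) * (t - s))"
proof -
  have [measurable]: "W t \<in> borel_measurable M" "W s \<in> borel_measurable M"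
    using assms by (auto intro!: brownian_measurable[OF BM])
  have "(\<integral>\<^sup>+\<omega>. ennreal (norm (force t \<omega> - force s \<omega>)) \<partial>M)
      \<le> (\<integral>\<^sup>+\<omega>. ennreal \<sigma> * ennreal (norm (W t \<omega> - W s \<omega>)) + (\<integral>\<^sup>+r\<in>{s<..t}. ennreal (norm (drift r \<omega>)) \<partial>lborel) \<partial>M)"
  proof (intro nn_integral_mono)
    fix \<omega>
    have "norm (force t \<omega> - force s \<omega>) \<le> \<sigma> * norm (W t \<omega> - W s \<omega>) + norm (LBINT r:{s<..t}. drift r \<omega>)"
      unfolding force_diff[OF assms(1,2)]
      using norm_triangle_ineq4[of "\<sigma> *\<^sub>R (W t \<omega> - W s \<omega>)"] \<sigma>_nonneg by (auto intro: order_trans)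
    then have "ennreal (norm (force t \<omega> - force s \<omega>))
        \<le> ennreal \<sigma> * ennreal (norm (W t \<omega> - W s \<omega>)) + ennreal (norm (LBINT r:{s<..t}. drift r \<omega>))"
      using \<sigma>_nonneg by (simp add: ennreal_leI flip: ennreal_plus ennreal_mult')
    also have "ennreal (norm (LBINT r:{s<..t}. drift r \<omega>)) \<le> (\<integral>\<^sup>+r\<in>{s<..t}. ennreal (norm (drift r \<omega>)) \<partial>lborel)"
      by (intro norm_set_integral_le_nn_integral drift_integrable[of _ t]) (use assms in auto)
    finally show "ennreal (norm (force t \<omega> - force s \<omega>)) \<le> ennreal \<sigma> * ennreal (norm (W t \<omega> - W s \<omega>))
        + (\<integral>\<^sup>+r\<in>{s<..t}. ennreal (norm (drift r \<omega>)) \<partial>lborel)"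
      by (simp add: add_left_mono)
  qed
  also have "\<dots> = ennreal \<sigma> * (\<integral>\<^sup>+\<omega>. ennreal (norm (W t \<omega> - W s \<omega>)) \<partial>M)
      + (\<integral>\<^sup>+r\<in>{s<..t}. (\<integral>\<^sup>+\<omega>. ennreal (norm (drift r \<omega>)) \<partial>M) \<partial>lborel)"
    by (simp add: nn_integral_add nn_integral_cmult
        nn_integral_swap_set[OF sigma_finite_measure_axioms])
  also have "\<dots> \<le> ennreal \<sigma> * ennreal (\<delta> + real CARD('n) * (t - s) / \<delta>) + (\<integral>\<^sup>+r\<in>{s<..t}. ennreal K \<partial>lborel)"
  proof (intro add_mono mult_left_mono nn_integral_mono)
    show "(\<integral>\<^sup>+\<omega>. ennreal (norm (W t \<omega> - W s \<omega>)) \<partial>M) \<le> ennreal (\<delta> + real CARD('n) * (t - s) / \<delta>)"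
      by (rule brownian_increment_first_moment[OF BM assms(1,2,4)])
    show "(\<integral>\<^sup>+\<omega>. ennreal (norm (drift r \<omega>)) \<partial>M) * indicator {s<..t} r \<le> ennreal K * indicator {s<..t} r" for r
      using assms expected_drift_le[of r] by (auto split: split_indicator)
  qed simp
  also have "\<dots> = ennreal (\<sigma> * (\<delta> + real CARD('n) * (t - s) / \<delta>) + K * (t - s))"
    using assms \<sigma>_nonneg K_nonneg
    by (simp add: nn_integral_cmult_indicator flip: ennreal_plus ennreal_mult')
  also have "\<sigma> * (\<delta> + real CARD('n) * (t - s) / \<delta>) + K * (t - s)
      = \<sigma> * \<delta> + (K + \<sigma> * real CARD('n) / \<delta>) * (t - s)"
    using assms by (simp add: field_simps)
  finally show ?thesis .
qed

lemma expected_grid_error_le: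
  assumes "0 \<le> t" "t \<le> T"
  shows "(\<integral>\<^sup>+\<omega>. ennreal (norm (\<xi> \<omega> + force t \<omega> - euler_path t \<omega>)) \<partial>M)
    \<le> ennreal (\<sigma> * sqrt h + (K + \<sigma> * real CARD('n) / sqrt h) * h)"
proof -
  let ?s = "h * real (grid t)"
  have "(\<integral>\<^sup>+\<omega>. ennreal (norm (\<xi> \<omega> + force t \<omega> - euler_path t \<omega>)) \<partial>M)
      = (\<integral>\<^sup>+\<omega>. ennreal (norm (force t \<omega> - force ?s \<omega>)) \<partial>M)"
  proof (rule nn_integral_cong_AE)
    show "AE \<omega> in M. ennreal (norm (\<xi> \<omega> + force t \<omega> - euler_path t \<omega>)) = ennreal (norm (force t \<omega> - force ?s \<omega>))"
      using brownian_start[OF BM]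
    proof eventually_elim
      case (elim \<omega>)
      have "euler_path t \<omega> = \<xi> \<omega> + force ?s \<omega>"
        using force_on_grid[OF elim, of "grid t"] by (simp add: euler_path_def)
      then show ?case by simp
    qed
  qed
  also have "\<dots> \<le> ennreal (\<sigma> * sqrt h + (K + \<sigma> * real CARD('n) / sqrt h) * (t - ?s))"
    using grid_bounds[OF assms(1)] assms h_pos by (intro expected_force_increment_le) auto
  also have "\<dots> \<le> ennreal (\<sigma> * sqrt h + (K + \<sigma> * real CARD('n) / sqrt h) * h)"
    using grid_bounds[OF assms(1)] K_nonneg \<sigma>_nonneg h_pos
    by (intro ennreal_leI add_left_mono mult_left_mono) auto
  finally show ?thesis .
qed

end

lemma force_measurable_version:
  obtains A where "(\<lambda>(t, \<omega>). A t \<omega>) \<in> borel_measurable (borel \<Otimes>\<^sub>M M)"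
    and "AE \<omega> in M. \<forall>t\<ge>0. A t \<omega> = force t \<omega>"
proof -
  have "AE \<omega> in M. W 0 \<omega> = 0 \<and> continuous_on {0..} (\<lambda>t. W t \<omega>)"
    using BM by (simp add: brownian_motion_def)
  then have "AE \<omega> in M. continuous_on {0..} (\<lambda>t. W t \<omega>)" by eventually_elim simp
  then obtain W' where [measurable]: "(\<lambda>(t, \<omega>). W' t \<omega>) \<in> borel_measurable (borel \<Otimes>\<^sub>M M)"
    and W': "AE \<omega> in M. \<forall>t\<ge>0. W' t \<omega> = W t \<omega>"
    using continuous_process_measurable_version[of W M] brownian_measurable[OF BM] by blast
  define I where "I t \<omega> = (\<integral>s. (if 0 \<le> s \<and> s \<le> t then 1 else 0 :: real) *\<^sub>R drift s \<omega> \<partial>lborel)" for t \<omega>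
  have I: "I t \<omega> = (LBINT s:{0..t}. drift s \<omega>)" for t \<omega>
    unfolding I_def set_lebesgue_integral_def by (intro Bochner_Integration.integral_cong) auto
  have [measurable]: "(\<lambda>(t, \<omega>). I t \<omega>) \<in> borel_measurable (borel \<Otimes>\<^sub>M M)"
    unfolding I_def by measurable
  show ?thesis
  proof (rule that[of "\<lambda>t \<omega>. \<sigma> *\<^sub>R W' t \<omega> - I t \<omega>"])
    show "(\<lambda>(t, \<omega>). \<sigma> *\<^sub>R W' t \<omega> - I t \<omega>) \<in> borel_measurable (borel \<Otimes>\<^sub>M M)" by measurable
    show "AE \<omega> in M. \<forall>t\<ge>0. \<sigma> *\<^sub>R W' t \<omega> - I t \<omega> = force t \<omega>"
      using W' by eventually_elim (simp add: I force_def)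
  qed
qed

end

section \<open>Exponential relaxation towards a moving target\<close>

text \<open>If \<open>x' = l (P - x)\<close>, then \<open>x t\<close> is an average of \<open>x 0\<close>, with weight \<open>exp (- l t)\<close>, and of the
  values \<open>P s\<close>, with density \<open>l exp (- l (t - s))\<close>. The weights sum up to 1, so the distance to any
  point \<open>c\<close> is at most the average of the distances. The point \<open>c\<close> will be the value at time \<open>t\<close> of
  a path that stays close to \<open>P\<close>.\<close>

lemma relaxation_bound:
  fixes x v P :: "real \<Rightarrow> 'a::euclidean_space" and l t :: real
  assumes "l > 0" "t \<ge> 0" and v: "continuous_on {0..t} v"
    and x: "\<And>s. s \<in> {0..t} \<Longrightarrow> x s = x 0 + (LBINT r:{0..s}. v r)"
    and P: "\<And>s. s \<in> {0..t} \<Longrightarrow> v s = l *\<^sub>R (P s - x s)"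
  shows "ennreal (norm (x t - c)) \<le> ennreal (exp (- l * t)) * ennreal (norm (x 0 - c))
    + (\<integral>\<^sup>+s\<in>{0..t}. ennreal (l * exp (- l * (t - s))) * ennreal (norm (P s - c)) \<partial>lborel)"
proof -
  have deriv: "(x has_vector_derivative v s) (at s within {0..t})" if s: "s \<in> {0..t}" for s
  proof -
    have 1: "((\<lambda>u. x 0 + integral {0..u} v) has_vector_derivative v s) (at s within {0..t})"
      using has_vector_derivative_add[OF has_vector_derivative_const[of "x 0"] integral_has_vector_derivative[OF v s]]
      by simp
    have 2: "x u = x 0 + integral {0..u} v" if u: "u \<in> {0..t}" for u
    proof -
      have "set_integrable lborel {0..u} v"
        using u by (intro borel_integrable_atLeastAtMost' continuous_on_subset[OF v]) auto
      then show ?thesis using x[OF u] by (simp add: set_borel_integral_eq_integral(2))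
    qed
    show ?thesis
      by (rule has_vector_derivative_transform[OF s 2 1])
  qed
  have x_cont: "continuous_on {0..t} x"
    using deriv by (intro continuous_on_vector_derivative)
  define g where "g s = (l * exp (l * s)) *\<^sub>R (P s - c)" for s
  have g_eq: "g s = exp (l * s) *\<^sub>R (v s + l *\<^sub>R (x s - c))" if "s \<in> {0..t}" for s
  proof -
    have "v s + l *\<^sub>R (x s - c) = l *\<^sub>R (P s - c)"
      unfolding P[OF that] by (simp add: scaleR_diff_right)
    then show ?thesis by (simp add: g_def mult.commute)
  qed
  have "continuous_on {0..t} (\<lambda>s. exp (l * s) *\<^sub>R (v s + l *\<^sub>R (x s - c)))"
    by (intro continuous_intros v x_cont)
  then have g_cont: "continuous_on {0..t} g"
    by (rule continuous_on_eq) (rule g_eq[symmetric])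
  define y where "y s = exp (l * s) *\<^sub>R (x s - c)" for s
  have y_deriv: "(y has_vector_derivative g s) (at s within {0..t})" if "s \<in> {0..t}" for s
  proof -
    have e: "((\<lambda>s. exp (l * s)) has_real_derivative l * exp (l * s)) (at s within {0..t})"
      by (auto intro!: derivative_eq_intros)
    have d: "((\<lambda>s. x s - c) has_vector_derivative v s) (at s within {0..t})"
      using has_vector_derivative_diff[OF deriv[OF that] has_vector_derivative_const[of c]] by simp
    have "(y has_vector_derivative exp (l * s) *\<^sub>R v s + (l * exp (l * s)) *\<^sub>R (x s - c)) (at s within {0..t})"
      unfolding y_def by (rule has_vector_derivative_scaleR[OF e d])
    moreover have "exp (l * s) *\<^sub>R v s + (l * exp (l * s)) *\<^sub>R (x s - c) = g s"
      unfolding g_eq[OF that] by (simp add: scaleR_add_right mult.commute)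
    ultimately show ?thesis by simp
  qed
  have "(g has_integral y t - y 0) {0..t}"
    using \<open>t \<ge> 0\<close> y_deriv by (intro fundamental_theorem_of_calculus)
  then have "integral {0..t} g = y t - y 0" by (rule integral_unique)
  moreover have g_int: "set_integrable lborel {0..t} g"
    by (rule borel_integrable_atLeastAtMost'[OF g_cont])
  ultimately have "(LBINT s:{0..t}. g s) = y t - y 0"
    by (simp add: set_borel_integral_eq_integral(2))
  then have bound: "ennreal (norm (y t - y 0)) \<le> (\<integral>\<^sup>+s\<in>{0..t}. ennreal (norm (g s)) \<partial>lborel)"
    using norm_set_integral_le_nn_integral[OF g_int] by simp
  have g_meas: "(\<lambda>s. ennreal (norm (g s)) * indicator {0..t} s) \<in> borel_measurable lborel"
  proof -
    have "(\<lambda>s. indicator {0..t} s *\<^sub>R g s) \<in> borel_measurable lborel"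
      using g_int by (intro borel_measurable_integrable) (simp add: set_integrable_def)
    then have "(\<lambda>s. ennreal (norm (indicator {0..t} s *\<^sub>R g s))) \<in> borel_measurable lborel"
      by (rule measurable_compose[OF measurable_compose[OF _ borel_measurable_norm] measurable_ennreal])
    moreover have "ennreal (norm (indicator {0..t} s *\<^sub>R g s)) = ennreal (norm (g s)) * indicator {0..t} s" for s
      by (simp split: split_indicator)
    ultimately show ?thesis by (simp only:)
  qed
  have "x t - c = exp (- l * t) *\<^sub>R (x 0 - c) + exp (- l * t) *\<^sub>R (y t - y 0)"
  proof -
    have "exp (- l * t) *\<^sub>R y t = x t - c"
      by (simp add: y_def flip: exp_add)
    moreover have "y 0 = x 0 - c" by (simp add: y_def)
    ultimately show ?thesis by (simp only: scaleR_diff_right) simp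
  qed
  then have "norm (x t - c) \<le> exp (- l * t) * norm (x 0 - c) + exp (- l * t) * norm (y t - y 0)"
    using norm_triangle_ineq[of "exp (- l * t) *\<^sub>R (x 0 - c)" "exp (- l * t) *\<^sub>R (y t - y 0)"] by simp
  then have "ennreal (norm (x t - c))
      \<le> ennreal (exp (- l * t)) * ennreal (norm (x 0 - c)) + ennreal (exp (- l * t)) * ennreal (norm (y t - y 0))"
    by (simp add: ennreal_leI flip: ennreal_plus ennreal_mult')
  also have "\<dots> \<le> ennreal (exp (- l * t)) * ennreal (norm (x 0 - c))
      + ennreal (exp (- l * t)) * (\<integral>\<^sup>+s\<in>{0..t}. ennreal (norm (g s)) \<partial>lborel)"
    by (intro add_left_mono mult_left_mono bound) simp
  also have "ennreal (exp (- l * t)) * (\<integral>\<^sup>+s\<in>{0..t}. ennreal (norm (g s)) \<partial>lborel)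
      = (\<integral>\<^sup>+s. ennreal (exp (- l * t)) * (ennreal (norm (g s)) * indicator {0..t} s) \<partial>lborel)"
    by (rule nn_integral_cmult[symmetric, OF g_meas])
  also have "\<dots> = (\<integral>\<^sup>+s\<in>{0..t}. ennreal (l * exp (- l * (t - s))) * ennreal (norm (P s - c)) \<partial>lborel)"
  proof (intro nn_integral_cong)
    fix s :: real
    have "exp (- l * t) * norm (g s) = l * exp (- l * (t - s)) * norm (P s - c)"
    proof -
      have "exp (- l * (t - s)) = exp (- l * t) * exp (l * s)"
        by (simp add: algebra_simps flip: exp_add)
      then show ?thesis using \<open>l > 0\<close> by (simp add: g_def)
    qed
    then show "ennreal (exp (- l * t)) * (ennreal (norm (g s)) * indicator {0..t} s)
        = ennreal (l * exp (- l * (t - s))) * ennreal (norm (P s - c)) * indicator {0..t} s"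
      using \<open>l > 0\<close> by (simp add: mult.assoc[symmetric] flip: ennreal_mult')
  qed
  finally show ?thesis .
qed

text \<open>The average age \<open>t - s\<close> under the weights of an exponential moving average is at most \<open>1 / l\<close>;
  the atom at 0 has the age \<open>t\<close>. With \<open>a = 1\<close> and \<open>c = 0\<close> this bounds the total mass of the weights by 1.\<close>

lemma relaxation_kernel_average:
  fixes l t a c :: real
  assumes "l > 0" "t \<ge> 0" "a \<ge> 0" "c \<ge> 0"
  shows "ennreal (exp (- l * t)) * ennreal (a + c * t)
    + (\<integral>\<^sup>+s\<in>{0..t}. ennreal (l * exp (- l * (t - s))) * ennreal (a + c * (t - s)) \<partial>lborel) \<le> ennreal (a + c / l)"
proof -
  define G where "G s = exp (- l * (t - s)) * (a + c * (t - s) + c / l)" for s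
  have "(\<integral>\<^sup>+s\<in>{0..t}. ennreal (l * exp (- l * (t - s))) * ennreal (a + c * (t - s)) \<partial>lborel)
      = (\<integral>\<^sup>+s\<in>{0..t}. ennreal (l * exp (- l * (t - s)) * (a + c * (t - s))) \<partial>lborel)"
    using \<open>l > 0\<close> by (intro nn_integral_cong) (simp add: ennreal_mult')
  also have "\<dots> = ennreal (G t - G 0)"
  proof (rule nn_integral_FTC_Icc)
    fix s assume s: "s \<in> {0..t}"
    show "(G has_real_derivative l * exp (- l * (t - s)) * (a + c * (t - s))) (at s)"
      unfolding G_def using \<open>l > 0\<close>
      by (auto intro!: derivative_eq_intros simp: field_simps)
    show "0 \<le> l * exp (- l * (t - s)) * (a + c * (t - s))"
      using s assms by simp
  qed (use assms in auto)
  finally have "ennreal (exp (- l * t)) * ennreal (a + c * t)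
    + (\<integral>\<^sup>+s\<in>{0..t}. ennreal (l * exp (- l * (t - s))) * ennreal (a + c * (t - s)) \<partial>lborel)
    = ennreal (exp (- l * t) * (a + c * t)) + ennreal (G t - G 0)"
    using assms by (simp add: ennreal_mult')
  also have "\<dots> = ennreal (exp (- l * t) * (a + c * t) + (G t - G 0))"
  proof (rule ennreal_plus[symmetric])
    have "exp (- l * t) * (a + c * t + c / l) \<le> a + c / l"
    proof -
      have "c * t + c / l = c / l * (1 + l * t)" using assms by (simp add: field_simps)
      moreover have "c / l * (1 + l * t) \<le> c / l * exp (l * t)"
        using assms by (intro mult_left_mono exp_ge_add_one_self) auto
      ultimately have "c * t + c / l \<le> c / l * exp (l * t)" by simp
      moreover have "a \<le> a * exp (l * t)" using assms by (simp add: mult_le_cancel_left1)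
      ultimately have "a + c * t + c / l \<le> (a + c / l) * exp (l * t)"
        by (simp add: distrib_right)
      then have "exp (- l * t) * (a + c * t + c / l) \<le> exp (- l * t) * ((a + c / l) * exp (l * t))"
        by (rule mult_left_mono) simp
      also have "\<dots> = (a + c / l) * (exp (- l * t) * exp (l * t))"
        by (simp only: ac_simps)
      also have "\<dots> = a + c / l"
        by (simp flip: exp_add)
      finally show ?thesis .
    qed
    then show "0 \<le> G t - G 0" by (simp add: G_def)
  qed (use assms in auto)
  also have "\<dots> \<le> ennreal (a + c / l)"
    using assms by (intro ennreal_leI) (simp add: G_def algebra_simps)
  finally show ?thesis .
qed

section \<open>Distance between a solution and its Euler scheme\<close>

text \<open>The bound of \<open>expected_grid_error_le\<close>, of order \<open>sqrt h\<close> as \<open>h\<close> tends to 0.\<close>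

definition (in mean_field_sde) grid_error :: "real \<Rightarrow> real \<Rightarrow> real" where
  "grid_error K h = \<sigma> * sqrt h + (K + \<sigma> * real CARD('n) / sqrt h) * h"

context euler_scheme
begin

text \<open>An instance of \<open>mean_field_stability\<close> for a process \<open>Z\<close> whose paths are continuous only almost
  surely. The jointly measurable version of \<open>Z\<close> has the same laws at all times, hence the same
  drift.\<close>

lemma comparison_with_euler:
  fixes Z :: "real \<Rightarrow> 'w \<Rightarrow> real^'n" and R :: "real \<Rightarrow> 'w \<Rightarrow> ennreal"
  assumes "T \<ge> 0" "\<epsilon> \<ge> 0"
    and moment: "\<And>k. h * real k \<le> T \<Longrightarrow> (\<integral>\<^sup>+x. ennreal (norm x) \<partial>euler_law h k) \<le> ennreal K"
    and Z_meas: "\<And>t. t \<ge> 0 \<Longrightarrow> Z t \<in> borel_measurable M"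
    and Z_P2: "\<And>t. t \<ge> 0 \<Longrightarrow> distr M borel (Z t) \<in> P2"
    and Z_cont: "AE \<omega> in M. continuous_on {0..} (\<lambda>t. Z t \<omega>)"
    and b_int: "AE \<omega> in M. set_integrable lborel {0..T} (\<lambda>s. b (distr M borel (Z s)) (Z s \<omega>))"
    and R[measurable]: "(\<lambda>(s, \<omega>). R s \<omega>) \<in> borel_measurable (borel \<Otimes>\<^sub>M M)"
    and R_int: "\<And>s. s \<in> {0..T} \<Longrightarrow> (\<integral>\<^sup>+\<omega>. R s \<omega> \<partial>M) \<le> ennreal \<epsilon>"
    and le: "AE \<omega> in M. \<forall>t\<in>{0..T}. ennreal (norm (Z t \<omega> - euler_path t \<omega>)) \<le> R t \<omega> + (\<integral>\<^sup>+s\<in>{0..t}.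
        ennreal (norm (b (distr M borel (Z s)) (Z s \<omega>) - drift s \<omega>)) \<partial>lborel)"
  shows "(\<integral>\<^sup>+\<omega>. ennreal (norm (Z T \<omega> - euler_path T \<omega>)) \<partial>M) \<le> ennreal (\<epsilon> * (1 + 4 * C * T * exp (4 * C * T)))"
proof -
  obtain Z' where Z'_meas[measurable]: "(\<lambda>(t, \<omega>). Z' t \<omega>) \<in> borel_measurable (borel \<Otimes>\<^sub>M M)"
    and Z': "AE \<omega> in M. \<forall>t\<ge>0. Z' t \<omega> = Z t \<omega>"
    using continuous_process_measurable_version[of Z M, OF Z_meas Z_cont] by blast
  have [measurable]: "Z' t \<in> borel_measurable M" for t
    by measurable
  have law: "distr M borel (Z' s) = distr M borel (Z s)" if "0 \<le> s" for s
    using Z_meas[OF that] Z' that by (intro distr_cong_AE) auto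
  have drift_eq: "b (distr M borel (euler_path s)) (euler_path s \<omega>) = drift s \<omega>" for s \<omega>
    by (simp add: drift_def euler_path_distr)
  have "(\<integral>\<^sup>+\<omega>. ennreal (norm (Z' T \<omega> - euler_path T \<omega>)) \<partial>M) \<le> ennreal (\<epsilon> * (1 + 4 * C * T * exp (4 * C * T)))"
  proof (rule mean_field_stability[where R=R])
    show "distr M borel (Z' s) \<in> P2" if "s \<in> {0..T}" for s
      using Z_P2 law that by simp
    show "distr M borel (euler_path s) \<in> P2" if "s \<in> {0..T}" for s
      by (simp add: euler_path_distr euler_law_P2)
    have m: "(\<integral>\<^sup>+\<omega>. ennreal (norm (euler_path s \<omega>)) \<partial>M) \<le> ennreal K" if "s \<in> {0..T}" for s
    proof -
      have "(\<integral>\<^sup>+\<omega>. ennreal (norm (euler_path s \<omega>)) \<partial>M) = (\<integral>\<^sup>+x. ennreal (norm x) \<partial>distr M borel (euler_path s))"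
        by (simp add: nn_integral_distr)
      also have "\<dots> \<le> ennreal K"
        unfolding euler_path_distr using that grid_bounds(1)[of s] by (intro moment) auto
      finally show ?thesis .
    qed
    have "(\<integral>\<^sup>+s\<in>{0..T}. (\<integral>\<^sup>+\<omega>. ennreal (norm (euler_path s \<omega>)) \<partial>M) \<partial>lborel) \<le> (\<integral>\<^sup>+s\<in>{0..T}. ennreal K \<partial>lborel)"
      using m by (intro nn_integral_mono) (auto split: split_indicator)
    also have "\<dots> < \<infinity>"
      using \<open>T \<ge> 0\<close> by (simp add: nn_integral_cmult_indicator ennreal_mult_less_top)
    finally show "(\<integral>\<^sup>+s\<in>{0..T}. (\<integral>\<^sup>+\<omega>. ennreal (norm (euler_path s \<omega>)) \<partial>M) \<partial>lborel) < \<infinity>" .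
    show "AE \<omega> in M. (\<integral>\<^sup>+s\<in>{0..T}. ennreal (norm (Z' s \<omega>)) \<partial>lborel) < \<infinity>"
      using Z' Z_cont
    proof eventually_elim
      case (elim \<omega>)
      have "(\<integral>\<^sup>+s\<in>{0..T}. ennreal (norm (Z' s \<omega>)) \<partial>lborel) = (\<integral>\<^sup>+s\<in>{0..T}. ennreal (norm (Z s \<omega>)) \<partial>lborel)"
        using elim(1) by (intro nn_integral_cong) (simp split: split_indicator)
      also have "\<dots> < \<infinity>"
        using elim(2) by (intro continuous_imp_nn_integrable continuous_on_subset[OF elim(2)]) auto
      finally show ?case .
    qed
    show "AE \<omega> in M. set_integrable lborel {0..T}
        (\<lambda>s. b (distr M borel (Z' s)) (Z' s \<omega>) - b (distr M borel (euler_path s)) (euler_path s \<omega>))"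
      using Z' b_int
    proof eventually_elim
      case (elim \<omega>)
      have "set_integrable lborel {0..T} (\<lambda>s. b (distr M borel (Z s)) (Z s \<omega>) - drift s \<omega>)"
        by (intro set_integral_diff elim(2) drift_integrable[of _ T]) simp_all
      moreover have "indicator {0..T} s *\<^sub>R (b (distr M borel (Z' s)) (Z' s \<omega>) - b (distr M borel (euler_path s)) (euler_path s \<omega>))
          = indicator {0..T} s *\<^sub>R (b (distr M borel (Z s)) (Z s \<omega>) - drift s \<omega>)" for s
        using elim(1) by (simp add: law drift_eq split: split_indicator)
      ultimately show ?case unfolding set_integrable_def by (simp only:)
    qed
    show "AE \<omega> in M. \<forall>t\<in>{0..T}. ennreal (norm (Z' t \<omega> - euler_path t \<omega>)) \<le> R t \<omega> + (\<integral>\<^sup>+s\<in>{0..t}.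
        ennreal (norm (b (distr M borel (Z' s)) (Z' s \<omega>) - b (distr M borel (euler_path s)) (euler_path s \<omega>))) \<partial>lborel)"
      using Z' le
    proof eventually_elim
      case (elim \<omega>)
      show ?case
      proof
        fix t assume t: "t \<in> {0..T}"
        have "(\<integral>\<^sup>+s\<in>{0..t}. ennreal (norm (b (distr M borel (Z' s)) (Z' s \<omega>) - b (distr M borel (euler_path s)) (euler_path s \<omega>))) \<partial>lborel)
            = (\<integral>\<^sup>+s\<in>{0..t}. ennreal (norm (b (distr M borel (Z s)) (Z s \<omega>) - drift s \<omega>)) \<partial>lborel)"
          using elim(1) by (intro nn_integral_cong) (simp add: law drift_eq split: split_indicator)
        then show "ennreal (norm (Z' t \<omega> - euler_path t \<omega>)) \<le> R t \<omega> + (\<integral>\<^sup>+s\<in>{0..t}.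
            ennreal (norm (b (distr M borel (Z' s)) (Z' s \<omega>) - b (distr M borel (euler_path s)) (euler_path s \<omega>))) \<partial>lborel)"
          using elim t by simp
      qed
    qed
  qed (use assms prob_space_axioms in simp_all)
  also have "(\<integral>\<^sup>+\<omega>. ennreal (norm (Z' T \<omega> - euler_path T \<omega>)) \<partial>M) = (\<integral>\<^sup>+\<omega>. ennreal (norm (Z T \<omega> - euler_path T \<omega>)) \<partial>M)"
    using Z' \<open>T \<ge> 0\<close> by (intro nn_integral_cong_AE) auto
  finally show ?thesis .
qed

lemma drift_integral_diff_le:
  assumes "set_integrable lborel {0..t} \<beta>"
  shows "ennreal (norm ((LBINT s:{0..t}. \<beta> s) - (LBINT s:{0..t}. drift s \<omega>)))
    \<le> (\<integral>\<^sup>+s\<in>{0..t}. ennreal (norm (\<beta> s - drift s \<omega>)) \<partial>lborel)"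
proof -
  have d: "set_integrable lborel {0..t} (\<lambda>s. drift s \<omega>)"
    by (rule drift_integrable[of _ t]) simp_all
  show ?thesis
    unfolding set_integral_diff(2)[OF assms d, symmetric]
    by (intro norm_set_integral_le_nn_integral set_integral_diff(1) assms d)
qed

context
  fixes K T :: real and Z :: "real \<Rightarrow> 'w \<Rightarrow> real^'n"
  assumes K_nonneg: "K \<ge> 0" and T_nonneg: "T \<ge> 0"
    and moment: "\<And>k. h * real k \<le> T \<Longrightarrow> (\<integral>\<^sup>+x. ennreal (norm x) \<partial>euler_law h k) \<le> ennreal K"
    and speed: "\<And>k. h * real k \<le> T \<Longrightarrow>
      (\<integral>\<^sup>+x. ennreal (norm (b (euler_law h k) x)) \<partial>euler_law h k) \<le> ennreal K"
    and Z_meas: "\<And>t. t \<ge> 0 \<Longrightarrow> Z t \<in> borel_measurable M"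
    and Z_P2: "\<And>t. t \<ge> 0 \<Longrightarrow> distr M borel (Z t) \<in> P2"
    and Z_cont: "AE \<omega> in M. continuous_on {0..} (\<lambda>t. Z t \<omega>)"
    and b_int: "AE \<omega> in M. set_integrable lborel {0..T} (\<lambda>s. b (distr M borel (Z s)) (Z s \<omega>))"
begin

lemma grid_error_nonneg: "grid_error K h \<ge> 0"
  using K_nonneg \<sigma>_nonneg h_pos by (simp add: grid_error_def)

text \<open>Here \<open>Z - euler_path\<close> is the difference of the accumulated drifts plus the deviation of the
  interpolation from the piecewise constant path.\<close>

lemma overdamped_close_to_euler:
  assumes eq: "AE \<omega> in M. \<forall>t\<in>{0..T}.
      Z t \<omega> = \<xi> \<omega> - (LBINT s:{0..t}. b (distr M borel (Z s)) (Z s \<omega>)) + \<sigma> *\<^sub>R W t \<omega>"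
  shows "(\<integral>\<^sup>+\<omega>. ennreal (norm (Z T \<omega> - euler_path T \<omega>)) \<partial>M)
    \<le> ennreal (grid_error K h * (1 + 4 * C * T * exp (4 * C * T)))"
proof -
  obtain A where [measurable]: "(\<lambda>(t, \<omega>). A t \<omega>) \<in> borel_measurable (borel \<Otimes>\<^sub>M M)"
    and A: "AE \<omega> in M. \<forall>t\<ge>0. A t \<omega> = force t \<omega>"
    by (rule force_measurable_version)
  define R where "R t \<omega> = ennreal (norm (\<xi> \<omega> + A t \<omega> - euler_path t \<omega>))" for t \<omega>
  show ?thesis
  proof (rule comparison_with_euler[OF T_nonneg grid_error_nonneg moment Z_meas Z_P2 Z_cont b_int, where R=R])
    show "(\<lambda>(s, \<omega>). R s \<omega>) \<in> borel_measurable (borel \<Otimes>\<^sub>M M)"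
      unfolding R_def by measurable
    show "(\<integral>\<^sup>+\<omega>. R s \<omega> \<partial>M) \<le> ennreal (grid_error K h)" if "s \<in> {0..T}" for s
    proof -
      have "(\<integral>\<^sup>+\<omega>. R s \<omega> \<partial>M) = (\<integral>\<^sup>+\<omega>. ennreal (norm (\<xi> \<omega> + force s \<omega> - euler_path s \<omega>)) \<partial>M)"
        using A that unfolding R_def by (intro nn_integral_cong_AE) auto
      then show ?thesis
        using expected_grid_error_le[OF K_nonneg speed, of T s] that by (simp add: grid_error_def)
    qed
    show "AE \<omega> in M. \<forall>t\<in>{0..T}. ennreal (norm (Z t \<omega> - euler_path t \<omega>)) \<le> R t \<omega> + (\<integral>\<^sup>+s\<in>{0..t}.
        ennreal (norm (b (distr M borel (Z s)) (Z s \<omega>) - drift s \<omega>)) \<partial>lborel)"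
      using A eq b_int
    proof eventually_elim
      case (elim \<omega>)
      show ?case
      proof
        fix t assume t: "t \<in> {0..T}"
        let ?b = "\<lambda>s. b (distr M borel (Z s)) (Z s \<omega>)"
        have i: "set_integrable lborel {0..t} ?b"
          using elim(3) by (rule set_integrable_subset) (use t in auto)
        have "Z t \<omega> - euler_path t \<omega> = (\<xi> \<omega> + A t \<omega> - euler_path t \<omega>)
            - ((LBINT s:{0..t}. ?b s) - (LBINT s:{0..t}. drift s \<omega>))"
          using elim(1,2) t by (simp add: force_def)
        then have "norm (Z t \<omega> - euler_path t \<omega>) \<le> norm (\<xi> \<omega> + A t \<omega> - euler_path t \<omega>)
            + norm ((LBINT s:{0..t}. ?b s) - (LBINT s:{0..t}. drift s \<omega>))"
          by (simp only: norm_triangle_ineq4)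
        then have "ennreal (norm (Z t \<omega> - euler_path t \<omega>)) \<le> R t \<omega>
            + ennreal (norm ((LBINT s:{0..t}. ?b s) - (LBINT s:{0..t}. drift s \<omega>)))"
          unfolding R_def by (simp add: ennreal_leI flip: ennreal_plus)
        also have "\<dots> \<le> R t \<omega> + (\<integral>\<^sup>+s\<in>{0..t}. ennreal (norm (?b s - drift s \<omega>)) \<partial>lborel)"
          by (intro add_left_mono drift_integral_diff_le i)
        finally show "ennreal (norm (Z t \<omega> - euler_path t \<omega>)) \<le> R t \<omega>
            + (\<integral>\<^sup>+s\<in>{0..t}. ennreal (norm (?b s - drift s \<omega>)) \<partial>lborel)" .
      qed
    qed
  qed
qed

text \<open>The relaxation rate is \<open>l\<close>, and the target is the right-hand side of the overdamped equation with
  an additional displacement \<open>p\<close>. In \<open>relaxation_bound\<close> the reference point is \<open>e = \<xi> + force t\<close>. The distance of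
  the target at time \<open>s\<close> from \<open>e\<close> has three parts: the displacement \<open>p\<close>, the difference of the
  accumulated drifts, which \<open>comparison_with_euler\<close> takes care of, and the increment of \<open>force\<close>
  between \<open>s\<close> and \<open>t\<close>. The average of the last one is small because the average age is at most
  \<open>1 / l\<close>.\<close>

lemma relaxation_close_to_euler:
  fixes p :: "'w \<Rightarrow> real^'n" and v :: "real \<Rightarrow> 'w \<Rightarrow> real^'n" and l m \<delta> :: real
  assumes "l > 0" "\<delta> > 0" "m \<ge> 0" and [measurable]: "p \<in> borel_measurable M"
    and p: "(\<integral>\<^sup>+\<omega>. ennreal (norm (p \<omega>)) \<partial>M) \<le> ennreal m"
    and eq: "AE \<omega> in M. Z 0 \<omega> = \<xi> \<omega> \<and> continuous_on {0..T} (\<lambda>s. v s \<omega>) \<and>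
      (\<forall>t\<in>{0..T}. Z t \<omega> = Z 0 \<omega> + (LBINT s:{0..t}. v s \<omega>) \<and>
        v t \<omega> = l *\<^sub>R (\<xi> \<omega> + p \<omega> - (LBINT s:{0..t}. b (distr M borel (Z s)) (Z s \<omega>)) + \<sigma> *\<^sub>R W t \<omega> - Z t \<omega>))"
  shows "(\<integral>\<^sup>+\<omega>. ennreal (norm (Z T \<omega> - euler_path T \<omega>)) \<partial>M)
    \<le> ennreal ((m + \<sigma> * \<delta> + (K + \<sigma> * real CARD('n) / \<delta>) / l + grid_error K h) * (1 + 4 * C * T * exp (4 * C * T)))"
proof -
  define a where "a = m + \<sigma> * \<delta>"
  define c where "c = K + \<sigma> * real CARD('n) / \<delta>"
  have ac: "a \<ge> 0" "c \<ge> 0"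
    using assms K_nonneg \<sigma>_nonneg by (auto simp: a_def c_def)
  obtain A where [measurable]: "(\<lambda>(t, \<omega>). A t \<omega>) \<in> borel_measurable (borel \<Otimes>\<^sub>M M)"
    and A: "AE \<omega> in M. \<forall>t\<ge>0. A t \<omega> = force t \<omega>"
    by (rule force_measurable_version)
  define \<kappa> where "\<kappa> t s = ennreal (l * exp (- l * (t - s)))" for t s
  define q where "q t s \<omega> = ennreal (norm (p \<omega>) + norm (A t \<omega> - A s \<omega>))" for t s \<omega>
  \<comment> \<open>bounds the averaged distance of the target from \<open>\<xi> + force t\<close> when the drifts agree\<close>
  define R1 where "R1 t \<omega> = ennreal (exp (- l * t)) * q t 0 \<omega> + (\<integral>\<^sup>+s. (if 0 \<le> s \<and> s \<le> t then \<kappa> t s * q t s \<omega> else 0) \<partial>lborel)" for t \<omega>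
  define R where "R t \<omega> = R1 t \<omega> + ennreal (norm (\<xi> \<omega> + A t \<omega> - euler_path t \<omega>))" for t \<omega>
  have R1: "R1 t \<omega> = ennreal (exp (- l * t)) * q t 0 \<omega> + (\<integral>\<^sup>+s\<in>{0..t}. \<kappa> t s * q t s \<omega> \<partial>lborel)" for t \<omega>
    unfolding R1_def by (intro arg_cong2[where f="(+)"] refl nn_integral_cong) (simp split: split_indicator)
  have [measurable]: "(\<lambda>s. \<kappa> t s) \<in> borel_measurable borel" for t
    unfolding \<kappa>_def by measurable
  have [measurable]: "(\<lambda>(s, \<omega>). q t s \<omega>) \<in> borel_measurable (borel \<Otimes>\<^sub>M M)" for t
    unfolding q_def by measurable
  have [measurable]: "(\<lambda>(t, \<omega>). R1 t \<omega>) \<in> borel_measurable (borel \<Otimes>\<^sub>M M)"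
    unfolding R1_def q_def \<kappa>_def by measurable
  have q_int: "(\<integral>\<^sup>+\<omega>. q t s \<omega> \<partial>M) \<le> ennreal (a + c * (t - s))" if "0 \<le> s" "s \<le> t" "t \<le> T" for s t
  proof -
    have "(\<integral>\<^sup>+\<omega>. q t s \<omega> \<partial>M) = (\<integral>\<^sup>+\<omega>. ennreal (norm (p \<omega>)) + ennreal (norm (A t \<omega> - A s \<omega>)) \<partial>M)"
      by (simp add: q_def)
    also have "\<dots> = (\<integral>\<^sup>+\<omega>. ennreal (norm (p \<omega>)) \<partial>M) + (\<integral>\<^sup>+\<omega>. ennreal (norm (A t \<omega> - A s \<omega>)) \<partial>M)"
      by (intro nn_integral_add) measurable
    also have "(\<integral>\<^sup>+\<omega>. ennreal (norm (A t \<omega> - A s \<omega>)) \<partial>M) = (\<integral>\<^sup>+\<omega>. ennreal (norm (force t \<omega> - force s \<omega>)) \<partial>M)"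
      using A that by (intro nn_integral_cong_AE) auto
    also have "(\<integral>\<^sup>+\<omega>. ennreal (norm (p \<omega>)) \<partial>M) + \<dots> \<le> ennreal m + ennreal (\<sigma> * \<delta> + c * (t - s))"
      unfolding c_def using that \<open>\<delta> > 0\<close>
      by (intro add_mono p expected_force_increment_le[OF K_nonneg speed]) auto
    also have "\<dots> = ennreal (a + c * (t - s))"
      using that ac assms \<sigma>_nonneg by (simp add: a_def flip: ennreal_plus)
    finally show ?thesis .
  qed
  have R1_int: "(\<integral>\<^sup>+\<omega>. R1 t \<omega> \<partial>M) \<le> ennreal (a + c / l)" if t: "t \<in> {0..T}" for t
  proof -
    have "(\<integral>\<^sup>+\<omega>. R1 t \<omega> \<partial>M) = ennreal (exp (- l * t)) * (\<integral>\<^sup>+\<omega>. q t 0 \<omega> \<partial>M)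
        + (\<integral>\<^sup>+s\<in>{0..t}. (\<integral>\<^sup>+\<omega>. \<kappa> t s * q t s \<omega> \<partial>M) \<partial>lborel)"
      unfolding R1
      by (subst nn_integral_add) (simp_all add: nn_integral_cmult nn_integral_swap_set[OF sigma_finite_measure_axioms])
    also have "\<dots> \<le> ennreal (exp (- l * t)) * ennreal (a + c * t)
        + (\<integral>\<^sup>+s\<in>{0..t}. \<kappa> t s * ennreal (a + c * (t - s)) \<partial>lborel)"
    proof (intro add_mono mult_left_mono nn_integral_mono)
      show "(\<integral>\<^sup>+\<omega>. q t 0 \<omega> \<partial>M) \<le> ennreal (a + c * t)"
        using q_int[of 0 t] t by simp
      fix s :: real
      have "(\<integral>\<^sup>+\<omega>. \<kappa> t s * q t s \<omega> \<partial>M) \<le> \<kappa> t s * ennreal (a + c * (t - s))" if "s \<in> {0..t}"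
      proof -
        have "(\<integral>\<^sup>+\<omega>. \<kappa> t s * q t s \<omega> \<partial>M) = \<kappa> t s * (\<integral>\<^sup>+\<omega>. q t s \<omega> \<partial>M)"
          by (intro nn_integral_cmult) measurable
        also have "\<dots> \<le> \<kappa> t s * ennreal (a + c * (t - s))"
          using that t by (intro mult_left_mono q_int) auto
        finally show ?thesis .
      qed
      then show "(\<integral>\<^sup>+\<omega>. \<kappa> t s * q t s \<omega> \<partial>M) * indicator {0..t} s \<le> \<kappa> t s * ennreal (a + c * (t - s)) * indicator {0..t} s"
        by (auto split: split_indicator)
    qed simp
    also have "\<dots> \<le> ennreal (a + c / l)"
      unfolding \<kappa>_def using t ac \<open>l > 0\<close> by (intro relaxation_kernel_average) auto
    finally show ?thesis .
  qed
  have nonneg: "0 \<le> m + \<sigma> * \<delta> + (K + \<sigma> * real CARD('n) / \<delta>) / l + grid_error K h"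
    using ac \<open>l > 0\<close> grid_error_nonneg unfolding a_def[symmetric] c_def[symmetric] by simp
  show ?thesis
  proof (rule comparison_with_euler[OF T_nonneg nonneg moment Z_meas Z_P2 Z_cont b_int, where R=R])
    show "(\<lambda>(s, \<omega>). R s \<omega>) \<in> borel_measurable (borel \<Otimes>\<^sub>M M)"
      unfolding R_def by measurable
    show "(\<integral>\<^sup>+\<omega>. R s \<omega> \<partial>M) \<le> ennreal (m + \<sigma> * \<delta> + (K + \<sigma> * real CARD('n) / \<delta>) / l + grid_error K h)"
      if s: "s \<in> {0..T}" for s
    proof -
      have "(\<integral>\<^sup>+\<omega>. ennreal (norm (\<xi> \<omega> + A s \<omega> - euler_path s \<omega>)) \<partial>M) = (\<integral>\<^sup>+\<omega>. ennreal (norm (\<xi> \<omega> + force s \<omega> - euler_path s \<omega>)) \<partial>M)"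
        using A that by (intro nn_integral_cong_AE) auto
      also have "\<dots> \<le> ennreal (grid_error K h)"
        using expected_grid_error_le[OF K_nonneg speed, of T s] that by (simp add: grid_error_def)
      finally have g: "(\<integral>\<^sup>+\<omega>. ennreal (norm (\<xi> \<omega> + A s \<omega> - euler_path s \<omega>)) \<partial>M) \<le> ennreal (grid_error K h)" .
      have "(\<integral>\<^sup>+\<omega>. R s \<omega> \<partial>M) = (\<integral>\<^sup>+\<omega>. R1 s \<omega> \<partial>M) + (\<integral>\<^sup>+\<omega>. ennreal (norm (\<xi> \<omega> + A s \<omega> - euler_path s \<omega>)) \<partial>M)"
        unfolding R_def by (intro nn_integral_add) measurable
      also have "\<dots> \<le> ennreal (a + c / l) + ennreal (grid_error K h)"
        by (intro add_mono R1_int s g)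
      also have "\<dots> = ennreal (a + c / l + grid_error K h)"
        using ac \<open>l > 0\<close> grid_error_nonneg by (intro ennreal_plus[symmetric]) auto
      finally show ?thesis by (simp only: a_def c_def)
    qed
    show "AE \<omega> in M. \<forall>t\<in>{0..T}. ennreal (norm (Z t \<omega> - euler_path t \<omega>)) \<le> R t \<omega> + (\<integral>\<^sup>+s\<in>{0..t}.
        ennreal (norm (b (distr M borel (Z s)) (Z s \<omega>) - drift s \<omega>)) \<partial>lborel)"
      using A eq b_int brownian_start[OF BM] AE_space
    proof eventually_elim
      case (elim \<omega>)
      have [measurable]: "\<omega> \<in> space M" using elim by simp
      show ?case
      proof
        fix t assume t: "t \<in> {0..T}"
        let ?b = "\<lambda>s. b (distr M borel (Z s)) (Z s \<omega>)"
        define Q where "Q = (\<integral>\<^sup>+s\<in>{0..t}. ennreal (norm (?b s - drift s \<omega>)) \<partial>lborel)"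
        define P where "P s = \<xi> \<omega> + p \<omega> - (LBINT r:{0..s}. ?b r) + \<sigma> *\<^sub>R W s \<omega>" for s
        define e where "e = \<xi> \<omega> + force t \<omega>"
        have force0: "force 0 \<omega> = 0"
          using force_on_grid[OF elim(4), of 0] by simp
        have init: "Z 0 \<omega> = \<xi> \<omega>"
          using elim(2) by (rule conjunct1)
        have v_cont: "continuous_on {0..T} (\<lambda>s. v s \<omega>)"
          using elim(2) by (rule conjunct1[OF conjunct2])
        note xv = elim(2)[THEN conjunct2, THEN conjunct2, rule_format, folded P_def]
        have relax: "ennreal (norm (Z t \<omega> - e)) \<le> ennreal (exp (- l * t)) * ennreal (norm (Z 0 \<omega> - e))
            + (\<integral>\<^sup>+s\<in>{0..t}. ennreal (l * exp (- l * (t - s))) * ennreal (norm (P s - e)) \<partial>lborel)"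
        proof (rule relaxation_bound[OF \<open>l > 0\<close>, where v="\<lambda>s. v s \<omega>"])
          show "0 \<le> t" using t by simp
          show "continuous_on {0..t} (\<lambda>s. v s \<omega>)"
            using v_cont by (rule continuous_on_subset) (use t in simp)
          fix s assume "s \<in> {0..t}"
          then have s: "s \<in> {0..T}" using t by auto
          show "Z s \<omega> = Z 0 \<omega> + (LBINT r:{0..s}. v r \<omega>)" by (rule conjunct1[OF xv[OF s]])
          show "v s \<omega> = l *\<^sub>R (P s - Z s \<omega>)" by (rule conjunct2[OF xv[OF s]])
        qed
        have init_e: "ennreal (norm (Z 0 \<omega> - e)) \<le> q t 0 \<omega> + Q"
        proof -
          have "norm (Z 0 \<omega> - e) = norm (A t \<omega> - A 0 \<omega>)"
            using elim(1) t by (simp add: init e_def force0)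
          then have "ennreal (norm (Z 0 \<omega> - e)) \<le> q t 0 \<omega>"
            unfolding q_def by (intro ennreal_leI) simp
          then show ?thesis by (simp add: add_increasing2)
        qed
        have P_e: "ennreal (norm (P s - e)) \<le> q t s \<omega> + Q" if s: "s \<in> {0..t}" for s
        proof -
          have i: "set_integrable lborel {0..s} ?b"
            using elim(3) by (rule set_integrable_subset) (use s t in auto)
          have "P s - e = (p \<omega> - (A t \<omega> - A s \<omega>)) - ((LBINT r:{0..s}. ?b r) - (LBINT r:{0..s}. drift r \<omega>))"
            using elim(1) s t by (simp add: P_def e_def force_def)
          then have "norm (P s - e) \<le> norm (p \<omega> - (A t \<omega> - A s \<omega>))
              + norm ((LBINT r:{0..s}. ?b r) - (LBINT r:{0..s}. drift r \<omega>))"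
            by (simp only: norm_triangle_ineq4)
          also have "\<dots> \<le> (norm (p \<omega>) + norm (A t \<omega> - A s \<omega>))
              + norm ((LBINT r:{0..s}. ?b r) - (LBINT r:{0..s}. drift r \<omega>))"
            by (intro add_right_mono norm_triangle_ineq4)
          finally have "ennreal (norm (P s - e)) \<le> q t s \<omega>
              + ennreal (norm ((LBINT r:{0..s}. ?b r) - (LBINT r:{0..s}. drift r \<omega>)))"
            unfolding q_def by (simp add: ennreal_leI flip: ennreal_plus)
          also have "\<dots> \<le> q t s \<omega> + (\<integral>\<^sup>+r\<in>{0..s}. ennreal (norm (?b r - drift r \<omega>)) \<partial>lborel)"
            by (intro add_left_mono drift_integral_diff_le i)
          also have "\<dots> \<le> q t s \<omega> + Q"
            unfolding Q_def using s by (intro add_left_mono nn_integral_mono) (auto split: split_indicator)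
          finally show ?thesis .
        qed
        have mass: "ennreal (exp (- l * t)) + (\<integral>\<^sup>+s\<in>{0..t}. \<kappa> t s \<partial>lborel) \<le> 1"
          using relaxation_kernel_average[OF \<open>l > 0\<close>, of t 1 0] t by (simp add: \<kappa>_def)
        have "ennreal (norm (Z t \<omega> - e)) \<le> ennreal (exp (- l * t)) * (q t 0 \<omega> + Q)
            + (\<integral>\<^sup>+s. \<kappa> t s * q t s \<omega> * indicator {0..t} s + \<kappa> t s * indicator {0..t} s * Q \<partial>lborel)"
        proof (rule order_trans[OF relax], intro add_mono mult_left_mono init_e nn_integral_mono)
          fix s :: real
          have "\<kappa> t s * ennreal (norm (P s - e)) \<le> \<kappa> t s * (q t s \<omega> + Q)" if "s \<in> {0..t}"
            by (intro mult_left_mono P_e that) simp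
          then show "ennreal (l * exp (- l * (t - s))) * ennreal (norm (P s - e)) * indicator {0..t} s
              \<le> \<kappa> t s * q t s \<omega> * indicator {0..t} s + \<kappa> t s * indicator {0..t} s * Q"
            unfolding \<kappa>_def by (auto simp: distrib_left split: split_indicator)
        qed simp
        also have "\<dots> = R1 t \<omega> + (ennreal (exp (- l * t)) + (\<integral>\<^sup>+s\<in>{0..t}. \<kappa> t s \<partial>lborel)) * Q"
        proof -
          have "(\<integral>\<^sup>+s. \<kappa> t s * q t s \<omega> * indicator {0..t} s + \<kappa> t s * indicator {0..t} s * Q \<partial>lborel)
              = (\<integral>\<^sup>+s\<in>{0..t}. \<kappa> t s * q t s \<omega> \<partial>lborel) + (\<integral>\<^sup>+s. \<kappa> t s * indicator {0..t} s * Q \<partial>lborel)"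
            by (intro nn_integral_add) measurable
          also have "(\<integral>\<^sup>+s. \<kappa> t s * indicator {0..t} s * Q \<partial>lborel) = (\<integral>\<^sup>+s\<in>{0..t}. \<kappa> t s \<partial>lborel) * Q"
            by (intro nn_integral_multc) measurable
          finally show ?thesis
            unfolding R1 by (simp only: distrib_left distrib_right ac_simps)
        qed
        also have "\<dots> \<le> R1 t \<omega> + 1 * Q"
          by (intro add_left_mono mult_right_mono mass) simp
        finally have main: "ennreal (norm (Z t \<omega> - e)) \<le> R1 t \<omega> + Q" by simp
        have "norm (Z t \<omega> - euler_path t \<omega>) \<le> norm (Z t \<omega> - e) + norm (\<xi> \<omega> + A t \<omega> - euler_path t \<omega>)"
          using norm_triangle_ineq[of "Z t \<omega> - e" "e - euler_path t \<omega>"] elim(1) t by (simp add: e_def)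
        then have "ennreal (norm (Z t \<omega> - euler_path t \<omega>)) \<le> ennreal (norm (Z t \<omega> - e)) + ennreal (norm (\<xi> \<omega> + A t \<omega> - euler_path t \<omega>))"
          by (simp add: ennreal_leI flip: ennreal_plus)
        also have "\<dots> \<le> R1 t \<omega> + Q + ennreal (norm (\<xi> \<omega> + A t \<omega> - euler_path t \<omega>))"
          by (intro add_right_mono main)
        also have "\<dots> = R t \<omega> + Q" by (simp add: R_def ac_simps)
        finally show "ennreal (norm (Z t \<omega> - euler_path t \<omega>)) \<le> R t \<omega>
            + (\<integral>\<^sup>+s\<in>{0..t}. ennreal (norm (?b s - drift s \<omega>)) \<partial>lborel)"
          by (simp only: Q_def)
      qed
    qed
  qed
qed

end

end

section \<open>Weak convergence by Lipschitz functions\<close>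

text \<open>The Pasch--Hausdorff envelope \<open>G n x = inf\<^sub>y (g y + n dist x y)\<close>: for large \<open>n\<close> only points \<open>y\<close>
  close to \<open>x\<close> matter in the infimum.\<close>

lemma lipschitz_minorants:
  fixes g :: "'a::euclidean_space \<Rightarrow> real"
  assumes cont: "continuous_on UNIV g" and bound: "\<And>x. \<bar>g x\<bar> \<le> B"
  obtains G :: "nat \<Rightarrow> 'a \<Rightarrow> real" where "\<And>n x. G n x \<le> g x" "\<And>n x. \<bar>G n x\<bar> \<le> B"
    "\<And>n x y. \<bar>G n x - G n y\<bar> \<le> real n * dist x y" "\<And>x. (\<lambda>n. G n x) \<longlonglongrightarrow> g x"
proof -
  define G where "G n x = (INF y. g y + real n * dist x y)" for n x
  have lower: "- B \<le> g y + real n * dist x y" for n x y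
    using bound[of y] by (simp add: add_increasing2 abs_le_iff)
  have bdd: "bdd_below (range (\<lambda>y. g y + real n * dist x y))" for n x
    using lower by (intro bdd_belowI2) auto
  have le: "G n x \<le> g y + real n * dist x y" for n x y
    unfolding G_def by (intro cINF_lower bdd) simp
  have le_g: "G n x \<le> g x" for n x
    using le[of n x x] by simp
  have ge: "- B \<le> G n x" for n x
    unfolding G_def by (intro cINF_greatest lower) simp
  have lip: "G n x \<le> G n y + real n * dist x y" for n x y
  proof -
    have "G n x - real n * dist x y \<le> g z + real n * dist y z" for z
    proof -
      have "real n * dist x z \<le> real n * (dist x y + dist y z)"
        by (intro mult_left_mono dist_triangle) simp
      with le[of n x z] show ?thesis by (simp add: distrib_left)
    qed
    then have "G n x - real n * dist x y \<le> G n y"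
      unfolding G_def[of n y] by (intro cINF_greatest) auto
    then show ?thesis by simp
  qed
  have lim: "(\<lambda>n. G n x) \<longlonglongrightarrow> g x" for x
  proof (rule tendstoI)
    fix e :: real assume "e > 0"
    obtain d where "d > 0" and d: "\<And>y. dist y x < d \<Longrightarrow> dist (g y) (g x) < e / 2"
      using cont \<open>e > 0\<close> unfolding continuous_on_iff by (metis UNIV_I half_gt_zero)
    have "\<forall>\<^sub>F n in sequentially. real n \<ge> 2 * B / d"
      using eventually_ge_at_top[of "nat \<lceil>2 * B / d\<rceil>"] by eventually_elim linarith
    then show "\<forall>\<^sub>F n in sequentially. dist (G n x) (g x) < e"
    proof eventually_elim
      case (elim n)
      have "g x - e / 2 \<le> g y + real n * dist x y" for y
      proof (cases "dist y x < d")
        case True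
        then have "\<bar>g y - g x\<bar> < e / 2"
          using d by (simp only: dist_real_def)
        then have "g x - e / 2 \<le> g y" by linarith
        then show ?thesis by (simp add: add_increasing2)
      next
        case False
        have "2 * B = 2 * B / d * d" using \<open>d > 0\<close> by simp
        also have "\<dots> \<le> real n * dist x y"
          using False elim \<open>d > 0\<close> by (intro mult_mono) (auto simp: dist_commute)
        finally show ?thesis using bound[of x] bound[of y] \<open>e > 0\<close> by (simp add: abs_le_iff)
      qed
      then have "g x - e / 2 \<le> G n x"
        unfolding G_def by (intro cINF_greatest) auto
      then show ?case using le_g[of n x] \<open>e > 0\<close> by (simp add: dist_real_def)
    qed
  qed
  show ?thesis
  proof (rule that[of G])
    show "\<bar>G n x\<bar> \<le> B" for n x
      using ge[of n x] le_g[of n x] bound[of x] by (simp add: abs_le_iff)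
    show "\<bar>G n x - G n y\<bar> \<le> real n * dist x y" for n x y
      using lip[of n x y] lip[of n y x] by (simp add: abs_le_iff dist_commute)
  qed (use le_g lim in auto)
qed

text \<open>Lipschitz functions below \<open>g\<close> that converge pointwise to \<open>g\<close> show that eventually the integrals of
  \<open>g\<close> do not fall below the limit by more than \<open>e\<close>. The other inequality is the same statement for \<open>- g\<close>.\<close>

lemma weakly_converges_if_lipschitz:
  fixes \<mu> :: "'i \<Rightarrow> 'a::euclidean_space measure"
  assumes \<mu>: "\<forall>\<^sub>F i in A. prob_space (\<mu> i) \<and> sets (\<mu> i) = sets borel"
    and \<nu>: "prob_space \<nu>" "sets \<nu> = sets borel"
    and lip: "\<And>g L B. L \<ge> 0 \<Longrightarrow> (\<And>x y. \<bar>g x - g y\<bar> \<le> L * dist x y) \<Longrightarrow> (\<And>x. \<bar>g x\<bar> \<le> B) \<Longrightarrow>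
      ((\<lambda>i. \<integral>x. g x \<partial>\<mu> i) \<longlongrightarrow> (\<integral>x. g x \<partial>\<nu>)) A"
  shows "weakly_converges \<mu> \<nu> A"
proof -
  have int: "integrable M g" if "prob_space M" "sets M = sets borel" "g \<in> borel_measurable borel" "\<And>x. \<bar>g x\<bar> \<le> B"
    for M :: "'a measure" and g :: "'a \<Rightarrow> real" and B
  proof -
    interpret prob_space M by fact
    note [measurable_cong] = that(2) and [measurable] = that(3)
    show ?thesis using that(4) by (intro integrable_const_bound[where B=B]) auto
  qed
  have lower: "\<forall>\<^sub>F i in A. (\<integral>x. g x \<partial>\<nu>) - e < (\<integral>x. g x \<partial>\<mu> i)"
    if cont: "continuous_on UNIV g" and bound: "\<And>x. \<bar>g x\<bar> \<le> B" and "e > 0" for g :: "'a \<Rightarrow> real" and B e :: real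
  proof -
    obtain G :: "nat \<Rightarrow> 'a \<Rightarrow> real" where G: "\<And>n x. G n x \<le> g x" "\<And>n x. \<bar>G n x\<bar> \<le> B"
      "\<And>n x y. \<bar>G n x - G n y\<bar> \<le> real n * dist x y" "\<And>x. (\<lambda>n. G n x) \<longlonglongrightarrow> g x"
      using lipschitz_minorants[OF cont bound] by blast
    have gm[measurable]: "g \<in> borel_measurable borel"
      using cont by (rule borel_measurable_continuous_onI)
    have Gm[measurable]: "G n \<in> borel_measurable borel" for n
    proof -
      have "(real n)-lipschitz_on UNIV (G n)"
        using G(3) by (intro lipschitz_onI) (auto simp: dist_real_def)
      then show ?thesis by (intro borel_measurable_continuous_onI lipschitz_on_continuous_on)
    qed
    note [measurable_cong] = \<nu>(2)
    interpret \<nu>: prob_space \<nu> by fact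
    have "(\<lambda>n. \<integral>x. G n x \<partial>\<nu>) \<longlonglongrightarrow> (\<integral>x. g x \<partial>\<nu>)"
      by (rule integral_dominated_convergence[where w="\<lambda>_. B"]) (use G in auto)
    then have "\<forall>\<^sub>F n in sequentially. (\<integral>x. g x \<partial>\<nu>) - e / 2 < (\<integral>x. G n x \<partial>\<nu>)"
      using \<open>e > 0\<close> by (intro order_tendstoD) auto
    then obtain n where n: "(\<integral>x. g x \<partial>\<nu>) - e / 2 < (\<integral>x. G n x \<partial>\<nu>)"
      by (metis eventually_happens trivial_limit_sequentially)
    have "((\<lambda>i. \<integral>x. G n x \<partial>\<mu> i) \<longlongrightarrow> (\<integral>x. G n x \<partial>\<nu>)) A"
      by (rule lip[of "real n"]) (use G in auto)
    then have "\<forall>\<^sub>F i in A. (\<integral>x. G n x \<partial>\<nu>) - e / 2 < (\<integral>x. G n x \<partial>\<mu> i)"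
      using \<open>e > 0\<close> by (intro order_tendstoD) auto
    then show ?thesis
      using \<mu>
    proof eventually_elim
      case (elim i)
      have "(\<integral>x. G n x \<partial>\<mu> i) \<le> (\<integral>x. g x \<partial>\<mu> i)"
        using elim(2) G bound by (intro integral_mono int[where B=B]) auto
      with n elim(1) show ?case by linarith
    qed
  qed
  show ?thesis
    unfolding weakly_converges_def
  proof (intro allI impI)
    fix g :: "'a \<Rightarrow> real" assume cont: "continuous_on UNIV g" and "bounded (range g)"
    then obtain B where B: "\<And>x. \<bar>g x\<bar> \<le> B" by (auto simp: bounded_iff)
    show "((\<lambda>i. \<integral>x. g x \<partial>\<mu> i) \<longlongrightarrow> (\<integral>x. g x \<partial>\<nu>)) A"
    proof (rule tendstoI)
      fix e :: real assume "e > 0"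
      have "\<forall>\<^sub>F i in A. (\<integral>x. - g x \<partial>\<nu>) - e < (\<integral>x. - g x \<partial>\<mu> i)"
        using B \<open>e > 0\<close> by (intro lower[where B=B] continuous_on_minus cont) auto
      with lower[OF cont B \<open>e > 0\<close>]
      show "\<forall>\<^sub>F i in A. dist (\<integral>x. g x \<partial>\<mu> i) (\<integral>x. g x \<partial>\<nu>) < e"
        by eventually_elim (auto simp: dist_real_def abs_less_iff)
    qed
  qed
qed

lemma lipschitz_integral_diff_le:
  fixes X Y :: "'w \<Rightarrow> 'a::euclidean_space" and g :: "'a \<Rightarrow> real"
  assumes M: "prob_space M" and [measurable]: "X \<in> borel_measurable M" "Y \<in> borel_measurable M"
    and "L \<ge> 0" "\<epsilon> \<ge> 0" and g: "\<And>x y. \<bar>g x - g y\<bar> \<le> L * dist x y" "\<And>x. \<bar>g x\<bar> \<le> B"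
    and dist: "(\<integral>\<^sup>+\<omega>. ennreal (norm (X \<omega> - Y \<omega>)) \<partial>M) \<le> ennreal \<epsilon>"
  shows "\<bar>(\<integral>x. g x \<partial>distr M borel X) - (\<integral>x. g x \<partial>distr M borel Y)\<bar> \<le> L * \<epsilon>"
proof -
  interpret prob_space M by fact
  have "L-lipschitz_on UNIV g"
    using g(1) \<open>L \<ge> 0\<close> by (intro lipschitz_onI) (auto simp: dist_real_def)
  then have [measurable]: "g \<in> borel_measurable borel"
    by (intro borel_measurable_continuous_onI lipschitz_on_continuous_on)
  have i: "integrable M (\<lambda>\<omega>. g (X \<omega>))" "integrable M (\<lambda>\<omega>. g (Y \<omega>))"
    using g(2) by (auto intro!: integrable_const_bound[where B=B])
  have "ennreal \<bar>\<integral>\<omega>. g (X \<omega>) - g (Y \<omega>) \<partial>M\<bar> \<le> (\<integral>\<^sup>+\<omega>. ennreal (norm (g (X \<omega>) - g (Y \<omega>))) \<partial>M)"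
    using integral_norm_bound_ennreal[OF Bochner_Integration.integrable_diff[OF i]] by simp
  also have "\<dots> \<le> (\<integral>\<^sup>+\<omega>. ennreal L * ennreal (norm (X \<omega> - Y \<omega>)) \<partial>M)"
    using g(1) \<open>L \<ge> 0\<close> by (intro nn_integral_mono) (simp add: ennreal_leI dist_norm flip: ennreal_mult')
  also have "\<dots> = ennreal L * (\<integral>\<^sup>+\<omega>. ennreal (norm (X \<omega> - Y \<omega>)) \<partial>M)"
    by (intro nn_integral_cmult) measurable
  also have "\<dots> \<le> ennreal L * ennreal \<epsilon>"
    by (intro mult_left_mono dist) simp
  also have "\<dots> = ennreal (L * \<epsilon>)" using \<open>L \<ge> 0\<close> by (simp add: ennreal_mult')
  finally have "\<bar>\<integral>\<omega>. g (X \<omega>) - g (Y \<omega>) \<partial>M\<bar> \<le> L * \<epsilon>"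
    using \<open>L \<ge> 0\<close> \<open>\<epsilon> \<ge> 0\<close> by (subst (asm) ennreal_le_iff) auto
  then show ?thesis using i by (simp add: integral_distr)
qed

section \<open>The overdamped limit\<close>

context mean_field_sde
begin

context
  fixes K T h :: real
  assumes K_nonneg: "K \<ge> 0" and T_nonneg: "T \<ge> 0" and h_pos: "h > 0"
    and moment: "\<And>k. h * real k \<le> T \<Longrightarrow> (\<integral>\<^sup>+x. ennreal (norm x) \<partial>euler_law h k) \<le> ennreal K"
    and speed: "\<And>k. h * real k \<le> T \<Longrightarrow>
      (\<integral>\<^sup>+x. ennreal (norm (b (euler_law h k) x)) \<partial>euler_law h k) \<le> ennreal K"
begin

lemma overdamped_law_close_to_euler_law:
  fixes Y :: "real \<Rightarrow> 'w \<Rightarrow> real^'n"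
  assumes sol: "overdamped_solution b \<sigma> \<mu>\<^sub>0 M F W Y"
  obtains H where "H \<in> borel_measurable M" "distr M borel H = euler_law h (nat \<lfloor>T / h\<rfloor>)"
    "(\<integral>\<^sup>+\<omega>. ennreal (norm (Y T \<omega> - H \<omega>)) \<partial>M) \<le> ennreal (grid_error K h * (1 + 4 * C * T * exp (4 * C * T)))"
proof -
  have BM: "brownian_motion M F W" and adapted: "\<forall>t\<ge>0. Y t \<in> borel_measurable (F t)"
    and P2: "\<forall>t\<ge>0. distr M borel (Y t) \<in> P2" and init: "distr M borel (Y 0) = \<mu>\<^sub>0"
    and eq: "AE \<omega> in M. continuous_on {0..} (\<lambda>t. Y t \<omega>) \<and>
        (\<forall>t\<ge>0. set_integrable lborel {0..t} (\<lambda>s. b (distr M borel (Y s)) (Y s \<omega>)) \<and>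
           Y t \<omega> = Y 0 \<omega> - (LBINT s:{0..t}. b (distr M borel (Y s)) (Y s \<omega>)) + \<sigma> *\<^sub>R W t \<omega>)"
    using sol unfolding overdamped_solution_def by simp_all
  interpret euler_scheme b C \<sigma> \<mu>\<^sub>0 M F W "Y 0" h
    using BM adapted init h_pos by unfold_locales simp_all
  have path_m: "euler_path T \<in> borel_measurable M" unfolding euler_path_def by measurable
  show ?thesis
  proof (rule that[OF path_m])
    show "distr M borel (euler_path T) = euler_law h (nat \<lfloor>T / h\<rfloor>)"
      by (simp add: euler_path_distr grid_def)
    show "(\<integral>\<^sup>+\<omega>. ennreal (norm (Y T \<omega> - euler_path T \<omega>)) \<partial>M) \<le> ennreal (grid_error K h * (1 + 4 * C * T * exp (4 * C * T)))"
    proof (rule overdamped_close_to_euler[OF K_nonneg T_nonneg moment speed])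
      show "Y t \<in> borel_measurable M" if "t \<ge> 0" for t
        using adapted that measurable_from_subalg[OF subalgebra_F] by blast
      show "distr M borel (Y t) \<in> P2" if "t \<ge> 0" for t using P2 that by simp
      show "AE \<omega> in M. continuous_on {0..} (\<lambda>t. Y t \<omega>)"
        using eq by eventually_elim (rule conjunct1)
      show "AE \<omega> in M. set_integrable lborel {0..T} (\<lambda>s. b (distr M borel (Y s)) (Y s \<omega>))"
        using eq
      proof eventually_elim
        case (elim \<omega>)
        show ?case by (rule conjunct1[OF conjunct2[OF elim, rule_format, OF T_nonneg]])
      qed
      show "AE \<omega> in M. \<forall>t\<in>{0..T}. Y t \<omega> = Y 0 \<omega> - (LBINT s:{0..t}. b (distr M borel (Y s)) (Y s \<omega>)) + \<sigma> *\<^sub>R W t \<omega>"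
        using eq
      proof eventually_elim
        case (elim \<omega>)
        show ?case
        proof
          fix t assume "t \<in> {0..T}"
          then have "t \<ge> 0" by simp
          then show "Y t \<omega> = Y 0 \<omega> - (LBINT s:{0..t}. b (distr M borel (Y s)) (Y s \<omega>)) + \<sigma> *\<^sub>R W t \<omega>"
            by (rule conjunct2[OF conjunct2[OF elim, rule_format]])
        qed
      qed
    qed
  qed
qed

text \<open>After the substitution \<open>s \<mapsto> \<gamma> s\<close>, the underdamped equation is a relaxation with rate \<open>\<gamma>\<^sup>2\<close> and
  displacement \<open>V 0 / \<gamma>\<close>. The parameter \<open>\<delta> = 1 / \<gamma>\<close> of \<open>relaxation_close_to_euler\<close> is the square root
  of the memory, so that the averaged oscillation of the noise is of order \<open>1 / \<gamma>\<close>.\<close>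

lemma underdamped_law_close_to_euler_law:
  fixes X V :: "real \<Rightarrow> 'w \<Rightarrow> real^'n"
  assumes sol: "underdamped_solution b \<gamma> (\<sigma> * sqrt \<gamma>) m\<^sub>0 M F W X V"
    and "\<gamma> > 0" and fst: "distr m\<^sub>0 borel fst = \<mu>\<^sub>0"
    and "m \<ge> 0" and snd: "(\<integral>\<^sup>+z. ennreal (norm (snd z)) \<partial>m\<^sub>0) \<le> ennreal m"
  obtains H where "H \<in> borel_measurable M" "distr M borel H = euler_law h (nat \<lfloor>T / h\<rfloor>)"
    "(\<integral>\<^sup>+\<omega>. ennreal (norm (X (\<gamma> * T) \<omega> - H \<omega>)) \<partial>M)
      \<le> ennreal ((m / \<gamma> + \<sigma> / \<gamma> + (K + \<sigma> * real CARD('n) * \<gamma>) / \<gamma>\<^sup>2 + grid_error K h) * (1 + 4 * C * T * exp (4 * C * T)))"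
proof -
  have BM0: "brownian_motion M F W"
    and adapted: "\<forall>t\<ge>0. X t \<in> borel_measurable (F t) \<and> V t \<in> borel_measurable (F t)"
    and P2: "\<forall>t\<ge>0. distr M borel (X t) \<in> P2" and init: "distr M borel (\<lambda>\<omega>. (X 0 \<omega>, V 0 \<omega>)) = m\<^sub>0"
    and eq: "AE \<omega> in M. continuous_on {0..} (\<lambda>t. X t \<omega>) \<and> continuous_on {0..} (\<lambda>t. V t \<omega>) \<and>
        (\<forall>t\<ge>0.
           set_integrable lborel {0..t} (\<lambda>s. b (distr M borel (X s)) (X s \<omega>) + \<gamma> *\<^sub>R V s \<omega>) \<and>
           X t \<omega> = X 0 \<omega> + (LBINT s:{0..t}. V s \<omega>) \<and>
           V t \<omega> = V 0 \<omega> - (LBINT s:{0..t}. b (distr M borel (X s)) (X s \<omega>) + \<gamma> *\<^sub>R V s \<omega>)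
                   + (\<sigma> * sqrt \<gamma>) *\<^sub>R W t \<omega>)"
    using sol unfolding underdamped_solution_def by simp_all
  define Z where "Z t = X (\<gamma> * t)" for t
  define W' where "W' t \<omega> = W (\<gamma> * t) \<omega> /\<^sub>R sqrt \<gamma>" for t \<omega>
  define v where "v t \<omega> = \<gamma> *\<^sub>R V (\<gamma> * t) \<omega>" for t \<omega>
  define p where "p \<omega> = V 0 \<omega> /\<^sub>R \<gamma>" for \<omega>
  have sub0: "subalgebra M (F t)" for t using BM0 by (simp add: brownian_motion_def)
  have X_m[measurable]: "X t \<in> borel_measurable M" and V_m[measurable]: "V t \<in> borel_measurable M" if "t \<ge> 0" for t
    using adapted that measurable_from_subalg[OF sub0] by blast+
  have XV0[measurable]: "X 0 \<in> borel_measurable M" "V 0 \<in> borel_measurable M"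
    using X_m[of 0] V_m[of 0] by auto
  have pair[measurable]: "(\<lambda>\<omega>. (X 0 \<omega>, V 0 \<omega>)) \<in> borel_measurable M" by simp
  have proj[measurable]: "fst \<in> borel_measurable (borel :: ((real^'n) \<times> (real^'n)) measure)"
      "snd \<in> borel_measurable (borel :: ((real^'n) \<times> (real^'n)) measure)"
    by (auto intro!: borel_measurable_continuous_onI continuous_intros)
  have X0: "distr M borel (X 0) = \<mu>\<^sub>0"
    unfolding fst[symmetric] init[symmetric] by (subst distr_distr) (auto simp: comp_def)
  have V0: "(\<integral>\<^sup>+\<omega>. ennreal (norm (V 0 \<omega>)) \<partial>M) \<le> ennreal m"
    using snd unfolding init[symmetric] by (subst (asm) nn_integral_distr) auto
  interpret euler_scheme b C \<sigma> \<mu>\<^sub>0 M "\<lambda>t. F (\<gamma> * t)" W' "X 0" h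
  proof
    show "brownian_motion M (\<lambda>t. F (\<gamma> * t)) W'"
      unfolding W'_def by (rule brownian_scaling[OF BM0 \<open>\<gamma> > 0\<close>])
    show "X 0 \<in> borel_measurable (F (\<gamma> * 0))" using adapted by simp
  qed (use X0 h_pos in auto)
  have path_m: "euler_path T \<in> borel_measurable M" unfolding euler_path_def by measurable
  show ?thesis
  proof (rule that[OF path_m])
    show "distr M borel (euler_path T) = euler_law h (nat \<lfloor>T / h\<rfloor>)"
      by (simp add: euler_path_distr grid_def)
    have Z_cont: "AE \<omega> in M. continuous_on {0..} (\<lambda>t. Z t \<omega>)"
      using eq
    proof eventually_elim
      case (elim \<omega>)
      show ?case
        unfolding Z_def
      proof (rule continuous_on_compose2[of "{0..}" "\<lambda>t. X t \<omega>"])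
        show "continuous_on {0..} (\<lambda>t. X t \<omega>)" using elim by (rule conjunct1)
        show "continuous_on {0..} (\<lambda>t. \<gamma> * t)" by (intro continuous_intros)
        show "(*) \<gamma> ` {0..} \<subseteq> {0..}" using \<open>\<gamma> > 0\<close> by auto
      qed
    qed
    have drift_part: "AE \<omega> in M. \<forall>t\<ge>0. set_integrable lborel {0..t} (\<lambda>s. V s \<omega>) \<and>
        set_integrable lborel {0..t} (\<lambda>s. b (distr M borel (X s)) (X s \<omega>))"
      using eq
    proof eventually_elim
      case (elim \<omega>)
      show ?case
      proof (intro allI impI)
        fix t :: real assume "t \<ge> 0"
        have "continuous_on {0..} (\<lambda>t. V t \<omega>)"
          using elim by (rule conjunct1[OF conjunct2])
        then have "continuous_on {0..t} (\<lambda>t. V t \<omega>)"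
          by (rule continuous_on_subset) auto
        then have iV: "set_integrable lborel {0..t} (\<lambda>s. V s \<omega>)"
          by (rule borel_integrable_atLeastAtMost')
        have "set_integrable lborel {0..t} (\<lambda>s. b (distr M borel (X s)) (X s \<omega>) + \<gamma> *\<^sub>R V s \<omega>)"
          by (rule conjunct1[OF elim[THEN conjunct2, THEN conjunct2, rule_format, OF \<open>t \<ge> 0\<close>]])
        then have "set_integrable lborel {0..t}
            (\<lambda>s. (b (distr M borel (X s)) (X s \<omega>) + \<gamma> *\<^sub>R V s \<omega>) - \<gamma> *\<^sub>R V s \<omega>)"
          using iV by (intro set_integral_diff set_integrable_scaleR_right) auto
        with iV show "set_integrable lborel {0..t} (\<lambda>s. V s \<omega>) \<and>
            set_integrable lborel {0..t} (\<lambda>s. b (distr M borel (X s)) (X s \<omega>))" by simp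
      qed
    qed
    have "(\<integral>\<^sup>+\<omega>. ennreal (norm (Z T \<omega> - euler_path T \<omega>)) \<partial>M)
      \<le> ennreal ((m / \<gamma> + \<sigma> * (1 / \<gamma>) + (K + \<sigma> * real CARD('n) / (1 / \<gamma>)) / \<gamma>\<^sup>2 + grid_error K h)
          * (1 + 4 * C * T * exp (4 * C * T)))"
    proof (rule relaxation_close_to_euler[OF K_nonneg T_nonneg moment speed, where p=p and v=v])
      show "Z t \<in> borel_measurable M" if "t \<ge> 0" for t
        unfolding Z_def using that \<open>\<gamma> > 0\<close> by (intro X_m) simp
      show "distr M borel (Z t) \<in> P2" if "t \<ge> 0" for t
        unfolding Z_def using P2 that \<open>\<gamma> > 0\<close> by simp
      show "AE \<omega> in M. continuous_on {0..} (\<lambda>t. Z t \<omega>)" by (rule Z_cont)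
      show "AE \<omega> in M. set_integrable lborel {0..T} (\<lambda>s. b (distr M borel (Z s)) (Z s \<omega>))"
        using drift_part
      proof eventually_elim
        case (elim \<omega>)
        have "set_integrable lborel {0..\<gamma> * T} (\<lambda>s. b (distr M borel (X s)) (X s \<omega>))"
          using elim T_nonneg \<open>\<gamma> > 0\<close> by simp
        then show ?case
          unfolding Z_def by (rule set_integrable_rescale[OF \<open>\<gamma> > 0\<close>])
      qed
      show "p \<in> borel_measurable M" unfolding p_def by measurable
      show "(\<integral>\<^sup>+\<omega>. ennreal (norm (p \<omega>)) \<partial>M) \<le> ennreal (m / \<gamma>)"
      proof -
        have "(\<integral>\<^sup>+\<omega>. ennreal (norm (p \<omega>)) \<partial>M) = (\<integral>\<^sup>+\<omega>. ennreal (1 / \<gamma>) * ennreal (norm (V 0 \<omega>)) \<partial>M)"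
          using \<open>\<gamma> > 0\<close> by (intro nn_integral_cong) (simp add: p_def divide_inverse flip: ennreal_mult')
        also have "\<dots> = ennreal (1 / \<gamma>) * (\<integral>\<^sup>+\<omega>. ennreal (norm (V 0 \<omega>)) \<partial>M)"
          by (intro nn_integral_cmult) measurable
        also have "\<dots> \<le> ennreal (1 / \<gamma>) * ennreal m"
          by (intro mult_left_mono V0) simp
        also have "\<dots> = ennreal (m / \<gamma>)"
          using \<open>\<gamma> > 0\<close> by (simp flip: ennreal_mult')
        finally show ?thesis .
      qed
      show "AE \<omega> in M. Z 0 \<omega> = X 0 \<omega> \<and> continuous_on {0..T} (\<lambda>s. v s \<omega>) \<and>
        (\<forall>t\<in>{0..T}. Z t \<omega> = Z 0 \<omega> + (LBINT s:{0..t}. v s \<omega>) \<and>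
          v t \<omega> = \<gamma>\<^sup>2 *\<^sub>R (X 0 \<omega> + p \<omega> - (LBINT s:{0..t}. b (distr M borel (Z s)) (Z s \<omega>)) + \<sigma> *\<^sub>R W' t \<omega> - Z t \<omega>))"
        using eq drift_part
      proof eventually_elim
        case (elim \<omega>)
        note eqs = elim(1)[THEN conjunct2, THEN conjunct2, rule_format, THEN conjunct2]
        have V_cont: "continuous_on {0..} (\<lambda>t. V t \<omega>)"
          using elim(1) by (rule conjunct1[OF conjunct2])
        have v_cont: "continuous_on {0..T} (\<lambda>s. v s \<omega>)"
        proof -
          have "continuous_on {0..T} (\<lambda>s. V (\<gamma> * s) \<omega>)"
          proof (rule continuous_on_compose2[OF V_cont])
            show "continuous_on {0..T} (\<lambda>t. \<gamma> * t)" by (intro continuous_intros)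
            show "(*) \<gamma> ` {0..T} \<subseteq> {0..}" using \<open>\<gamma> > 0\<close> by auto
          qed
          then show ?thesis
            unfolding v_def by (rule continuous_on_scaleR[OF continuous_on_const])
        qed
        have main: "Z t \<omega> = Z 0 \<omega> + (LBINT s:{0..t}. v s \<omega>) \<and>
            v t \<omega> = \<gamma>\<^sup>2 *\<^sub>R (X 0 \<omega> + p \<omega> - (LBINT s:{0..t}. b (distr M borel (Z s)) (Z s \<omega>)) + \<sigma> *\<^sub>R W' t \<omega> - Z t \<omega>)"
          if "t \<in> {0..T}" for t
        proof
          have t: "0 \<le> \<gamma> * t" using that \<open>\<gamma> > 0\<close> by simp
          define IV Ib where "IV = (LBINT s:{0..\<gamma> * t}. V s \<omega>)" and "Ib = (LBINT s:{0..t}. b (distr M borel (Z s)) (Z s \<omega>))"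
          note ints = elim(2)[rule_format, OF t]
          have Xt: "X (\<gamma> * t) \<omega> = X 0 \<omega> + IV"
            unfolding IV_def by (rule conjunct1[OF eqs[OF t]])
          have "IV = (LBINT s:{0..t}. v s \<omega>)"
            unfolding IV_def v_def set_integral_rescale[OF \<open>\<gamma> > 0\<close>] by (simp add: set_integral_scaleR_right)
          then show "Z t \<omega> = Z 0 \<omega> + (LBINT s:{0..t}. v s \<omega>)"
            using Xt by (simp add: Z_def)
          have "(LBINT s:{0..\<gamma> * t}. b (distr M borel (X s)) (X s \<omega>) + \<gamma> *\<^sub>R V s \<omega>)
              = (LBINT s:{0..\<gamma> * t}. b (distr M borel (X s)) (X s \<omega>)) + (LBINT s:{0..\<gamma> * t}. \<gamma> *\<^sub>R V s \<omega>)"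
            using ints by (intro set_integral_add set_integrable_scaleR_right) auto
          also have "(LBINT s:{0..\<gamma> * t}. b (distr M borel (X s)) (X s \<omega>)) = \<gamma> *\<^sub>R Ib"
            unfolding Ib_def Z_def by (rule set_integral_rescale[OF \<open>\<gamma> > 0\<close>])
          also have "(LBINT s:{0..\<gamma> * t}. \<gamma> *\<^sub>R V s \<omega>) = \<gamma> *\<^sub>R IV"
            unfolding IV_def by (rule set_integral_scaleR_right)
          finally have Vt: "V (\<gamma> * t) \<omega> = V 0 \<omega> - (\<gamma> *\<^sub>R Ib + \<gamma> *\<^sub>R IV) + (\<sigma> * sqrt \<gamma>) *\<^sub>R W (\<gamma> * t) \<omega>"
            using conjunct2[OF eqs[OF t]] by (simp only:)
          have Vp: "V 0 \<omega> = \<gamma> *\<^sub>R p \<omega>" using \<open>\<gamma> > 0\<close> by (simp add: p_def)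
          have Wt: "(\<sigma> * sqrt \<gamma>) *\<^sub>R W (\<gamma> * t) \<omega> = \<gamma> *\<^sub>R (\<sigma> *\<^sub>R W' t \<omega>)"
          proof -
            have "\<gamma> / sqrt \<gamma> = sqrt \<gamma>" using \<open>\<gamma> > 0\<close> by (simp add: real_div_sqrt)
            then have "\<sigma> * sqrt \<gamma> = \<gamma> * (\<sigma> * inverse (sqrt \<gamma>))"
              by (metis divide_inverse mult.left_commute)
            then show ?thesis by (simp only: W'_def scaleR_scaleR)
          qed
          have IV: "IV = Z t \<omega> - X 0 \<omega>" using Xt by (simp add: Z_def)
          have "v t \<omega> = \<gamma> *\<^sub>R (\<gamma> *\<^sub>R p \<omega> - (\<gamma> *\<^sub>R Ib + \<gamma> *\<^sub>R (Z t \<omega> - X 0 \<omega>)) + \<gamma> *\<^sub>R (\<sigma> *\<^sub>R W' t \<omega>))"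
            unfolding v_def Vt unfolding Vp Wt IV ..
          also have "\<dots> = \<gamma>\<^sup>2 *\<^sub>R (X 0 \<omega> + p \<omega> - Ib + \<sigma> *\<^sub>R W' t \<omega> - Z t \<omega>)"
            by (simp add: power2_eq_square algebra_simps)
          finally show "v t \<omega> = \<gamma>\<^sup>2 *\<^sub>R (X 0 \<omega> + p \<omega> - (LBINT s:{0..t}. b (distr M borel (Z s)) (Z s \<omega>)) + \<sigma> *\<^sub>R W' t \<omega> - Z t \<omega>)"
            unfolding Ib_def .
        qed
        have "Z 0 \<omega> = X 0 \<omega>" by (simp add: Z_def)
        with v_cont main show ?case by blast
      qed
    qed (use \<open>\<gamma> > 0\<close> \<open>m \<ge> 0\<close> in simp_all)
    then show "(\<integral>\<^sup>+\<omega>. ennreal (norm (X (\<gamma> * T) \<omega> - euler_path T \<omega>)) \<partial>M)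
      \<le> ennreal ((m / \<gamma> + \<sigma> / \<gamma> + (K + \<sigma> * real CARD('n) * \<gamma>) / \<gamma>\<^sup>2 + grid_error K h) * (1 + 4 * C * T * exp (4 * C * T)))"
      by (simp add: Z_def)
  qed
qed

end

end

theorem corollary2p13:
  fixes \<sigma>\<^sub>0 lam :: real
    and F\<^sub>0 :: "(real^'n) measure \<Rightarrow> real"
    and f :: "real^'n \<Rightarrow> real"
    and m\<^sub>0 :: "((real^'n) \<times> (real^'n)) measure"
    and M :: "real \<Rightarrow> 'w measure" and \<F> :: "real \<Rightarrow> real \<Rightarrow> 'w measure"
    and W X V :: "real \<Rightarrow> real \<Rightarrow> 'w \<Rightarrow> real^'n"
    and N :: "'u measure" and \<G> :: "real \<Rightarrow> 'u measure"
    and B Y :: "real \<Rightarrow> 'u \<Rightarrow> real^'n"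
  assumes "\<sigma>\<^sub>0 > 0" and "lam > 0"
    and "\<And>\<mu>. \<mu> \<in> P2 \<Longrightarrow> F\<^sub>0 \<mu> \<ge> 0" and "class_Cinf F\<^sub>0"
    and "\<And>x. f x \<ge> 0" and "smooth_fun f" and "\<And>x. f x \<ge> lam * (norm x)\<^sup>2"
    and "\<And>k. k \<ge> 2 \<Longrightarrow> bounded_higher_Dm F\<^sub>0 f k"
    and "\<exists>C. \<forall>\<mu>\<^sub>1\<in>P2. \<forall>\<mu>\<^sub>2\<in>P2. \<forall>x\<^sub>1 x\<^sub>2.
           norm (Dm F\<^sub>0 f \<mu>\<^sub>1 x\<^sub>1 - Dm F\<^sub>0 f \<mu>\<^sub>2 x\<^sub>2) \<le> C * (wasserstein 1 \<mu>\<^sub>1 \<mu>\<^sub>2 + norm (x\<^sub>1 - x\<^sub>2))"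
    and "prob_space m\<^sub>0" and "sets m\<^sub>0 = sets borel"
    and "\<And>p::real. p \<ge> 1 \<Longrightarrow> integrable m\<^sub>0 (\<lambda>z. norm (fst z) powr p + norm (snd z) powr p)"
    and "entropy_H m\<^sub>0 < \<infinity>" and "free_energy F\<^sub>0 f \<sigma>\<^sub>0 m\<^sub>0 < \<infinity>"
    and "\<And>\<gamma>. \<gamma> > 0 \<Longrightarrow>
           underdamped_solution (Dm F\<^sub>0 f) \<gamma> (\<sigma>\<^sub>0 * sqrt \<gamma>) m\<^sub>0 (M \<gamma>) (\<F> \<gamma>) (W \<gamma>) (X \<gamma>) (V \<gamma>)"
    and "overdamped_solution (Dm F\<^sub>0 f) \<sigma>\<^sub>0 (distr m\<^sub>0 borel fst) N \<G> B Y"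
  shows "\<forall>t\<ge>0. weakly_converges (\<lambda>\<gamma>. distr (M \<gamma>) borel (X \<gamma> (\<gamma> * t))) (distr N borel (Y t)) at_top"
proof (intro allI impI)
  fix t :: real assume "t \<ge> 0"
  let ?b = "Dm F\<^sub>0 f" and ?\<mu> = "distr m\<^sub>0 borel fst"
  note underdamped = assms(15) and overdamped = assms(16)
  obtain C\<^sub>0 where C\<^sub>0: "\<forall>\<mu>\<^sub>1\<in>P2. \<forall>\<mu>\<^sub>2\<in>P2. \<forall>x\<^sub>1 x\<^sub>2.
      norm (?b \<mu>\<^sub>1 x\<^sub>1 - ?b \<mu>\<^sub>2 x\<^sub>2) \<le> C\<^sub>0 * (wasserstein 1 \<mu>\<^sub>1 \<mu>\<^sub>2 + norm (x\<^sub>1 - x\<^sub>2))"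
    using assms(9) by (rule exE)
  \<comment> \<open>the given constant may fail to be positive\<close>
  define C where "C = max 1 C\<^sub>0"
  have BM: "brownian_motion N \<G> B" and Y_adapted: "\<forall>t\<ge>0. Y t \<in> borel_measurable (\<G> t)"
    and Y_P2: "\<forall>t\<ge>0. distr N borel (Y t) \<in> P2" and Y_init: "distr N borel (Y 0) = ?\<mu>"
    using overdamped unfolding overdamped_solution_def by simp_all
  interpret mean_field_sde ?b C \<sigma>\<^sub>0 ?\<mu>
  proof
    show "0 < C" by (simp add: C_def)
    show "0 \<le> \<sigma>\<^sub>0" using assms(1) by simp
    have "distr N borel (Y 0) \<in> P2" using Y_P2 by simp
    then show "?\<mu> \<in> P2" by (simp only: Y_init)
    fix \<mu> \<nu> :: "(real^'n) measure" and x y :: "real^'n" assume "\<mu> \<in> P2" "\<nu> \<in> P2"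
    then have "norm (?b \<mu> x - ?b \<nu> y) \<le> C\<^sub>0 * (wasserstein 1 \<mu> \<nu> + norm (x - y))"
      by (rule C\<^sub>0[rule_format])
    also have "\<dots> \<le> C * (wasserstein 1 \<mu> \<nu> + norm (x - y))"
      by (intro mult_right_mono) (simp_all add: C_def wasserstein_def)
    finally show "norm (?b \<mu> x - ?b \<nu> y) \<le> C * (wasserstein 1 \<mu> \<nu> + norm (x - y))" .
  qed
  obtain K where "K \<ge> 0"
    and moment: "\<And>h k. h > 0 \<Longrightarrow> h * real k \<le> t \<Longrightarrow> (\<integral>\<^sup>+x. ennreal (norm x) \<partial>euler_law h k) \<le> ennreal K"
    and speed: "\<And>h k. h > 0 \<Longrightarrow> h * real k \<le> t \<Longrightarrow>
      (\<integral>\<^sup>+x. ennreal (norm (?b (euler_law h k) x)) \<partial>euler_law h k) \<le> ennreal K"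
  proof -
    have "Y 0 \<in> borel_measurable (\<G> 0)" using Y_adapted by simp
    then show ?thesis
      by (rule euler_moments_bounded[OF BM _ Y_init, of t]) (rule that)
  qed
  obtain m where "m \<ge> 0" and m: "(\<integral>\<^sup>+z. ennreal (norm (snd z)) \<partial>m\<^sub>0) \<le> ennreal m"
  proof -
    have "integrable m\<^sub>0 (\<lambda>z. norm (fst z) + norm (snd z))"
      using assms(12)[of 1] by simp
    then have "(\<integral>\<^sup>+z. ennreal (norm (norm (fst z) + norm (snd z))) \<partial>m\<^sub>0) < \<infinity>"
      by (simp only: integrable_iff_bounded)
    moreover have "(\<integral>\<^sup>+z. ennreal (norm (snd z)) \<partial>m\<^sub>0) \<le> (\<integral>\<^sup>+z. ennreal (norm (norm (fst z) + norm (snd z))) \<partial>m\<^sub>0)"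
      by (intro nn_integral_mono ennreal_leI) simp
    ultimately have "(\<integral>\<^sup>+z. ennreal (norm (snd z)) \<partial>m\<^sub>0) < \<infinity>" by (rule le_less_trans[rotated])
    then have "(\<integral>\<^sup>+z. ennreal (norm (snd z)) \<partial>m\<^sub>0) \<le> ennreal (enn2real (\<integral>\<^sup>+z. ennreal (norm (snd z)) \<partial>m\<^sub>0))"
      by (simp add: ennreal_enn2real)
    then show ?thesis by (rule that[rotated]) simp
  qed
  define G where "G = 1 + 4 * C * t * exp (4 * C * t)"
  have G: "G \<ge> 0" using C_pos \<open>t \<ge> 0\<close> by (simp add: G_def)
  define \<epsilon> where "\<epsilon> \<gamma> = m / \<gamma> + \<sigma>\<^sub>0 / \<gamma> + (K + \<sigma>\<^sub>0 * real CARD('n) * \<gamma>) / \<gamma>\<^sup>2" for \<gamma>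
  have \<epsilon>_nonneg: "\<epsilon> \<gamma> \<ge> 0" if "\<gamma> > 0" for \<gamma>
    using that \<open>m \<ge> 0\<close> \<open>K \<ge> 0\<close> \<sigma>_nonneg by (simp add: \<epsilon>_def)
  have \<epsilon>_lim: "(\<epsilon> \<longlongrightarrow> 0) at_top"
  proof (rule Lim_transform_eventually)
    have inv: "((\<lambda>\<gamma>::real. inverse \<gamma>) \<longlongrightarrow> 0) at_top"
      by (rule tendsto_inverse_0_at_top[OF filterlim_ident])
    have "((\<lambda>\<gamma>. (m + \<sigma>\<^sub>0 + \<sigma>\<^sub>0 * real CARD('n)) * inverse \<gamma> + K * (inverse \<gamma>)\<^sup>2) \<longlongrightarrow>
        (m + \<sigma>\<^sub>0 + \<sigma>\<^sub>0 * real CARD('n)) * 0 + K * 0\<^sup>2) at_top"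
      by (intro tendsto_intros inv)
    then show "((\<lambda>\<gamma>. (m + \<sigma>\<^sub>0 + \<sigma>\<^sub>0 * real CARD('n)) * inverse \<gamma> + K * (inverse \<gamma>)\<^sup>2) \<longlongrightarrow> 0) at_top"
      by simp
    show "\<forall>\<^sub>F \<gamma> in at_top. (m + \<sigma>\<^sub>0 + \<sigma>\<^sub>0 * real CARD('n)) * inverse \<gamma> + K * (inverse \<gamma>)\<^sup>2 = \<epsilon> \<gamma>"
      using eventually_gt_at_top[of "0::real"]
      by eventually_elim (simp add: \<epsilon>_def field_simps power2_eq_square)
  qed
  have grid_lim: "((\<lambda>h. grid_error K h) \<longlongrightarrow> 0) (at_right 0)"
  proof (rule Lim_transform_eventually)
    have "((\<lambda>h::real. \<sigma>\<^sub>0 * sqrt h + K * h + \<sigma>\<^sub>0 * real CARD('n) * sqrt h) \<longlongrightarrow>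
        \<sigma>\<^sub>0 * sqrt 0 + K * 0 + \<sigma>\<^sub>0 * real CARD('n) * sqrt 0) (at_right 0)"
      by (intro tendsto_intros)
    then show "((\<lambda>h::real. \<sigma>\<^sub>0 * sqrt h + K * h + \<sigma>\<^sub>0 * real CARD('n) * sqrt h) \<longlongrightarrow> 0) (at_right 0)"
      by simp
    show "\<forall>\<^sub>F h in at_right 0. \<sigma>\<^sub>0 * sqrt h + K * h + \<sigma>\<^sub>0 * real CARD('n) * sqrt h = grid_error K h"
      using eventually_at_right_less[of "0::real"]
    proof eventually_elim
      case (elim h)
      have "\<sigma>\<^sub>0 * real CARD('n) / sqrt h * h = \<sigma>\<^sub>0 * real CARD('n) * (h / sqrt h)" by simp
      also have "h / sqrt h = sqrt h" using elim by (simp add: real_div_sqrt)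
      finally show ?case by (simp add: grid_error_def distrib_right)
    qed
  qed
  have X_prob: "prob_space (M \<gamma>)" and X_meas: "X \<gamma> (\<gamma> * t) \<in> borel_measurable (M \<gamma>)" if "\<gamma> > 0" for \<gamma>
  proof -
    have *: "brownian_motion (M \<gamma>) (\<F> \<gamma>) (W \<gamma>)" "\<forall>t\<ge>0. X \<gamma> t \<in> borel_measurable (\<F> \<gamma> t) \<and> V \<gamma> t \<in> borel_measurable (\<F> \<gamma> t)"
      using underdamped[OF that] unfolding underdamped_solution_def by simp_all
    then show "prob_space (M \<gamma>)" by (simp add: brownian_motion_def)
    have "subalgebra (M \<gamma>) (\<F> \<gamma> (\<gamma> * t))" using *(1) by (simp add: brownian_motion_def)
    moreover have "0 \<le> \<gamma> * t" using that \<open>t \<ge> 0\<close> by simp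
    ultimately show "X \<gamma> (\<gamma> * t) \<in> borel_measurable (M \<gamma>)"
      using *(2) by (auto intro: measurable_from_subalg)
  qed
  have N: "prob_space N" using BM by (simp add: brownian_motion_def)
  have Y_meas: "Y t \<in> borel_measurable N"
  proof -
    have "subalgebra N (\<G> t)" using BM by (simp add: brownian_motion_def)
    then show ?thesis
      by (rule measurable_from_subalg) (use Y_adapted \<open>t \<ge> 0\<close> in simp)
  qed
  show "weakly_converges (\<lambda>\<gamma>. distr (M \<gamma>) borel (X \<gamma> (\<gamma> * t))) (distr N borel (Y t)) at_top"
  proof (rule weakly_converges_if_lipschitz)
    show "\<forall>\<^sub>F \<gamma> in at_top. prob_space (distr (M \<gamma>) borel (X \<gamma> (\<gamma> * t))) \<and>
        sets (distr (M \<gamma>) borel (X \<gamma> (\<gamma> * t))) = sets borel"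
      using eventually_gt_at_top[of "0::real"]
      by eventually_elim (simp add: prob_space.prob_space_distr X_prob X_meas)
    show "prob_space (distr N borel (Y t))" "sets (distr N borel (Y t)) = sets borel"
      using N Y_meas by (simp_all add: prob_space.prob_space_distr)
    fix g :: "real^'n \<Rightarrow> real" and L D :: real
    assume "L \<ge> 0" and g: "\<And>x y. \<bar>g x - g y\<bar> \<le> L * dist x y" "\<And>x. \<bar>g x\<bar> \<le> D"
    have close: "\<bar>(\<integral>x. g x \<partial>distr (M \<gamma>) borel (X \<gamma> (\<gamma> * t))) - (\<integral>x. g x \<partial>distr N borel (Y t))\<bar>
        \<le> L * G * \<epsilon> \<gamma> + 2 * L * G * grid_error K h" if "\<gamma> > 0" "h > 0" for \<gamma> h
    proof -
      have ge: "grid_error K h \<ge> 0"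
        using \<open>K \<ge> 0\<close> \<sigma>_nonneg \<open>h > 0\<close> by (simp add: grid_error_def)
      let ?E = "euler_law h (nat \<lfloor>t / h\<rfloor>)"
      obtain H where H: "H \<in> borel_measurable (M \<gamma>)" "distr (M \<gamma>) borel H = ?E"
        "(\<integral>\<^sup>+\<omega>. ennreal (norm (X \<gamma> (\<gamma> * t) \<omega> - H \<omega>)) \<partial>M \<gamma>) \<le> ennreal ((\<epsilon> \<gamma> + grid_error K h) * G)"
        unfolding \<epsilon>_def G_def
        by (rule underdamped_law_close_to_euler_law[OF \<open>K \<ge> 0\<close> \<open>t \<ge> 0\<close> \<open>h > 0\<close> moment[OF \<open>h > 0\<close>] speed[OF \<open>h > 0\<close>]
              underdamped[OF \<open>\<gamma> > 0\<close>] \<open>\<gamma> > 0\<close> refl \<open>m \<ge> 0\<close> m])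
      have 1: "\<bar>(\<integral>x. g x \<partial>distr (M \<gamma>) borel (X \<gamma> (\<gamma> * t))) - (\<integral>x. g x \<partial>?E)\<bar> \<le> L * ((\<epsilon> \<gamma> + grid_error K h) * G)"
        unfolding H(2)[symmetric] using \<epsilon>_nonneg[OF \<open>\<gamma> > 0\<close>] ge G
        by (intro lipschitz_integral_diff_le[OF X_prob[OF \<open>\<gamma> > 0\<close>] X_meas[OF \<open>\<gamma> > 0\<close>] H(1) \<open>L \<ge> 0\<close> _ g H(3)]) simp
      obtain H' where H': "H' \<in> borel_measurable N" "distr N borel H' = ?E"
        "(\<integral>\<^sup>+\<omega>. ennreal (norm (Y t \<omega> - H' \<omega>)) \<partial>N) \<le> ennreal (grid_error K h * G)"
        unfolding G_def
        by (rule overdamped_law_close_to_euler_law[OF \<open>K \<ge> 0\<close> \<open>t \<ge> 0\<close> \<open>h > 0\<close> moment[OF \<open>h > 0\<close>] speed[OF \<open>h > 0\<close>]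
              overdamped])
      have 2: "\<bar>(\<integral>x. g x \<partial>distr N borel (Y t)) - (\<integral>x. g x \<partial>?E)\<bar> \<le> L * (grid_error K h * G)"
        unfolding H'(2)[symmetric] using ge G
        by (intro lipschitz_integral_diff_le[OF N Y_meas H'(1) \<open>L \<ge> 0\<close> _ g H'(3)]) simp
      have "L * ((\<epsilon> \<gamma> + grid_error K h) * G) + L * (grid_error K h * G) = L * G * \<epsilon> \<gamma> + 2 * L * G * grid_error K h"
        by (simp add: algebra_simps)
      with 1 2 show ?thesis by linarith
    qed
    show "((\<lambda>\<gamma>. \<integral>x. g x \<partial>distr (M \<gamma>) borel (X \<gamma> (\<gamma> * t))) \<longlongrightarrow> (\<integral>x. g x \<partial>distr N borel (Y t))) at_top"
    \<comment> \<open>the step \<open>h\<close> is fixed first, as the discretisation error is uniform in \<open>\<gamma>\<close>\<close>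
    proof (rule tendstoI)
      fix e :: real assume "e > 0"
      have "((\<lambda>h. 2 * L * G * grid_error K h) \<longlongrightarrow> 2 * L * G * 0) (at_right 0)"
        by (intro tendsto_intros grid_lim)
      then have "\<forall>\<^sub>F h in at_right 0. 2 * L * G * grid_error K h < e / 2"
        using \<open>e > 0\<close> by (intro order_tendstoD(2)) auto
      then have "\<forall>\<^sub>F h in at_right (0::real). 0 < h \<and> 2 * L * G * grid_error K h < e / 2"
        using eventually_at_right_less[of "0::real"] by eventually_elim simp
      then obtain h where h: "h > 0" "2 * L * G * grid_error K h < e / 2"
        using eventually_happens'[OF trivial_limit_at_right_real] by blast
      have "((\<lambda>\<gamma>. L * G * \<epsilon> \<gamma>) \<longlongrightarrow> L * G * 0) at_top"
        by (intro tendsto_intros \<epsilon>_lim)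
      then have "\<forall>\<^sub>F \<gamma> in at_top. L * G * \<epsilon> \<gamma> < e / 2"
        using \<open>e > 0\<close> by (intro order_tendstoD(2)) auto
      then show "\<forall>\<^sub>F \<gamma> in at_top. dist (\<integral>x. g x \<partial>distr (M \<gamma>) borel (X \<gamma> (\<gamma> * t))) (\<integral>x. g x \<partial>distr N borel (Y t)) < e"
        using eventually_gt_at_top[of "0::real"]
      proof eventually_elim
        case (elim \<gamma>)
        show ?case
          unfolding dist_real_def using close[OF elim(2) h(1)] elim(1) h(2) by linarith
      qed
    qed
  qed
qed

end
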